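(* Let $d\ge1$ and $\Sigma_\mu,\Sigma_\nu\in\mathcal S_d^+$. There exists $O\in\mathcal O_d$ such that $DO^*\Sigma_\mu OD\le O^*\Sigma_\nu O$, where $$D=\mathrm{diag}\left(1\wedge\sqrt{\tfrac{(O^*\Sigma_\nu O)_{11}}{(O^*\Sigma_\mu O)_{11}}},\dots,1\wedge\sqrt{\tfrac{(O^*\Sigma_\nu O)_{dd}}{(O^*\Sigma_\mu O)_{dd}}}\right),$$ with the convention that $1\wedge\sqrt{\frac{(O^*\Sigma_\nu O)_{ii}}{(O^*\Sigma_\mu O)_{ii}}}=1$ when $(O^*\Sigma_\mu O)_{ii}=0$. Moreover, for any such $O\in\mathcal O_d$, $$\mathcal I_2(\Sigma_\mu,\Sigma_\nu)=ODO^*\Sigma_\mu ODO^*,$$ $$\mathbf{bw}^2(\Sigma_\mu,\mathcal I_2(\Sigma_\mu,\Sigma_\nu))=\sum_{i=1}^d\left(\sqrt{(O^*\Sigma_\mu O)_{ii}}-\sqrt{(O^*\Sigma_\nu O)_{ii}}\right)_+^2=\mathbf{bw}^2(\Sigma_\nu,\mathcal J_2(\Sigma_\nu,\Sigma_\mu)),$$ and $\mathcal J_2(\Sigma_\nu,\Sigma_\mu)=O\tilde\Sigma_{\mathcal J}O^*$, where for $1\le i,j\le d$ $$(\tilde\Sigma_{\mathcal J})_{ij}=1_{\{(O^*\Sigma_\nu O)_{ii}(O^*\Sigma_\nu O)_{jj}=0\}}(O^*\Sigma_\mu O)_{ij}+1_{\{(O^*\Sigma_\nu O)_{ii}(O^*\Sigma_\nu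 O)_{jj}>0\}}\frac{(O^*\Sigma_\nu O)_{ij}}{D_{ii}D_{jj}}.$$
   Context: $\mathcal S_d^+$ is the set of real symmetric positive semi-definite $d\times d$ matrices, $\mathcal O_d$ the group of $d\times d$ orthogonal matrices, $O^*$ the transpose, $\le$ between symmetric matrices is the positive semi-definite (Loewner) order, $a\wedge b=\min(a,b)$, and $(a)_+^2=(\max(a,0))^2$. $\mathcal N_d(0,\Sigma)$ is the centered (possibly degenerate) Gaussian distribution on $\mathbb R^d$ with covariance $\Sigma$. $\mathcal P_2(\mathbb R^d)$ is the set of probability measures with finite second moment and $\mathcal W_2$ the quadratic Wasserstein distance. The convex order is defined by $\mu\le_{cx}\nu$ iff $\int f\,d\mu\le\int f\,d\nu$ for every convex $f:\mathbb R^d\to\mathbb R$. The Bures–Wasserstein distance is given by $\mathbf{bw}^2(\Sigma_1,\Sigma_2)=\mathcal W_2^2(\mathcal N_d(0,\Sigma_1),\mathcal N_d(0,\Sigma_2))=\operatorname{tr}\left(\Sigma_1+\Sigma_2-2(\Sigma_1^{1/2}\Sigma_2\Sigma_1^{1/2})^{1/2}\right)$. $\mathcal I_2(\Sigma_\mu,\Sigma_\nu)\in\mathcal S_d^+$ is the matrix such that $\mathcal N_d(0,\mathcal I_2(\Sigma_\mu,\Sigma_\nu))$ is the unique minimizer of $\eta\mapsto\mathcal W_2(\mathcal N_d(0,\Sigma_\mu),\eta)$ over $\{\eta\in\mathcal P_2(\mathbb R^d):\eta\le_{cx}\mathcal N_d(0,\Sigma_\nu)\}$; equivalently it is the unique minimizer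 of $\Sigma\mapsto\mathbf{bw}^2(\Sigma_\mu,\Sigma)$ over $\{\Sigma\in\mathcal S_d^+:\Sigma\le\Sigma_\nu\}$. $\mathcal J_2(\Sigma_\nu,\Sigma_\mu)\in\mathcal S_d^+$ is the matrix such that $\mathcal N_d(0,\mathcal J_2(\Sigma_\nu,\Sigma_\mu))$ is the unique Gaussian distribution among the minimizers of $\eta\mapsto\mathcal W_2(\mathcal N_d(0,\Sigma_\nu),\eta)$ over $\{\eta\in\mathcal P_2(\mathbb R^d):\mathcal N_d(0,\Sigma_\mu)\le_{cx}\eta\}$; equivalently it is the unique minimizer of $\Sigma\mapsto\mathbf{bw}^2(\Sigma_\nu,\Sigma)$ over $\{\Sigma\in\mathcal S_d^+:\Sigma_\mu\le\Sigma\}$. *)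

theory Defs
  imports "HOL-Probability.Probability"
begin

definition psd :: "real^'n^'n \<Rightarrow> bool" where
  "psd A \<longleftrightarrow> transpose A = A \<and> (\<forall>x. 0 \<le> x \<bullet> (A *v x))"

definition loewner_le :: "real^'n^'n \<Rightarrow> real^'n^'n \<Rightarrow> bool" (infix \<open>\<le>\<^sub>L\<close> 50) where
  "A \<le>\<^sub>L B \<longleftrightarrow> psd (B - A)"

definition psd_sqrt :: "real^'n^'n \<Rightarrow> real^'n^'n" where
  "psd_sqrt A = (THE B. psd B \<and> B ** B = A)"

definition bw :: "real^'n^'n \<Rightarrow> real^'n^'n \<Rightarrow> real" where
  "bw A B = sqrt (trace (A + B - 2 *\<^sub>R psd_sqrt (psd_sqrt A ** B ** psd_sqrt A)))"

definition std_gaussian :: "(real^'n) measure" where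
  "std_gaussian = density lborel (\<lambda>x. ennreal (\<Prod>i\<in>UNIV. std_normal_density (x $ i)))"

text \<open>Being the law of \<open>m + S\<^sup>1\<^sup>/\<^sup>2 Z\<close> with \<open>Z\<close> standard Gaussian, this covers singular
  covariance matrices, for which there is no Lebesgue density.\<close>

definition gaussian :: "real^'n \<Rightarrow> real^'n^'n \<Rightarrow> (real^'n) measure" where
  "gaussian m S = distr std_gaussian borel (\<lambda>z. m + psd_sqrt S *v z)"

definition P2 :: "(real^'n) measure set" where
  "P2 = {\<mu>. sets \<mu> = sets borel \<and> prob_space \<mu> \<and> integrable \<mu> (\<lambda>x. (norm x)\<^sup>2)}"

definition couplings ::
  "(real^'n) measure \<Rightarrow> (real^'n) measure \<Rightarrow> ((real^'n) \<times> (real^'n)) measure set" where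
  "couplings \<mu> \<nu> =
     {\<pi>. sets \<pi> = sets borel \<and> distr \<pi> borel fst = \<mu> \<and> distr \<pi> borel snd = \<nu>}"

text \<open>For arguments in \<^const>\<open>P2\<close> the infimum is finite, so that \<^const>\<open>enn2real\<close> loses nothing.\<close>

definition W2 :: "(real^'n) measure \<Rightarrow> (real^'n) measure \<Rightarrow> real" where
  "W2 \<mu> \<nu> =
     sqrt (enn2real (INF \<pi>\<in>couplings \<mu> \<nu>. \<integral>\<^sup>+ (x, y). ennreal ((norm (x - y))\<^sup>2) \<partial>\<pi>))"

text \<open>A convex function is bounded below by an affine one, so for \<open>\<mu>\<close> and \<open>\<nu>\<close> with finite first
  moments its integrals are well defined in \<open>(-\<infinity>, \<infinity>]\<close>, and they are finite exactly when the
  function is integrable. The inequality \<open>\<integral>f d\<mu> \<le> \<integral>f d\<nu>\<close> between such extended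
  values is the implication below; the Bochner integral alone would read \<open>\<infinity>\<close> as \<open>0\<close>.\<close>

definition convex_order :: "(real^'n) measure \<Rightarrow> (real^'n) measure \<Rightarrow> bool" (infix \<open>\<le>\<^sub>c\<^sub>x\<close> 50) where
  "\<mu> \<le>\<^sub>c\<^sub>x \<nu> \<longleftrightarrow>
     (\<forall>f. convex_on UNIV f \<longrightarrow> integrable \<nu> f \<longrightarrow>
        integrable \<mu> f \<and> integral\<^sup>L \<mu> f \<le> integral\<^sup>L \<nu> f)"

definition I2_minimizers :: "real^'n^'n \<Rightarrow> real^'n^'n \<Rightarrow> (real^'n) measure set" where
  "I2_minimizers \<Sigma>\<mu> \<Sigma>\<nu> =
     {\<eta>. is_arg_min (W2 (gaussian 0 \<Sigma>\<mu>)) (\<lambda>\<eta>. \<eta> \<in> P2 \<and> \<eta> \<le>\<^sub>c\<^sub>x gaussian 0 \<Sigma>\<nu>) \<eta>}"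

definition I2 :: "real^'n^'n \<Rightarrow> real^'n^'n \<Rightarrow> real^'n^'n" where
  "I2 \<Sigma>\<mu> \<Sigma>\<nu> = (THE S. psd S \<and> I2_minimizers \<Sigma>\<mu> \<Sigma>\<nu> = {gaussian 0 S})"

definition J2_minimizers :: "real^'n^'n \<Rightarrow> real^'n^'n \<Rightarrow> (real^'n) measure set" where
  "J2_minimizers \<Sigma>\<nu> \<Sigma>\<mu> =
     {\<eta>. is_arg_min (W2 (gaussian 0 \<Sigma>\<nu>)) (\<lambda>\<eta>. \<eta> \<in> P2 \<and> gaussian 0 \<Sigma>\<mu> \<le>\<^sub>c\<^sub>x \<eta>) \<eta>}"

definition J2 :: "real^'n^'n \<Rightarrow> real^'n^'n \<Rightarrow> real^'n^'n" where
  "J2 \<Sigma>\<nu> \<Sigma>\<mu> = (THE S. psd S \<and>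
     J2_minimizers \<Sigma>\<nu> \<Sigma>\<mu> \<inter> {gaussian m S' |m S'. psd S'} = {gaussian 0 S})"

definition conj_by :: "real^'n^'n \<Rightarrow> real^'n^'n \<Rightarrow> real^'n^'n" where
  "conj_by Q A = transpose Q ** A ** Q"

definition Dmat :: "real^'n^'n \<Rightarrow> real^'n^'n \<Rightarrow> real^'n^'n \<Rightarrow> real^'n^'n" where
  "Dmat Q \<Sigma>\<mu> \<Sigma>\<nu> = (\<chi> i j.
     if i \<noteq> j then 0
     else if conj_by Q \<Sigma>\<mu> $ i $ i = 0 then 1
     else min 1 (sqrt (conj_by Q \<Sigma>\<nu> $ i $ i / conj_by Q \<Sigma>\<mu> $ i $ i)))"

definition SigmaJ :: "real^'n^'n \<Rightarrow> real^'n^'n \<Rightarrow> real^'n^'n \<Rightarrow> real^'n^'n" where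
  "SigmaJ Q \<Sigma>\<mu> \<Sigma>\<nu> = (\<chi> i j.
     of_bool (conj_by Q \<Sigma>\<nu> $ i $ i * conj_by Q \<Sigma>\<nu> $ j $ j = 0) * conj_by Q \<Sigma>\<mu> $ i $ j +
     of_bool (conj_by Q \<Sigma>\<nu> $ i $ i * conj_by Q \<Sigma>\<nu> $ j $ j > 0) *
       (conj_by Q \<Sigma>\<nu> $ i $ j / (Dmat Q \<Sigma>\<mu> \<Sigma>\<nu> $ i $ i * Dmat Q \<Sigma>\<mu> \<Sigma>\<nu> $ j $ j)))"

definition admissible :: "real^'n^'n \<Rightarrow> real^'n^'n \<Rightarrow> real^'n^'n \<Rightarrow> bool" where
  "admissible Q \<Sigma>\<mu> \<Sigma>\<nu> \<longleftrightarrow> orthogonal_matrix Q \<and>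
     Dmat Q \<Sigma>\<mu> \<Sigma>\<nu> ** conj_by Q \<Sigma>\<mu> ** Dmat Q \<Sigma>\<mu> \<Sigma>\<nu> \<le>\<^sub>L conj_by Q \<Sigma>\<nu>"

end

theory Submission imports Defs begin

text \<open>
  Write \<open>a\<^sub>i, b\<^sub>i\<close> for the diagonals of \<open>\<Sigma>\<mu>, \<Sigma>\<nu>\<close> in the orthonormal frame given by the
  columns \<open>q\<^sub>i\<close> of \<open>Q\<close>. Existence of an admissible \<open>Q\<close> is duality: \<open>Q\<close> is chosen to maximize
  \<open>\<Sum>\<^sub>i (\<surd>a\<^sub>i - \<surd>b\<^sub>i)\<^sub>+\<^sup>2\<close>, which amounts to minimizing
  \<open>tr (T \<Sigma>\<mu>) + tr (T\<^sup>-\<^sup>1 \<Sigma>\<nu>)\<close> over \<open>0 < T \<le> 1\<close>, and the first order condition under rank one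
  perturbations of \<open>T\<^sup>-\<^sup>1\<close> is \<open>T \<Sigma>\<mu> T \<le> \<Sigma>\<nu>\<close>.

  Optimality and uniqueness need no optimal couplings. If \<open>X\<close> has law \<open>N(0, \<Sigma>\<mu>)\<close> and \<open>Y\<close> is
  dominated by \<open>N(0, \<Sigma>\<nu>)\<close>, then \<open>E (q\<^sub>i \<bullet> Y)\<^sup>2 \<le> b\<^sub>i\<close>, and the Cauchy-Schwarz inequality in each
  direction \<open>q\<^sub>i\<close> gives \<open>E |X - Y|\<^sup>2 \<ge> \<Sum>\<^sub>i (\<surd>a\<^sub>i - \<surd>b\<^sub>i)\<^sub>+\<^sup>2 + E |Y - T X|\<^sup>2\<close> with
  \<open>T = Q D Q\<^sup>*\<close>. So \<open>T X\<close> is optimal, and every minimizer has its law. For the other projection the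
  roles are exchanged: \<open>X\<close> with law \<open>N(0, \<Sigma>\<nu>)\<close> is compared with \<open>R Y\<close>, where \<open>R\<close> is \<open>T\<close> with
  the directions \<open>b\<^sub>i = 0\<close> killed and \<open>\<Sigma>\<nu> = R J R\<close>, \<open>J\<close> being the claimed projection.
  That the candidates are feasible is the implication from the Loewner order to the convex order of centred Gaussians, proved by writing
  the square roots as \<open>A\<^sup>1\<^sup>/\<^sup>2 = B\<^sup>1\<^sup>/\<^sup>2 C\<close> with a contraction \<open>C\<close>, an average of orthogonal
  matrices.
\<close>

subsection \<open>Orthogonal matrices and the spectral theorem\<close>

lemma norm_orthogonal_matrix_row:
  fixes Q :: "real^'n^'n"
  assumes "orthogonal_matrix Q" shows "norm (Q $ i) = 1"
  using assms by (auto simp: orthogonal_matrix_orthonormal_rows row_def)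

lemma orthogonal_matrix_columns:
  fixes Q :: "real^'n^'n"
  shows "orthogonal_matrix Q \<longleftrightarrow> (\<forall>i j. column i Q \<bullet> column j Q = (if i = j then 1 else 0))"
  by (auto simp: orthogonal_matrix matrix_mult_transpose_dot_column vec_eq_iff mat_def)

lemma compact_orthogonal_matrices: "compact {Q :: real^'n^'n. orthogonal_matrix Q}"
proof -
  have eq: "{Q :: real^'n^'n. orthogonal_matrix Q} =
      (\<Inter>i. \<Inter>j. {Q. column i Q \<bullet> column j Q = (if i = j then 1 else 0)})"
    by (auto simp: orthogonal_matrix_columns)
  have "closed {Q :: real^'n^'n. orthogonal_matrix Q}"
    unfolding eq column_def inner_vec_def
    by (intro closed_INT ballI closed_Collect_eq continuous_intros)
  moreover have "bounded {Q :: real^'n^'n. orthogonal_matrix Q}"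
  proof (rule boundedI)
    fix Q :: "real^'n^'n" assume "Q \<in> {Q. orthogonal_matrix Q}"
    then have "(\<Sum>i\<in>UNIV. norm (Q $ i)) = real CARD('n)"
      by (simp add: norm_orthogonal_matrix_row)
    then show "norm Q \<le> real CARD('n)"
      unfolding norm_vec_def by (metis L2_set_le_sum norm_ge_zero norm_vec_def)
  qed
  ultimately show ?thesis by (simp add: compact_eq_bounded_closed)
qed

definition frame_matrix :: "('n \<Rightarrow> real^'n) \<Rightarrow> real^'n^'n" where
  "frame_matrix u = (\<chi> i j. u j $ i)"

lemma column_frame_matrix [simp]: "column j (frame_matrix u) = u j"
  by (simp add: frame_matrix_def column_def vec_eq_iff)

text \<open>Source of every extremal choice below: the eigenbasis, the orthogonal polar factor and
  the optimal frame are each a maximizer of a continuous functional on the compact orthogonal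
  group.\<close>

lemma orthogonal_attains_sup:
  fixes \<Phi> :: "real^'n^'n \<Rightarrow> real"
  assumes "continuous_on UNIV \<Phi>"
  obtains Q where "orthogonal_matrix Q" "\<And>R. orthogonal_matrix R \<Longrightarrow> \<Phi> R \<le> \<Phi> Q"
proof -
  have "{Q :: real^'n^'n. orthogonal_matrix Q} \<noteq> {}"
    using orthogonal_matrix_id by blast
  from continuous_attains_sup[OF compact_orthogonal_matrices this, of \<Phi>] assms
  show ?thesis using that continuous_on_subset by (metis mem_Collect_eq subset_UNIV)
qed

text \<open>A Givens rotation in the plane of columns \<open>i\<close> and \<open>j\<close>, with
  \<open>c\<close> and \<open>s\<close> as cosine and sine. It is the perturbation against which a
  maximizer over orthogonal matrices is tested.\<close>

definition rotate_columns :: "'n \<Rightarrow> 'n \<Rightarrow> real \<Rightarrow> real \<Rightarrow> real^'n^'n \<Rightarrow> real^'n^'n" where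
  "rotate_columns i j c s Q = frame_matrix (\<lambda>k.
     if k = i then c *\<^sub>R column i Q + s *\<^sub>R column j Q
     else if k = j then c *\<^sub>R column j Q - s *\<^sub>R column i Q
     else column k Q)"

lemma orthogonal_rotate_columns:
  fixes Q :: "real^'n^'n"
  assumes Q: "orthogonal_matrix Q" and "i \<noteq> j" and cs: "c\<^sup>2 + s\<^sup>2 = 1"
  shows "orthogonal_matrix (rotate_columns i j c s Q)"
proof -
  have Q': "column k Q \<bullet> column l Q = (if k = l then 1 else 0)" for k l
    using Q by (auto simp: orthogonal_matrix_columns)
  have cs': "c * c + s * s = 1" "s * s + c * c = 1" using cs by (auto simp: power2_eq_square)
  show ?thesis
    using \<open>i \<noteq> j\<close> unfolding orthogonal_matrix_columns rotate_columns_def column_frame_matrix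
    by (auto simp: inner_add_left inner_add_right inner_diff_left inner_diff_right Q' cs')
qed

text \<open>A plane rotation changes only two terms of a sum over columns; this isolates their
  contribution to the increment.\<close>

lemma sum_diff_two:
  fixes f g :: "'n::finite \<Rightarrow> real"
  assumes "i \<noteq> j" "\<And>k. k \<noteq> i \<Longrightarrow> k \<noteq> j \<Longrightarrow> f k = g k"
  shows "sum f UNIV - sum g UNIV = f i + f j - g i - g j"
proof -
  have "sum h UNIV = h i + h j + sum h (UNIV - {i, j})" for h :: "'n \<Rightarrow> real"
    using sum.subset_diff[of "{i,j}" UNIV h] \<open>i \<noteq> j\<close> by simp
  moreover have "sum f (UNIV - {i, j}) = sum g (UNIV - {i, j})"
    using assms by (intro sum.cong) auto
  ultimately show ?thesis by simp
qed

text \<open>This is how the diagonal entries enter the probabilistic part: for a covariance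
  \<open>A\<close> they are the variances in the directions of the frame.\<close>

lemma conj_by_nth: "conj_by Q A $ i $ j = column i Q \<bullet> (A *v column j Q)"
proof -
  have "conj_by Q A $ i $ j = (\<Sum>k\<in>UNIV. \<Sum>l\<in>UNIV. Q $ l $ i * A $ l $ k * Q $ k $ j)"
    by (simp add: conj_by_def matrix_matrix_mult_def transpose_def sum_distrib_right)
  also have "\<dots> = (\<Sum>l\<in>UNIV. \<Sum>k\<in>UNIV. Q $ l $ i * A $ l $ k * Q $ k $ j)"
    by (rule sum.swap)
  also have "\<dots> = column i Q \<bullet> (A *v column j Q)"
    by (simp add: inner_vec_def matrix_vector_mult_def column_def sum_distrib_left mult.assoc)
  finally show ?thesis .
qed

lemma dot_matrix_sym:
  fixes A :: "real^'n^'n"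
  shows "transpose A = A \<Longrightarrow> x \<bullet> (A *v y) = y \<bullet> (A *v x)"
  by (metis dot_lmul_matrix inner_commute transpose_matrix_vector)

section \<open>Spectral form and diagonalization of symmetric matrices\<close>

definition diagm :: "('n \<Rightarrow> real) \<Rightarrow> real^'n^'n" where
  "diagm d = (\<chi> i j. if i = j then d i else 0)"

text \<open>For orthogonal \<open>Q\<close> the columns are eigenvectors with eigenvalues
  \<open>d\<close>, so products, inverses and square roots act on \<open>d\<close> alone.\<close>

definition spec :: "real^'n^'n \<Rightarrow> ('n \<Rightarrow> real) \<Rightarrow> real^'n^'n" where
  "spec Q d = Q ** diagm d ** transpose Q"

lemma diagm_nth [simp]: "diagm d $ i $ j = (if i = j then d i else 0)"
  by (simp add: diagm_def)

lemma diagm_mult: "diagm a ** diagm b = diagm (\<lambda>i. a i * b i)"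
  by (auto simp: vec_eq_iff matrix_matrix_mult_def if_distrib[of "\<lambda>x. _ * x"] cong: if_cong)

lemma transpose_diagm [simp]: "transpose (diagm d) = diagm d"
  by (auto simp: vec_eq_iff transpose_def)

lemma orthogonal_transpose_mult: "orthogonal_matrix Q \<Longrightarrow> transpose Q ** Q = mat 1"
  and orthogonal_mult_transpose: "orthogonal_matrix Q \<Longrightarrow> Q ** transpose Q = mat 1"
  by (auto simp: orthogonal_matrix_def)

text \<open>Diagonalizes by maximizing the sum of the squared diagonal entries: a plane rotation killing a
  nonzero off-diagonal entry would increase it.\<close>

lemma spectral_theorem:
  fixes A :: "real^'n^'n"
  assumes A: "transpose A = A"
  obtains Q d where "orthogonal_matrix Q" "A = spec Q d"
proof -
  define q where "q v = v \<bullet> (A *v v)" for v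
  have "continuous_on UNIV (\<lambda>Q. \<Sum>k\<in>UNIV. (q (column k Q))\<^sup>2)"
    unfolding q_def column_def inner_vec_def matrix_vector_mult_def
    by (intro continuous_intros)
  then obtain Q where Q: "orthogonal_matrix Q" and max: "\<And>R. orthogonal_matrix R \<Longrightarrow>
     (\<Sum>k\<in>UNIV. (q (column k R))\<^sup>2) \<le> (\<Sum>k\<in>UNIV. (q (column k Q))\<^sup>2)"
    using orthogonal_attains_sup by blast
  have off: "conj_by Q A $ i $ j = 0" if "i \<noteq> j" for i j
  proof (rule ccontr)
    assume nz: "conj_by Q A $ i $ j \<noteq> 0"
    define x where "x = conj_by Q A $ i $ j"
    \<comment> \<open>\<open>r\<close> is the distance between the two eigenvalues of the 2 by 2
      block of \<open>conj_by Q A\<close> at \<open>i\<close> and \<open>j\<close>.\<close>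
    define r where "r = sqrt ((q (column i Q) - q (column j Q))\<^sup>2 + (2 * x)\<^sup>2)"
    define p where "p = q (column i Q) - q (column j Q)"
    have r2: "r\<^sup>2 = p\<^sup>2 + 4 * x\<^sup>2" unfolding r_def p_def by simp
    have "p\<^sup>2 + 4 * x\<^sup>2 > 0" using nz x_def by (simp add: add_nonneg_pos)
    then have r0: "r \<noteq> 0" using r2 by auto
    have "(p / r)\<^sup>2 + (2 * x / r)\<^sup>2 = 1" using r0
      by (simp add: power_divide power_mult_distrib flip: add_divide_distrib r2)
    \<comment> \<open>The rotated block is quadratic in \<open>c\<close> and \<open>s\<close>, hence
      a function of the doubled angle; rotating by half of \<open>t\<close> diagonalizes it.\<close>
    then obtain t where t: "p / r = cos t" "2 * x / r = sin t" using sincos_total_2pi by metis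
    define c s where "c = cos (t/2)" and "s = sin (t/2)"
    have cs: "c\<^sup>2 + s\<^sup>2 = 1" unfolding c_def s_def by simp
    have c2: "c\<^sup>2 - s\<^sup>2 = p / r" unfolding c_def s_def t using cos_double[of "t/2"] by simp
    have s2: "2 * s * c = 2 * x / r" unfolding c_def s_def t using sin_double[of "t/2"] by simp
    have sym: "column j Q \<bullet> (A *v column i Q) = x"
      unfolding x_def conj_by_nth using dot_matrix_sym[OF A] by blast
    define R where "R = rotate_columns i j c s Q"
    have qi: "q (column i R) = c\<^sup>2 * q (column i Q) + s\<^sup>2 * q (column j Q) + 2 * s * c * x"
      using that sym x_def
      by (simp add: R_def rotate_columns_def q_def conj_by_nth inner_add_left inner_add_right
          matrix_vector_right_distrib matrix_vector_mult_scaleR power2_eq_square algebra_simps)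
    have qj: "q (column j R) = c\<^sup>2 * q (column j Q) + s\<^sup>2 * q (column i Q) - 2 * s * c * x"
      using that sym x_def
      by (simp add: R_def rotate_columns_def q_def conj_by_nth inner_diff_left inner_diff_right
          matrix_vector_mult_diff_distrib matrix_vector_mult_scaleR power2_eq_square algebra_simps)
    have d1: "q (column i R) - q (column j R) = r"
    proof -
      have "q (column i R) - q (column j R) = (c\<^sup>2 - s\<^sup>2) * p + 2 * (2 * s * c) * x"
        unfolding qi qj p_def by (simp add: algebra_simps)
      also have "\<dots> = r\<^sup>2 / r" unfolding c2 s2 r2 using r0 by (simp add: field_simps power2_eq_square)
      finally show ?thesis using r0 by (simp add: power2_eq_square)
    qed
    have d2: "q (column i R) + q (column j R) = q (column i Q) + q (column j Q)"
    proof -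
      have "q (column i R) + q (column j R) = (c\<^sup>2 + s\<^sup>2) * (q (column i Q) + q (column j Q))"
        unfolding qi qj by (simp add: algebra_simps)
      then show ?thesis using cs by simp
    qed
    \<comment> \<open>The rotation keeps the sum of the two diagonal entries and turns their
      difference from \<open>p\<close> into \<open>r\<close>, so the sum of squares grows by
      \<open>(r\<^sup>2 - p\<^sup>2) / 2\<close>.\<close>
    have "(\<Sum>k\<in>UNIV. (q (column k R))\<^sup>2) - (\<Sum>k\<in>UNIV. (q (column k Q))\<^sup>2)
        = (q (column i R))\<^sup>2 + (q (column j R))\<^sup>2 - (q (column i Q))\<^sup>2 - (q (column j Q))\<^sup>2"
      by (rule sum_diff_two[OF that]) (simp add: R_def rotate_columns_def)
    also have "\<dots> = ((q (column i R) - q (column j R))\<^sup>2 - p\<^sup>2) / 2"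
    proof -
      have id: "u\<^sup>2 + v\<^sup>2 = ((u + v)\<^sup>2 + (u - v)\<^sup>2) / 2" for u v :: real
        by (simp add: power2_eq_square algebra_simps)
      show ?thesis unfolding p_def using id[of "q (column i R)" "q (column j R)"]
        id[of "q (column i Q)" "q (column j Q)"] d2 by simp
    qed
    also have "\<dots> = 2 * x\<^sup>2" unfolding d1 r2 by simp
    also have "\<dots> > 0" using nz x_def by simp
    finally show False using max[of R] orthogonal_rotate_columns[OF Q that cs] R_def by fastforce
  qed
  define d where "d i = conj_by Q A $ i $ i" for i
  have "conj_by Q A = diagm d" by (auto simp: vec_eq_iff d_def off)
  then have "spec Q d = Q ** (transpose Q ** A ** Q) ** transpose Q" by (simp add: spec_def conj_by_def)
  also have "\<dots> = (Q ** transpose Q) ** A ** (Q ** transpose Q)" by (simp add: matrix_mul_assoc)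
  also have "\<dots> = A" using Q by (simp add: orthogonal_mult_transpose)
  finally show ?thesis using that Q by metis
qed


text \<open>As a rewrite rule this would turn \<open>transpose A *v x\<close> into a row vector
  product and so break the form in which \<open>dot_matrix_transpose\<close> and the spectral lemmas
  are stated.\<close>

declare transpose_matrix_vector [simp del]

lemma dot_matrix_transpose:
  fixes A :: "real^'n^'m"
  shows "x \<bullet> (A *v y) = (transpose A *v x) \<bullet> y"
  by (simp add: dot_lmul_matrix transpose_matrix_vector)

lemma matrix_eq_dotI:
  fixes A B :: "real^'n^'m"
  assumes "\<And>x y. x \<bullet> (A *v y) = x \<bullet> (B *v y)"
  shows "A = B"
  using assms by (metis matrix_eq vector_eq_ldot)

lemma transpose_mult_vec_nth: "(transpose Q *v x) $ i = column i Q \<bullet> x"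
  by (simp add: matrix_vector_mult_def transpose_def inner_vec_def column_def)

lemma diagm_vec_nth: "(diagm d *v x) $ i = d i * x $ i"
  by (simp add: matrix_vector_mult_def if_distrib[of "\<lambda>x. x * _"] cong: if_cong)

lemma transpose_spec [simp]: "transpose (spec Q d) = spec Q d"
  by (simp add: spec_def matrix_transpose_mul matrix_mul_assoc)

lemma spec_mult:
  assumes "orthogonal_matrix Q"
  shows "spec Q a ** spec Q b = spec Q (\<lambda>i. a i * b i)"
proof -
  have "spec Q a ** spec Q b = Q ** diagm a ** (transpose Q ** Q) ** diagm b ** transpose Q"
    by (simp add: spec_def matrix_mul_assoc)
  also have "\<dots> = Q ** (diagm a ** diagm b) ** transpose Q"
    using assms by (simp add: orthogonal_transpose_mult matrix_mul_assoc)
  finally show ?thesis by (simp add: spec_def diagm_mult)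
qed

lemma dot_spec:
  "x \<bullet> (spec Q d *v y) = (\<Sum>i\<in>UNIV. d i * (column i Q \<bullet> x) * (column i Q \<bullet> y))"
proof -
  have "x \<bullet> (spec Q d *v y) = (transpose Q *v x) \<bullet> (diagm d *v (transpose Q *v y))"
    by (simp add: spec_def dot_matrix_transpose[of x Q] flip: matrix_vector_mul_assoc)
  also have "\<dots> = (\<Sum>i\<in>UNIV. d i * (column i Q \<bullet> x) * (column i Q \<bullet> y))"
    by (simp add: inner_vec_def[of "transpose Q *v x"] diagm_vec_nth transpose_mult_vec_nth mult_ac)
  finally show ?thesis .
qed

lemma spec_one:
  fixes Q :: "real^'n^'n"
  assumes "orthogonal_matrix Q"
  shows "spec Q (\<lambda>_. 1) = mat 1"
proof -
  note assms
  moreover have "diagm (\<lambda>_. 1) = (mat 1 :: real^'n^'n)" by (auto simp: vec_eq_iff mat_def)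
  ultimately show ?thesis by (simp add: spec_def orthogonal_mult_transpose)
qed

lemma dot_orthogonal_sum:
  fixes x y :: "real^'n"
  assumes "orthogonal_matrix Q"
  shows "x \<bullet> y = (\<Sum>i\<in>UNIV. (column i Q \<bullet> x) * (column i Q \<bullet> y))"
  using dot_spec[of x Q "\<lambda>_. 1" y] assms by (simp add: spec_one)

lemma norm_orthogonal_sum:
  fixes x :: "real^'n"
  assumes "orthogonal_matrix Q"
  shows "(norm x)\<^sup>2 = (\<Sum>i\<in>UNIV. (column i Q \<bullet> x)\<^sup>2)"
  using dot_orthogonal_sum[OF assms, of x x] by (simp add: power2_norm_eq_inner power2_eq_square[of "_ \<bullet> _"])

lemma trace_conj_by: "orthogonal_matrix Q \<Longrightarrow> trace (conj_by Q A) = trace A"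
  by (metis conj_by_def matrix_mul_assoc matrix_mul_lid orthogonal_mult_transpose trace_mul_sym)

lemma conj_by_unconj:
  "orthogonal_matrix Q \<Longrightarrow> Q ** conj_by Q A ** transpose Q = A"
proof -
  assume Q: "orthogonal_matrix Q"
  have "Q ** conj_by Q A ** transpose Q = (Q ** transpose Q) ** A ** (Q ** transpose Q)"
    by (simp add: conj_by_def matrix_mul_assoc)
  then show ?thesis using Q by (simp add: orthogonal_mult_transpose)
qed

lemma conj_by_inj:
  "orthogonal_matrix Q \<Longrightarrow> conj_by Q A = conj_by Q B \<Longrightarrow> A = B"
  by (metis conj_by_unconj)

lemma column_spec:
  assumes Q: "orthogonal_matrix Q"
  shows "spec Q d *v column i Q = d i *\<^sub>R column i Q"
proof (subst vector_eq_ldot[symmetric], rule allI)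
  fix x
  have "column k Q \<bullet> column i Q = (if k = i then 1 else 0)" for k
    using Q by (auto simp: orthogonal_matrix_columns)
  then have "x \<bullet> (spec Q d *v column i Q) =
      (\<Sum>k\<in>UNIV. if k = i then d k * (column k Q \<bullet> x) else 0)"
    unfolding dot_spec by (intro sum.cong) auto
  then show "x \<bullet> (spec Q d *v column i Q) = x \<bullet> (d i *\<^sub>R column i Q)"
    by (simp add: inner_commute)
qed

lemma psd_spec: "(\<And>i. 0 \<le> d i) \<Longrightarrow> psd (spec Q d)"
  by (simp add: psd_def dot_spec sum_nonneg mult.assoc)

lemma column_unit:
  fixes Q :: "real^'n^'n"
  shows "orthogonal_matrix Q \<Longrightarrow> column i Q \<bullet> column i Q = 1"
  by (metis orthogonal_matrix_columns)

lemma psd_spectral: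
  assumes "psd A"
  obtains Q d where "orthogonal_matrix Q" "A = spec Q d" "\<And>i. 0 \<le> d i"
proof -
  obtain Q d where Q: "orthogonal_matrix Q" "A = spec Q d"
    using assms spectral_theorem unfolding psd_def by metis
  have "0 \<le> column i Q \<bullet> (A *v column i Q)" for i using assms by (simp add: psd_def)
  then have "0 \<le> d i" for i using Q by (simp add: column_spec column_unit)
  then show ?thesis using Q that by blast
qed

text \<open>If \<open>y = A *v x\<close> were nonzero, the quadratic form would be affine and
  nonconstant in \<open>t\<close> along \<open>y + t *\<^sub>R x\<close>; the chosen
  \<open>t\<close> makes its value -1.\<close>

lemma psd_quad_zero:
  assumes A: "psd A" and x: "x \<bullet> (A *v x) = 0"
  shows "A *v x = 0"
proof (rule ccontr)
  define y where "y = A *v x"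
  assume "A *v x \<noteq> 0"
  then have yy: "y \<bullet> y > 0" by (simp add: y_def)
  define t where "t = - (y \<bullet> (A *v y) + 1) / (2 * (y \<bullet> y))"
  have sym: "x \<bullet> (A *v y) = y \<bullet> y"
    using dot_matrix_sym[of A x y] A by (simp add: psd_def y_def)
  have "(y + t *\<^sub>R x) \<bullet> (A *v (y + t *\<^sub>R x)) = y \<bullet> (A *v y) + 2 * t * (y \<bullet> y)"
    using x sym by (simp add: matrix_vector_right_distrib matrix_vector_mult_scaleR inner_add_left
        inner_add_right algebra_simps flip: y_def)
  also have "\<dots> = -1" using yy by (simp add: t_def field_simps)
  finally show False using A unfolding psd_def by (metis neg_0_le_iff_le not_one_le_zero)
qed

lemma psd_symD: "psd A \<Longrightarrow> transpose A = A" by (simp add: psd_def)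

lemma psd_congruence:
  assumes "psd A" shows "psd (transpose M ** A ** M)"
proof -
  have "x \<bullet> ((transpose M ** A ** M) *v x) = (M *v x) \<bullet> (A *v (M *v x))" for x
    by (simp add: dot_matrix_transpose[of x "transpose M"] flip: matrix_vector_mul_assoc)
  then show ?thesis using assms
    by (simp add: psd_def matrix_transpose_mul matrix_mul_assoc)
qed

lemma psd_add: "psd A \<Longrightarrow> psd B \<Longrightarrow> psd (A + B)"
  by (simp add: psd_def matrix_vector_mult_add_rdistrib inner_add_right transpose_def vec_eq_iff)

subsection \<open>Square roots, polar decomposition and the Bures distance\<close>

text \<open>Let \<open>x\<close> be an eigenvector of \<open>B - C\<close> with nonzero eigenvalue.
  Equal squares give \<open>B *v x\<close> and \<open>C *v x\<close> the same length, so their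
  difference, a multiple of \<open>x\<close>, is orthogonal to their sum. Both quadratic forms then
  vanish at \<open>x\<close>, which forces \<open>B *v x = C *v x = 0\<close>. The description in
  \<open>psd_sqrt\<close> thereby becomes definite.\<close>

lemma psd_square_inj:
  assumes B: "psd B" and C: "psd C" and eq: "B ** B = C ** C"
  shows "B = C"
proof -
  have "transpose (B - C) = B - C" using B C by (simp add: psd_def transpose_def vec_eq_iff)
  then obtain Q d where Q: "orthogonal_matrix Q" "B - C = spec Q d"
    using spectral_theorem by blast
  have "d i = 0" for i
  proof (rule ccontr)
    assume nz: "d i \<noteq> 0"
    define x where "x = column i Q"
    have D: "B *v x - C *v x = d i *\<^sub>R x"
      using column_spec[OF Q(1), of d i] Q(2) by (simp add: x_def flip: matrix_vector_mult_diff_rdistrib)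
    have sq: "(M *v x) \<bullet> (M *v x) = x \<bullet> ((M ** M) *v x)" if "psd M" for M
      using dot_matrix_transpose[of x M "M *v x"] psd_symD[OF that]
      by (simp add: matrix_vector_mul_assoc)
    have "(B *v x) \<bullet> (B *v x) = (C *v x) \<bullet> (C *v x)" using sq B C eq by simp
    then have "(B *v x - C *v x) \<bullet> (B *v x + C *v x) = 0"
      by (simp add: inner_diff_left inner_add_right inner_commute[of "C *v x" "B *v x"])
    then have "x \<bullet> (B *v x) + x \<bullet> (C *v x) = 0" unfolding D using nz
      by (simp add: inner_add_right flip: distrib_left)
    moreover have "0 \<le> x \<bullet> (B *v x)" "0 \<le> x \<bullet> (C *v x)" using B C by (auto simp: psd_def)
    ultimately have "B *v x = 0" "C *v x = 0" using psd_quad_zero B C by (smt (verit))+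
    then have "d i *\<^sub>R x = 0" using D by simp
    then show False using nz column_unit[OF Q(1), of i] by (simp add: x_def)
  qed
  then have "B - C = spec Q (\<lambda>_. 0)" using Q by presburger
  also have "\<dots> = 0" by (rule matrix_eq_dotI) (simp add: dot_spec)
  finally show ?thesis by simp
qed

lemma psd_sqrt_eqI: "psd B \<Longrightarrow> B ** B = A \<Longrightarrow> psd_sqrt A = B"
  unfolding psd_sqrt_def using psd_square_inj by blast

lemma psd_sqrt_spec:
  "orthogonal_matrix Q \<Longrightarrow> (\<And>i. 0 \<le> d i) \<Longrightarrow> psd_sqrt (spec Q d) = spec Q (\<lambda>i. sqrt (d i))"
  by (rule psd_sqrt_eqI) (simp_all add: psd_spec spec_mult)

lemma psd_sqrt:
  assumes "psd A" shows "psd (psd_sqrt A)" and "psd_sqrt A ** psd_sqrt A = A"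
proof -
  obtain Q d where "orthogonal_matrix Q" "A = spec Q d" "\<And>i. 0 \<le> d i"
    using assms psd_spectral by blast
  then show "psd (psd_sqrt A)" "psd_sqrt A ** psd_sqrt A = A"
    by (simp_all add: psd_sqrt_spec psd_spec spec_mult)
qed

text \<open>The orthogonal factor maximizes \<open>tr (W\<^sup>* C)\<close>; stationarity under plane rotations makes
  \<open>W\<^sup>* C\<close> symmetric, and the signs of its eigenvalues are then absorbed into \<open>W\<close>. This covers
  singular \<open>C\<close>.\<close>

lemma polar_decomposition:
  fixes C :: "real^'n^'n"
  obtains W S where "orthogonal_matrix W" "psd S" "C = W ** S"
proof -
  have "continuous_on UNIV (\<lambda>Q. \<Sum>k\<in>UNIV. column k Q \<bullet> column k C)"
    unfolding column_def inner_vec_def by (intro continuous_intros)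
  then obtain W where W: "orthogonal_matrix W" and max: "\<And>R. orthogonal_matrix R \<Longrightarrow>
     (\<Sum>k\<in>UNIV. column k R \<bullet> column k C) \<le> (\<Sum>k\<in>UNIV. column k W \<bullet> column k C)"
    using orthogonal_attains_sup by blast
  have sym: "column i W \<bullet> column j C = column j W \<bullet> column i C" if "i \<noteq> j" for i j
  proof (rule ccontr)
    assume ne: "column i W \<bullet> column j C \<noteq> column j W \<bullet> column i C"
    \<comment> \<open>The two terms affected by a rotation add up to \<open>c * p + s * q\<close>.
      The best angle yields \<open>r\<close>, which exceeds \<open>p\<close> as soon as the
      asymmetry \<open>q\<close> is nonzero.\<close>
    define p where "p = column i W \<bullet> column i C + column j W \<bullet> column j C"
    define q where "q = column j W \<bullet> column i C - column i W \<bullet> column j C"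
    define r where "r = sqrt (p\<^sup>2 + q\<^sup>2)"
    have r: "r\<^sup>2 = p\<^sup>2 + q\<^sup>2" "r > \<bar>p\<bar>" using ne
      by (auto simp: r_def q_def intro!: real_less_rsqrt)
    then have r0: "r > 0" by linarith
    define R where "R = rotate_columns i j (p / r) (q / r) W"
    have cs: "(p / r)\<^sup>2 + (q / r)\<^sup>2 = 1" using r0 by (simp add: power_divide flip: add_divide_distrib r(1))
    have "(\<Sum>k\<in>UNIV. column k R \<bullet> column k C) - (\<Sum>k\<in>UNIV. column k W \<bullet> column k C) =
        column i R \<bullet> column i C + column j R \<bullet> column j C - column i W \<bullet> column i C - column j W \<bullet> column j C"
      by (rule sum_diff_two[OF that]) (simp add: R_def rotate_columns_def)
    also have "\<dots> = (p / r) * p + (q / r) * q - p"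
    proof -
      have "column i (rotate_columns i j c s W) \<bullet> column i C +
          column j (rotate_columns i j c s W) \<bullet> column j C - column i W \<bullet> column i C -
          column j W \<bullet> column j C = c * p + s * q - p" for c s
        using that by (simp add: rotate_columns_def inner_add_left inner_diff_left p_def q_def algebra_simps)
      then show ?thesis unfolding R_def by blast
    qed
    also have "\<dots> = r - p"
    proof -
      have "(p / r) * p + (q / r) * q = r\<^sup>2 / r"
        unfolding r by (simp add: power2_eq_square add_divide_distrib)
      then show ?thesis using r0 by (simp add: power2_eq_square)
    qed
    also have "\<dots> > 0" using r by linarith
    finally show False using max[of R] orthogonal_rotate_columns[OF W that cs] R_def by fastforce
  qed
  have "transpose (transpose W ** C) = transpose W ** C"
  proof -
    have "(transpose W ** C) $ i $ j = column i W \<bullet> column j C" for i j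
      by (simp add: matrix_matrix_mult_def transpose_def column_def inner_vec_def)
    then show ?thesis
      using sym by (simp add: vec_eq_iff transpose_def[of "transpose W ** C"]) metis
  qed
  then obtain Q d where Q: "orthogonal_matrix Q" "transpose W ** C = spec Q d"
    using spectral_theorem by blast
  \<comment> \<open>Zero eigenvalues get the sign 1, so that \<open>spec Q s\<close> is an
    orthogonal involution even for singular \<open>C\<close>.\<close>
  define s where "s i = (if d i < 0 then -1 else 1 :: real)" for i
  have s: "spec Q s ** spec Q s = mat 1"
    using Q(1) by (simp add: spec_mult s_def if_distrib spec_one cong: if_cong)
  have V: "orthogonal_matrix (W ** spec Q s)"
  proof -
    have "transpose (W ** spec Q s) ** (W ** spec Q s) = spec Q s ** (transpose W ** W) ** spec Q s"
      by (simp add: matrix_transpose_mul matrix_mul_assoc)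
    then show ?thesis using W s by (simp add: orthogonal_matrix)
  qed
  have "spec Q d = spec Q s ** spec Q (\<lambda>i. \<bar>d i\<bar>)"
    unfolding spec_mult[OF Q(1)] by (rule arg_cong[of _ _ "spec Q"]) (auto simp: s_def)
  moreover have "C = W ** spec Q d"
    using Q(2) W by (metis matrix_mul_assoc matrix_mul_lid orthogonal_mult_transpose)
  ultimately have "C = (W ** spec Q s) ** spec Q (\<lambda>i. \<bar>d i\<bar>)" by (simp add: matrix_mul_assoc)
  then show ?thesis using that[OF V] psd_spec[of "\<lambda>i. \<bar>d i\<bar>" Q] by simp
qed


text \<open>In the polar decompositions of the transposes the symmetric factors are square roots of
  the same Gram matrix, hence equal; the orthogonal factors combine into \<open>W\<close>. For
  Gaussians this turns equal covariances into an orthogonal change of variable.\<close>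

lemma gram_eq_orthogonal:
  fixes L1 L2 :: "real^'n^'n"
  assumes eq: "L1 ** transpose L1 = L2 ** transpose L2"
  obtains W where "orthogonal_matrix W" "L1 = L2 ** W"
proof -
  obtain U S where U: "orthogonal_matrix U" "psd S" "transpose L1 = U ** S"
    using polar_decomposition by blast
  obtain V T where V: "orthogonal_matrix V" "psd T" "transpose L2 = V ** T"
    using polar_decomposition by blast
  have L: "L1 = S ** transpose U" "L2 = T ** transpose V"
    using U V by (metis matrix_transpose_mul psd_symD transpose_transpose)+
  have "S ** S = S ** (transpose U ** U) ** S" "T ** T = T ** (transpose V ** V) ** T"
    using U V by (simp_all add: orthogonal_transpose_mult)
  then have "S ** S = L1 ** transpose L1" "T ** T = L2 ** transpose L2"
    using L U(3) V(3) by (simp_all add: matrix_mul_assoc)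
  then have "S = T" using eq U V psd_square_inj by metis
  then have "L1 = L2 ** (V ** transpose U)"
    using L V(1) by (metis matrix_mul_assoc matrix_mul_rid orthogonal_transpose_mult)
  moreover have "orthogonal_matrix (V ** transpose U)"
    using U(1) V(1) by (simp add: orthogonal_matrix_mul)
  ultimately show ?thesis using that by blast
qed

lemma psd_sqrt_gram: "psd A \<Longrightarrow> psd_sqrt A ** transpose (psd_sqrt A) = A"
  by (simp add: psd_sqrt psd_symD)

text \<open>With \<open>M = W ** S\<close> the two roots are \<open>S\<close> and
  \<open>W ** S ** transpose W\<close>, which are orthogonally similar.\<close>

lemma trace_sqrt_gram_commute:
  fixes M :: "real^'n^'n"
  shows "trace (psd_sqrt (M ** transpose M)) = trace (psd_sqrt (transpose M ** M))"
proof -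
  obtain W S where W: "orthogonal_matrix W" "psd S" "M = W ** S"
    using polar_decomposition by blast
  have "transpose M ** M = S ** (transpose W ** W) ** S"
    using W by (simp add: matrix_transpose_mul psd_symD matrix_mul_assoc)
  then have 1: "psd_sqrt (transpose M ** M) = S"
    using W by (intro psd_sqrt_eqI) (simp_all add: orthogonal_transpose_mult)
  have "M ** transpose M = W ** S ** S ** transpose W"
    using W by (simp add: matrix_transpose_mul psd_symD matrix_mul_assoc)
  also have "\<dots> = (W ** S ** transpose W) ** (W ** S ** transpose W)"
    using W(1) by (metis matrix_mul_assoc matrix_mul_rid orthogonal_transpose_mult)
  finally have 2: "psd_sqrt (M ** transpose M) = W ** S ** transpose W"
    using psd_congruence[OF W(2), of "transpose W"] by (intro psd_sqrt_eqI) simp_all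
  show ?thesis unfolding 1 2
    using W(1) by (metis matrix_mul_assoc matrix_mul_lid orthogonal_transpose_mult trace_mul_sym)
qed

text \<open>The two matrices under the outer root are the two Gram matrices of the product of the
  square roots. Symmetry serves the second projection, where the transport map is explicit only from
  the projection back to \<open>N\<close>.\<close>

lemma bw_commute:
  fixes A B :: "real^'n^'n"
  assumes A: "psd A" and B: "psd B" shows "bw A B = bw B A"
proof -
  define M where "M = psd_sqrt A ** psd_sqrt B"
  have "psd_sqrt A ** B ** psd_sqrt A = psd_sqrt A ** (psd_sqrt B ** psd_sqrt B) ** psd_sqrt A"
    using psd_sqrt[OF B] by metis
  also have "\<dots> = M ** transpose M"
    by (simp add: M_def matrix_transpose_mul psd_symD psd_sqrt(1) A B matrix_mul_assoc)
  finally have 1: "psd_sqrt A ** B ** psd_sqrt A = M ** transpose M" .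
  have "psd_sqrt B ** A ** psd_sqrt B = psd_sqrt B ** (psd_sqrt A ** psd_sqrt A) ** psd_sqrt B"
    using psd_sqrt[OF A] by metis
  also have "\<dots> = transpose M ** M"
    by (simp add: M_def matrix_transpose_mul psd_symD psd_sqrt(1) A B matrix_mul_assoc)
  finally have 2: "psd_sqrt B ** A ** psd_sqrt B = transpose M ** M" .
  have "trace (c *\<^sub>R X) = c * trace X" for c and X :: "real^'n^'n"
    by (simp add: trace_def sum_distrib_left)
  then show ?thesis
    by (simp add: bw_def 1 2 trace_sub trace_add trace_sqrt_gram_commute[of M])
qed

lemma trace_mult_spec:
  "trace (A ** spec Q d) = (\<Sum>i\<in>UNIV. d i * conj_by Q A $ i $ i)"
proof -
  have "trace (A ** spec Q d) = trace (conj_by Q A ** diagm d)"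
    unfolding spec_def conj_by_def by (metis matrix_mul_assoc trace_mul_sym)
  then show ?thesis
    by (simp add: trace_def matrix_matrix_mult_def if_distrib[of "\<lambda>x. _ * x"] mult.commute cong: if_cong)
qed

lemma trace_eq_sum_conj_by:
  "orthogonal_matrix Q \<Longrightarrow> trace A = (\<Sum>i\<in>UNIV. conj_by Q A $ i $ i)"
  using trace_conj_by[of Q A] by (simp add: trace_def)

text \<open>For \<open>T = spec Q t\<close> the nested root is explicit: \<open>S ** T ** S\<close>
  is positive semi-definite and squares to \<open>S ** (T ** A ** T) ** S\<close>, where
  \<open>S\<close> is the root of \<open>A\<close>. What remains is the trace of \<open>A\<close>
  against \<open>1 - T\<close> squared.\<close>

lemma bw_spec:
  fixes A :: "real^'n^'n"
  assumes A: "psd A" and Q: "orthogonal_matrix Q" and t: "\<And>i. 0 \<le> t i"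
  shows "(bw A (spec Q t ** A ** spec Q t))\<^sup>2 = (\<Sum>i\<in>UNIV. (1 - t i)\<^sup>2 * conj_by Q A $ i $ i)"
proof -
  define T where "T = spec Q t"
  define S where "S = psd_sqrt A"
  have T: "psd T" unfolding T_def using t by (simp add: psd_spec)
  have S: "psd S" "S ** S = A" using psd_sqrt[OF A] by (simp_all add: S_def)
  have "psd (S ** T ** S)" using psd_congruence[OF T, of S] S by (simp add: psd_symD)
  moreover have "(S ** T ** S) ** (S ** T ** S) = S ** (T ** A ** T) ** S"
    unfolding S(2)[symmetric] by (simp add: matrix_mul_assoc)
  ultimately have sq: "psd_sqrt (S ** (T ** A ** T) ** S) = S ** T ** S"
    using psd_sqrt_eqI by blast
  have tr1: "trace (S ** T ** S) = trace (A ** T)"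
    by (metis S(2) matrix_mul_assoc trace_mul_sym)
  have trc: "trace (c *\<^sub>R X) = c * trace X" for c and X :: "real^'n^'n"
    by (simp add: trace_def sum_distrib_left)
  have tr2: "trace (T ** A ** T) = (\<Sum>i\<in>UNIV. t i * t i * conj_by Q A $ i $ i)"
  proof -
    have "trace (T ** A ** T) = trace (A ** (T ** T))"
      by (metis matrix_mul_assoc trace_mul_sym)
    also have "T ** T = spec Q (\<lambda>i. t i * t i)" unfolding T_def by (rule spec_mult[OF Q])
    finally show ?thesis by (simp add: trace_mult_spec)
  qed
  have "trace (A + T ** A ** T - 2 *\<^sub>R psd_sqrt (S ** (T ** A ** T) ** S))
      = (\<Sum>i\<in>UNIV. (1 - t i)\<^sup>2 * conj_by Q A $ i $ i)"
    unfolding sq trace_sub trace_add trc tr1 tr2 trace_eq_sum_conj_by[OF Q, of A] unfolding T_def trace_mult_spec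
    by (simp add: sum_distrib_left power2_eq_square algebra_simps flip: sum_subtractf sum.distrib)
  moreover have "0 \<le> conj_by Q A $ i $ i" for i
    using A by (simp add: conj_by_nth psd_def)
  ultimately show ?thesis
    unfolding bw_def T_def[symmetric] S_def[symmetric] by (simp add: sum_nonneg)
qed

lemma loewner_le_dot:
  "psd A \<Longrightarrow> psd B \<Longrightarrow> A \<le>\<^sub>L B \<longleftrightarrow> (\<forall>x. x \<bullet> (A *v x) \<le> x \<bullet> (B *v x))"
  by (simp add: loewner_le_def psd_def matrix_vector_mult_diff_rdistrib inner_diff_right
      transpose_def vec_eq_iff)

lemma matrix_matrix_mult_add_rdistrib:
  fixes A B :: "real^'n^'m"
  shows "(A + B) ** C = A ** C + B ** C"
  by (simp add: matrix_matrix_mult_def vec_eq_iff distrib_right sum.distrib)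

text \<open>Douglas factorization: \<open>C = R A\<^sup>1\<^sup>/\<^sup>2\<close> for the pseudo-inverse \<open>R\<close> of \<open>B\<^sup>1\<^sup>/\<^sup>2\<close>.\<close>

lemma loewner_le_factor:
  assumes A: "psd A" and B: "psd B" and AB: "A \<le>\<^sub>L B"
  obtains C where "psd_sqrt A = psd_sqrt B ** C" "\<And>x. norm (transpose C *v x) \<le> norm x"
proof -
  obtain Q d where Q: "orthogonal_matrix Q" and Bs: "B = spec Q d" and d: "\<And>i. 0 \<le> d i"
    using B psd_spectral by blast
  define S where "S = psd_sqrt A"
  have S: "psd S" "S ** S = A" using psd_sqrt[OF A] by (simp_all add: S_def)
  have le: "(norm (S *v x))\<^sup>2 \<le> x \<bullet> (B *v x)" for x
  proof -
    have "(norm (S *v x))\<^sup>2 = x \<bullet> (A *v x)"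
      using dot_matrix_transpose[of x S "S *v x"] S
      by (simp add: power2_norm_eq_inner psd_symD matrix_vector_mul_assoc)
    then show ?thesis using AB loewner_le_dot[OF A B] by simp
  qed
  \<comment> \<open>Because \<open>inverse 0 = 0\<close>, \<open>R\<close> is the pseudo-inverse of
    the root of \<open>B\<close>, and \<open>N\<close> projects onto the kernel of
    \<open>B\<close>.\<close>
  define R where "R = spec Q (\<lambda>i. inverse (sqrt (d i)))"
  define N where "N = spec Q (\<lambda>i. of_bool (d i = 0))"
  have SB: "psd_sqrt B = spec Q (\<lambda>i. sqrt (d i))" using Bs Q d by (simp add: psd_sqrt_spec)
  have sum: "psd_sqrt B ** R + N = mat 1"
  proof -
    have "psd_sqrt B ** R + N = spec Q (\<lambda>_. 1)"
      unfolding SB R_def N_def spec_mult[OF Q]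
      by (rule matrix_eq_dotI)
         (auto simp: matrix_vector_mult_add_rdistrib inner_add_right dot_spec
           simp flip: sum.distrib intro!: sum.cong)
    then show ?thesis using Q by (simp add: spec_one)
  qed
  \<comment> \<open>The order puts the kernel of \<open>B\<close> inside the kernel of
    \<open>A\<close>, so the part of the identity missed by the pseudo-inverse does not affect
    \<open>S\<close>.\<close>
  have "S *v (N *v x) = 0" for x
  proof -
    have "(N *v x) \<bullet> (B *v (N *v x)) = x \<bullet> ((N ** B ** N) *v x)"
      using dot_matrix_transpose[of x N "B *v (N *v x)"]
      by (simp add: N_def matrix_vector_mul_assoc matrix_mul_assoc)
    also have "\<dots> = 0"
      unfolding N_def Bs spec_mult[OF Q] by (auto simp: dot_spec intro!: sum.neutral)
    finally show ?thesis using le[of "N *v x"] by simp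
  qed
  then have "S ** N = 0" by (simp add: matrix_eq matrix_vector_mul_assoc)
  then have "N ** S = 0"
    by (metis N_def S(1) matrix_transpose_mul psd_symD transpose_spec transpose_mat mat_0)
  then have "psd_sqrt A = psd_sqrt B ** (R ** S)"
    using arg_cong[OF sum, of "\<lambda>M. M ** S"]
    by (simp add: S_def matrix_mul_assoc matrix_matrix_mult_add_rdistrib)
  moreover have "norm (transpose (R ** S) *v x) \<le> norm x" for x
  proof -
    have "(norm (transpose (R ** S) *v x))\<^sup>2 = (norm (S *v (R *v x)))\<^sup>2"
      using S by (simp add: R_def matrix_transpose_mul psd_symD matrix_vector_mul_assoc)
    also have "\<dots> \<le> (R *v x) \<bullet> (B *v (R *v x))" by (rule le)
    also have "\<dots> = x \<bullet> ((R ** B ** R) *v x)"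
      using dot_matrix_transpose[of x R "B *v (R *v x)"]
      by (simp add: R_def matrix_vector_mul_assoc matrix_mul_assoc)
    also have "\<dots> = (\<Sum>i\<in>UNIV. of_bool (d i \<noteq> 0) * (column i Q \<bullet> x)\<^sup>2)"
      unfolding R_def Bs spec_mult[OF Q] dot_spec
    proof (rule sum.cong[OF refl], goal_cases)
      case (1 i)
      have "inverse (sqrt (d i)) * d i * inverse (sqrt (d i)) = of_bool (d i \<noteq> 0)"
        using d[of i] by (auto simp: field_simps)
      then show ?case by (simp add: power2_eq_square)
    qed
    also have "\<dots> \<le> (\<Sum>i\<in>UNIV. (column i Q \<bullet> x)\<^sup>2)" by (intro sum_mono) auto
    also have "\<dots> = (norm x)\<^sup>2" using norm_orthogonal_sum[OF Q] by simp
    finally show ?thesis by (simp add: power2_le_iff_abs_le)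
  qed
  ultimately show ?thesis using that by blast
qed

text \<open>Polar decomposition of the transpose: the \<open>k i\<close> are the singular values of
  \<open>C\<close>, at most 1 because an eigenvector of the symmetric factor is not
  lengthened.\<close>

lemma contraction_factor:
  assumes "\<And>x. norm (transpose C *v x) \<le> norm x"
  obtains Q k W where "orthogonal_matrix Q" "orthogonal_matrix W" "C = spec Q k ** W"
    "\<And>i. 0 \<le> k i" "\<And>i. k i \<le> 1"
proof -
  obtain W S where W: "orthogonal_matrix W" "psd S" "transpose C = W ** S"
    using polar_decomposition by blast
  obtain Q k where Q: "orthogonal_matrix Q" "S = spec Q k" and k: "\<And>i. 0 \<le> k i"
    using W(2) psd_spectral by blast
  have "C = spec Q k ** transpose W"
    using W(3) Q(2) by (metis matrix_transpose_mul transpose_spec transpose_transpose)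
  moreover have "k i \<le> 1" for i
  proof -
    have WO: "orthogonal_transformation ((*v) W)"
      using W(1) by (simp add: orthogonal_transformation_matrix)
    have "norm (W *v (S *v column i Q)) \<le> norm (column i Q)"
      using assms[of "column i Q"] W(3) by (simp add: matrix_vector_mul_assoc)
    then have "norm (k i *\<^sub>R column i Q) \<le> norm (column i Q)"
      using orthogonal_transformation_norm[OF WO] Q by (simp add: column_spec)
    moreover have "norm (column i Q) = 1" using column_unit[OF Q(1)] by (simp add: norm_eq_1)
    ultimately show ?thesis by simp
  qed
  moreover have "orthogonal_matrix (transpose W)" using W(1) by simp
  ultimately show ?thesis using that Q(1) k by blast
qed

subsection \<open>Existence of an admissible frame\<close>

text \<open>Scalar weak duality. On \<open>p \<ge> 1\<close> the right side is smallest at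
  \<open>p = 1\<close> if \<open>a \<le> b\<close>; otherwise it is at least
  \<open>2 * sqrt (a * b)\<close> by the arithmetic-geometric mean inequality.\<close>

lemma bures_summand_bound:
  fixes a b p :: real
  assumes a: "0 \<le> a" and b: "0 \<le> b" and p: "1 \<le> p"
  shows "a + b - (max (sqrt a - sqrt b) 0)\<^sup>2 \<le> a / p + p * b"
proof (cases "a \<le> b")
  case True
  have "(p - 1) * (a / p) \<le> (p - 1) * b"
    using True a p by (intro mult_left_mono) (auto simp: divide_le_eq mult_le_cancel_left1 intro: order_trans)
  moreover have "(p - 1) * (a / p) = a - a / p" using p by (simp add: field_simps)
  moreover have "max (sqrt a - sqrt b) 0 = 0" using True by simp
  ultimately show ?thesis by (simp add: algebra_simps)
next
  case False
  have "0 \<le> (sqrt (a / p) - sqrt (p * b))\<^sup>2" by simp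
  also have "\<dots> = a / p + p * b - 2 * (sqrt (a / p) * sqrt (p * b))"
    using a b p by (simp add: power2_diff)
  also have "sqrt (a / p) * sqrt (p * b) = sqrt a * sqrt b"
    using p by (simp flip: real_sqrt_mult)
  finally show ?thesis using False a b by (simp add: power2_diff)
qed

text \<open>The scalar dual optimum is \<open>p = 1 / t\<close>, with \<open>t\<close> the entry of
  \<open>D\<close>. The excluded value \<open>t = 0\<close> occurs when \<open>b = 0 < a\<close>,
  where the infimum is only approached as \<open>p\<close> tends to infinity.\<close>

lemma bures_summand_eq:
  fixes a b :: real
  assumes a: "0 \<le> a" and b: "0 \<le> b"
  defines "t \<equiv> if a = 0 then 1 else min 1 (sqrt (b / a))"
  assumes t: "t \<noteq> 0"
  shows "t * a + b / t = a + b - (max (sqrt a - sqrt b) 0)\<^sup>2"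
proof (cases "a \<le> b")
  case True
  then have "t = 1" using a by (auto simp: t_def)
  then show ?thesis using True by simp
next
  case False
  then have tt: "t = sqrt b / sqrt a" using a b by (auto simp: t_def real_sqrt_divide min_def divide_le_eq)
  have sa: "sqrt a * sqrt a = a" "sqrt b * sqrt b = b" "sqrt a > 0" using a b False by auto
  have sb: "sqrt b > 0" using t tt b by (simp add: less_le)
  have "t * a = sqrt a * sqrt b" unfolding tt using sa by (simp add: field_simps)
  moreover have "b / t = sqrt a * sqrt b" unfolding tt using sa sb by (simp add: field_simps)
  ultimately show ?thesis using False a b by (simp add: power2_diff)
qed

definition outer :: "real^'n \<Rightarrow> real^'n \<Rightarrow> real^'n^'n" where
  "outer u v = (\<chi> i j. u $ i * v $ j)"

lemma outer_mult_vec: "outer u v *v x = (v \<bullet> x) *\<^sub>R u"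
  by (simp add: outer_def matrix_vector_mult_def vec_eq_iff inner_vec_def sum_distrib_left sum_distrib_right mult_ac)

lemma trace_mult_outer: "trace (A ** outer u v) = v \<bullet> (A *v u)"
  by (simp add: outer_def trace_def matrix_matrix_mult_def inner_vec_def matrix_vector_mult_def
      sum_distrib_left mult_ac)

lemma transpose_outer: "transpose (outer u v) = outer v u"
  by (simp add: outer_def transpose_def vec_eq_iff)

definition dfac :: "real^'n^'n \<Rightarrow> real^'n^'n \<Rightarrow> real^'n^'n \<Rightarrow> 'n \<Rightarrow> real" where
  "dfac Q M N i = (if conj_by Q M $ i $ i = 0 then 1
     else min 1 (sqrt (conj_by Q N $ i $ i / conj_by Q M $ i $ i)))"

lemma Dmat_eq: "Dmat Q M N = diagm (dfac Q M N)"
  by (simp add: Dmat_def dfac_def vec_eq_iff)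

lemma conj_by_diag_nonneg: "psd A \<Longrightarrow> 0 \<le> conj_by Q A $ i $ i"
  by (simp add: conj_by_nth psd_def)

lemma dfac_bounds:
  assumes "psd M" "psd N"
  shows "0 \<le> dfac Q M N i" "dfac Q M N i \<le> 1"
  using assms by (auto simp: dfac_def conj_by_diag_nonneg)

lemma conj_by_quad: "x \<bullet> (conj_by Q A *v y) = (Q *v x) \<bullet> (A *v (Q *v y))"
  by (simp add: conj_by_def dot_matrix_transpose[of x "transpose Q"] flip: matrix_vector_mul_assoc)

lemma psd_conj_by: "psd A \<Longrightarrow> psd (conj_by Q A)"
  unfolding conj_by_def by (rule psd_congruence)

lemma spec_sandwich_quad: "x \<bullet> ((spec Q t ** A ** spec Q t) *v y) = (spec Q t *v x) \<bullet> (A *v (spec Q t *v y))"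
  by (simp add: dot_matrix_transpose[of x "spec Q t"] flip: matrix_vector_mul_assoc)

lemma psd_spec_sandwich: "psd A \<Longrightarrow> psd (spec Q t ** A ** spec Q t)"
  using psd_congruence[of A "spec Q t"] by simp

lemma conj_by_spec_sandwich:
  assumes "orthogonal_matrix Q"
  shows "conj_by Q (spec Q t ** A ** spec Q t) = diagm t ** conj_by Q A ** diagm t"
proof -
  have "conj_by Q (spec Q t ** A ** spec Q t) =
      (transpose Q ** Q) ** diagm t ** conj_by Q A ** diagm t ** (transpose Q ** Q)"
    by (simp add: conj_by_def spec_def matrix_mul_assoc)
  then show ?thesis using assms by (simp add: orthogonal_transpose_mult)
qed

lemma conj_by_diff: "conj_by Q (A - B) = conj_by Q A - conj_by Q B"
  by (rule matrix_eq_dotI)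
     (simp add: conj_by_quad matrix_vector_mult_diff_rdistrib inner_diff_right)

lemma psd_conj_by_iff: "orthogonal_matrix Q \<Longrightarrow> psd (conj_by Q A) \<longleftrightarrow> psd A"
proof
  assume Q: "orthogonal_matrix Q" and "psd (conj_by Q A)"
  then show "psd A"
    using psd_congruence[of "conj_by Q A" "transpose Q"] by (simp add: conj_by_unconj)
qed (simp add: psd_conj_by)

lemma admissible_orthogonal: "admissible Q M N \<Longrightarrow> orthogonal_matrix Q"
  by (simp add: admissible_def)

text \<open>The Loewner order is invariant under orthogonal conjugation, so admissibility can be
  read in the original coordinates as \<open>T M T \<le> N\<close>.\<close>

lemma admissible_iff:
  "admissible Q M N \<longleftrightarrow> orthogonal_matrix Q \<and>
     spec Q (dfac Q M N) ** M ** spec Q (dfac Q M N) \<le>\<^sub>L N"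
proof (cases "orthogonal_matrix Q")
  case True
  show ?thesis
    unfolding admissible_def loewner_le_def Dmat_eq
    by (simp add: True psd_conj_by_iff flip: conj_by_spec_sandwich conj_by_diff)
qed (simp add: admissible_def)

text \<open>Weak duality for matrices: \<open>R\<close> is an eigenbasis of \<open>P\<close>, in
  which \<open>T\<close> is diagonal as the inverse of \<open>P\<close>, and the scalar bound
  applies to each eigenvalue. A dual value below the optimum would therefore exhibit a better
  frame.\<close>

lemma dual_value_le:
  fixes P T M N :: "real^'n^'n"
  assumes sym: "transpose P = P" and ge: "\<And>x. x \<bullet> x \<le> x \<bullet> (P *v x)" and TP: "T ** P = mat 1"
    and M: "psd M" and N: "psd N"
  obtains R where "orthogonal_matrix R"
    "trace M + trace N - (\<Sum>i\<in>UNIV. (max (sqrt (conj_by R M $ i $ i) - sqrt (conj_by R N $ i $ i)) 0)\<^sup>2)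
       \<le> trace (M ** T) + trace (N ** P)"
proof -
  obtain R p where R: "orthogonal_matrix R" and P: "P = spec R p"
    using spectral_theorem[OF sym] by blast
  have p: "1 \<le> p i" for i
    using ge[of "column i R"] R by (simp add: P column_spec column_unit)
  then have p0: "p i \<noteq> 0" for i by (metis not_one_le_zero)
  have "P ** spec R (\<lambda>i. 1 / p i) = mat 1"
    using R p0 by (simp add: P spec_mult spec_one)
  then have T: "T = spec R (\<lambda>i. 1 / p i)"
    using TP by (metis matrix_mul_assoc matrix_mul_lid matrix_mul_rid)
  have "trace M + trace N - (\<Sum>i\<in>UNIV. (max (sqrt (conj_by R M $ i $ i) - sqrt (conj_by R N $ i $ i)) 0)\<^sup>2)
    = (\<Sum>i\<in>UNIV. conj_by R M $ i $ i + conj_by R N $ i $ i -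
        (max (sqrt (conj_by R M $ i $ i) - sqrt (conj_by R N $ i $ i)) 0)\<^sup>2)"
    by (simp add: trace_eq_sum_conj_by[OF R] sum.distrib sum_subtractf)
  also have "\<dots> \<le> (\<Sum>i\<in>UNIV. conj_by R M $ i $ i / p i + p i * conj_by R N $ i $ i)"
    using M N p by (intro sum_mono bures_summand_bound conj_by_diag_nonneg)
  also have "\<dots> = trace (M ** T) + trace (N ** P)"
    by (simp add: T P trace_mult_spec sum.distrib)
  finally show ?thesis using that R by blast
qed

lemma admissible_exists:
  fixes M N :: "real^'n^'n"
  assumes M: "psd M" and N: "psd N"
  shows "\<exists>Q. admissible Q M N"
proof -
  define g where "g Q = (\<Sum>i\<in>UNIV. (max (sqrt (conj_by Q M $ i $ i) - sqrt (conj_by Q N $ i $ i)) 0)\<^sup>2)"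
    for Q :: "real^'n^'n"
  have "continuous_on UNIV g"
    unfolding g_def conj_by_nth column_def inner_vec_def matrix_vector_mult_def
    by (intro continuous_intros)
  then obtain Q where Q: "orthogonal_matrix Q" and max: "\<And>R. orthogonal_matrix R \<Longrightarrow> g R \<le> g Q"
    using orthogonal_attains_sup by blast
  define t where "t = dfac Q M N"
  define T where "T = spec Q t"
  \<comment> \<open>\<open>n\<close> marks the directions where \<open>T\<close> is singular; there
    the scalar dual problem has no minimizer.\<close>
  define n where "n i = (of_bool (t i = 0) :: real)" for i
  have t: "0 \<le> t i" "t i \<le> 1" for i unfolding t_def using dfac_bounds[OF M N] by auto
  \<comment> \<open>Adding \<open>\<epsilon> *\<^sub>R outer w w\<close> to the dual variable raises
    the \<open>N\<close> part of the dual value by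
    \<open>\<epsilon> * (w \<bullet> (N *v w))\<close> and lowers the \<open>M\<close> part by
    \<open>\<epsilon> * (y \<bullet> (M *v y))\<close> to first order. Maximality of
    \<open>g Q\<close> forbids a net decrease; dividing by \<open>\<epsilon>\<close> gives
    \<open>ineq\<close>, and its limit at 0 is the claim.\<close>
  have key: "(T *v w) \<bullet> (M *v (T *v w)) \<le> w \<bullet> (N *v w)" for w
  proof -
    define z where "z = spec Q n *v w"
    define y where "y = T *v w"
    define \<kappa> where "\<kappa> = w \<bullet> y"
    define \<rho> where "\<rho> = w \<bullet> z"
    have ineq: "y \<bullet> (M *v y) + \<epsilon>\<^sup>2 * (y \<bullet> (M *v z) + z \<bullet> (M *v y)) + \<epsilon>^4 * (z \<bullet> (M *v z))
        \<le> (w \<bullet> (N *v w) + \<epsilon> * trace M) * (1 + \<epsilon> * (\<kappa> + \<epsilon>\<^sup>2 * \<rho>))"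
      if e: "0 < \<epsilon>" "\<epsilon> < 1" for \<epsilon> :: real
    proof -
      \<comment> \<open>Directions with \<open>t\<^sub>i = 0\<close> are lifted to \<open>\<epsilon>\<^sup>2\<close> so that \<open>S\<close> is invertible; this costs only
        \<open>o(\<epsilon>)\<close> against the perturbation of size \<open>\<epsilon>\<close>.\<close>
      define s where "s i = t i + \<epsilon>\<^sup>2 * n i" for i
      have e2: "\<epsilon>\<^sup>2 < 1" "0 < \<epsilon>\<^sup>2" using e by (auto simp: power_less_one_iff)
      have s: "0 < s i" "s i \<le> 1" for i
        using t[of i] e2 by (auto simp: s_def n_def less_le)
      define S where "S = spec Q s"
      define P where "P = spec Q (\<lambda>i. 1 / s i)"
      define u where "u = S *v w"
      have u: "u = y + \<epsilon>\<^sup>2 *\<^sub>R z"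
        unfolding u_def y_def z_def S_def T_def
        by (subst vector_eq_ldot[symmetric])
           (simp add: dot_spec inner_add_right s_def sum_distrib_left algebra_simps flip: sum.distrib)
      have SP: "S ** P = mat 1"
        using s Q by (simp add: S_def P_def spec_mult spec_one less_imp_neq[THEN not_sym])
      have SPx: "S *v (P *v x) = x" for x by (simp add: matrix_vector_mul_assoc SP)
      have Ssym: "transpose S = S" by (simp add: S_def)
      have Psym: "transpose P = P" by (simp add: P_def)
      have wu: "0 \<le> w \<bullet> u" "w \<bullet> u = \<kappa> + \<epsilon>\<^sup>2 * \<rho>"
        using psd_spec[of s Q] s by (auto simp: u_def S_def psd_def less_imp_le)
           (simp add: u_def[symmetric] u S_def[symmetric] inner_add_right \<kappa>_def \<rho>_def)
      \<comment> \<open>Sherman-Morrison: \<open>S'\<close> is the inverse of \<open>P'\<close>.\<close>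
      define c where "c = \<epsilon> / (1 + \<epsilon> * (w \<bullet> u))"
      have pos: "0 < 1 + \<epsilon> * (w \<bullet> u)" using e wu by (simp add: add_pos_nonneg)
      define P' where "P' = P + \<epsilon> *\<^sub>R outer w w"
      define S' where "S' = S - c *\<^sub>R outer u u"
      have P'v: "P' *v x = P *v x + (\<epsilon> * (w \<bullet> x)) *\<^sub>R w" for x
        by (simp add: P'_def matrix_vector_mult_add_rdistrib outer_mult_vec scaleR_matrix_vector_assoc[symmetric])
      have "S' *v (P' *v x) = x" for x
      proof -
        have "u \<bullet> (P *v x) = w \<bullet> x"
          using dot_matrix_transpose[of w S "P *v x"] by (simp add: u_def Ssym SPx)
        then have "u \<bullet> (P' *v x) = (w \<bullet> x) * (1 + \<epsilon> * (w \<bullet> u))"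
          by (simp add: P'v inner_add_right inner_commute[of u w] algebra_simps)
        then have "c * (u \<bullet> (P' *v x)) = \<epsilon> * (w \<bullet> x)" using pos by (simp add: c_def)
        moreover have "S *v (P' *v x) = x + (\<epsilon> * (w \<bullet> x)) *\<^sub>R u"
          by (simp add: P'v matrix_vector_right_distrib matrix_vector_mult_scaleR SPx u_def)
        ultimately show ?thesis
          by (simp add: S'_def matrix_vector_mult_diff_rdistrib outer_mult_vec scaleR_matrix_vector_assoc[symmetric])
      qed
      then have SP': "S' ** P' = mat 1" by (simp add: matrix_eq matrix_vector_mul_assoc)
      have P'sym: "transpose P' = P'"
        using Psym transpose_outer[of w w] by (simp add: P'_def transpose_def vec_eq_iff)
      have P'ge: "x \<bullet> x \<le> x \<bullet> (P' *v x)" for x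
      proof -
        have "x \<bullet> x = (\<Sum>i\<in>UNIV. 1 * (column i Q \<bullet> x) * (column i Q \<bullet> x))"
          using dot_orthogonal_sum[OF Q, of x x] by simp
        also have "\<dots> \<le> x \<bullet> (P *v x)"
          unfolding P_def dot_spec mult.assoc using s by (intro sum_mono mult_right_mono) auto
        also have "\<dots> \<le> x \<bullet> (P' *v x)" using e by (simp add: P'v inner_add_right inner_commute mult.assoc)
        finally show ?thesis .
      qed
      obtain R where R: "orthogonal_matrix R"
        "trace M + trace N - g R \<le> trace (M ** S') + trace (N ** P')"
        using dual_value_le[OF P'sym P'ge SP' M N] unfolding g_def by blast
      have tr: "trace (A ** (B + k *\<^sub>R C)) = trace (A ** B) + k * trace (A ** C)"
        for A B C :: "real^'n^'n" and k
        by (simp add: trace_def matrix_matrix_mult_def sum.distrib algebra_simps sum_distrib_left)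
      have "trace (M ** S') = trace (M ** S) - c * (u \<bullet> (M *v u))"
        using tr[of M S "- c"] by (simp add: S'_def trace_mult_outer)
      moreover have "trace (N ** P') = trace (N ** P) + \<epsilon> * (w \<bullet> (N *v w))"
        by (simp add: P'_def tr trace_mult_outer)
      moreover have "trace (M ** S) + trace (N ** P) \<le> trace M + trace N - g Q + \<epsilon>\<^sup>2 * trace M"
      proof -
        \<comment> \<open>In a lifted direction \<open>b = 0\<close>, the optimal scalar value is 0
          and the lift costs exactly \<open>\<epsilon>\<^sup>2 * a\<close>; in the others
          \<open>s i = t i\<close> attains the scalar minimum.\<close>
        have "s i * a + b / s i \<le> a + b - (max (sqrt a - sqrt b) 0)\<^sup>2 + \<epsilon>\<^sup>2 * a"
          if ab: "a = conj_by Q M $ i $ i" "b = conj_by Q N $ i $ i" for i a b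
        proof -
          have nn: "0 \<le> a" "0 \<le> b" using ab M N by (simp_all add: conj_by_diag_nonneg)
          show ?thesis
          proof (cases "t i = 0")
            case True
            then have "a \<noteq> 0" "b = 0" using nn by (auto simp: t_def dfac_def min_def ab split: if_splits)
            then show ?thesis using True nn by (simp add: s_def n_def)
          next
            case False
            then have si: "s i = t i" by (simp add: s_def n_def)
            have ti: "t i = (if a = 0 then 1 else min 1 (sqrt (b / a)))"
              unfolding t_def dfac_def ab ..
            have "s i * a + b / s i = a + b - (max (sqrt a - sqrt b) 0)\<^sup>2"
              using bures_summand_eq[OF nn] False unfolding si ti by blast
            then show ?thesis using nn by simp
          qed
        qed
        then show ?thesis
          unfolding S_def P_def trace_mult_spec g_def
            trace_eq_sum_conj_by[OF Q, of M] trace_eq_sum_conj_by[OF Q, of N]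
          by (auto simp: sum_distrib_left simp flip: sum.distrib sum_subtractf intro!: sum_mono)
      qed
      moreover have "g R \<le> g Q" using max R by blast
      ultimately have "c * (u \<bullet> (M *v u)) \<le> \<epsilon> * (w \<bullet> (N *v w)) + \<epsilon>\<^sup>2 * trace M" using R(2) by linarith
      then have "\<epsilon> * (u \<bullet> (M *v u)) \<le> (\<epsilon> * (w \<bullet> (N *v w)) + \<epsilon>\<^sup>2 * trace M) * (1 + \<epsilon> * (w \<bullet> u))"
        using pos by (simp add: c_def divide_le_eq)
      also have "\<dots> = \<epsilon> * ((w \<bullet> (N *v w) + \<epsilon> * trace M) * (1 + \<epsilon> * (w \<bullet> u)))"
        by (simp add: power2_eq_square algebra_simps)
      finally have "u \<bullet> (M *v u) \<le> (w \<bullet> (N *v w) + \<epsilon> * trace M) * (1 + \<epsilon> * (w \<bullet> u))"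
        using e by simp
      moreover have "u \<bullet> (M *v u) = y \<bullet> (M *v y) + \<epsilon>\<^sup>2 * (y \<bullet> (M *v z) + z \<bullet> (M *v y)) + \<epsilon>^4 * (z \<bullet> (M *v z))"
        unfolding u
        by (simp add: matrix_vector_right_distrib matrix_vector_mult_scaleR inner_add_left inner_add_right
            power2_eq_square power4_eq_xxxx algebra_simps)
      ultimately show ?thesis unfolding wu(2) by simp
    qed
    have "((\<lambda>\<epsilon>. y \<bullet> (M *v y) + \<epsilon>\<^sup>2 * (y \<bullet> (M *v z) + z \<bullet> (M *v y)) + \<epsilon>^4 * (z \<bullet> (M *v z)))
        \<longlongrightarrow> y \<bullet> (M *v y)) (at_right 0)"
      by (auto intro!: tendsto_eq_intros)
    moreover have "((\<lambda>\<epsilon>. (w \<bullet> (N *v w) + \<epsilon> * trace M) * (1 + \<epsilon> * (\<kappa> + \<epsilon>\<^sup>2 * \<rho>)))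
        \<longlongrightarrow> w \<bullet> (N *v w)) (at_right 0)"
      by (auto intro!: tendsto_eq_intros)
    moreover have "eventually (\<lambda>\<epsilon>. 0 < \<epsilon> \<and> \<epsilon> < 1) (at_right (0::real))"
      using eventually_at_right_real[of 0 1] by (simp add: eventually_mono)
    then have "eventually (\<lambda>\<epsilon>.
        y \<bullet> (M *v y) + \<epsilon>\<^sup>2 * (y \<bullet> (M *v z) + z \<bullet> (M *v y)) + \<epsilon>^4 * (z \<bullet> (M *v z))
        \<le> (w \<bullet> (N *v w) + \<epsilon> * trace M) * (1 + \<epsilon> * (\<kappa> + \<epsilon>\<^sup>2 * \<rho>))) (at_right 0)"
      by eventually_elim (use ineq in blast)
    ultimately have "y \<bullet> (M *v y) \<le> w \<bullet> (N *v w)"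
      by (intro tendsto_le[OF trivial_limit_at_right_real])
    then show ?thesis by (simp add: y_def)
  qed
  have "T ** M ** T \<le>\<^sub>L N"
    using key by (simp add: loewner_le_dot psd_spec_sandwich M N T_def spec_sandwich_quad)
  then show ?thesis using Q admissible_iff unfolding T_def t_def by blast
qed

section \<open>Algebra of the candidate for the projection onto covariances above
  \<open>M\<close>\<close>

lemma psd_diag_zero:
  assumes A: "psd A" and "A $ i $ i = 0"
  shows "A $ i $ j = 0" "A $ j $ i = 0"
proof -
  have nth: "axis k 1 \<bullet> (A *v axis l 1) = A $ k $ l" for k l
    by (simp add: inner_axis' matrix_vector_mul_component inner_axis)
  have "A *v axis i 1 = 0" using assms nth by (intro psd_quad_zero) simp_all
  then show "A $ j $ i = 0" using nth[of j i] by simp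
  then show "A $ i $ j = 0" using arg_cong[OF psd_symD[OF A], of "\<lambda>X. X $ i $ j"]
    by (simp add: transpose_def)
qed

text \<open>Unlike \<^const>\<open>dfac\<close>, this vanishes in the null directions of \<open>N\<close>, even where \<open>M\<close> vanishes too.\<close>

definition efac :: "real^'n^'n \<Rightarrow> real^'n^'n \<Rightarrow> real^'n^'n \<Rightarrow> 'n \<Rightarrow> real" where
  "efac Q M N i = (if conj_by Q N $ i $ i > 0 then dfac Q M N i else 0)"

lemma efac_bounds:
  assumes "psd M" "psd N"
  shows "0 \<le> efac Q M N i" "efac Q M N i \<le> 1"
  using assms by (auto simp: efac_def dfac_bounds)

lemma dfac_pos: "psd M \<Longrightarrow> conj_by Q N $ i $ i > 0 \<Longrightarrow> dfac Q M N i > 0"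
  using conj_by_diag_nonneg[of M Q i] by (auto simp: dfac_def)

lemma diagm_sandwich_nth: "(diagm a ** A ** diagm b) $ i $ j = a i * A $ i $ j * b j"
  by (simp add: matrix_matrix_mult_def if_distrib[of "\<lambda>x. _ * x"] if_distrib[of "\<lambda>x. x * _"] cong: if_cong)

lemma conj_by_congr: "orthogonal_matrix Q \<Longrightarrow> conj_by Q (Q ** A ** transpose Q) = A"
proof -
  assume Q: "orthogonal_matrix Q"
  have "conj_by Q (Q ** A ** transpose Q) = (transpose Q ** Q) ** A ** (transpose Q ** Q)"
    by (simp add: conj_by_def matrix_mul_assoc)
  then show ?thesis using Q by (simp add: orthogonal_transpose_mult)
qed

context
  fixes Q M N J :: "real^'n^'n"
  assumes M: "psd M" and N: "psd N" and adm: "admissible Q M N"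
    and J_def: "J = Q ** SigmaJ Q M N ** transpose Q"
begin

lemma conj_by_J: "conj_by Q J = SigmaJ Q M N"
  by (simp add: J_def conj_by_congr admissible_orthogonal[OF adm])

lemma SigmaJ_nth:
  "SigmaJ Q M N $ i $ j =
     (if conj_by Q N $ i $ i > 0 \<and> conj_by Q N $ j $ j > 0
      then conj_by Q N $ i $ j / (dfac Q M N i * dfac Q M N j) else conj_by Q M $ i $ j)"
  using conj_by_diag_nonneg[OF N, of Q i] conj_by_diag_nonneg[OF N, of Q j]
  by (auto simp: SigmaJ_def Dmat_eq zero_less_mult_iff)

text \<open>In the frame, \<open>J - M\<close> is the admissibility gap \<open>N - D M D\<close>
  multiplied on both sides by \<open>h\<close>, which inverts \<open>D\<close> where
  \<open>N\<close> has positive variance and is 0 elsewhere. Entries meeting a null direction of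
  \<open>N\<close> agree for \<open>J\<close> and \<open>M\<close>.\<close>

lemma psd_J_diff: "psd (J - M)"
proof -
  define h where "h i = (if conj_by Q N $ i $ i > 0 then 1 / dfac Q M N i else 0)" for i
  have "conj_by Q (J - M) = diagm h ** (conj_by Q N - Dmat Q M N ** conj_by Q M ** Dmat Q M N) ** diagm h"
  proof -
    have "SigmaJ Q M N $ i $ j - conj_by Q M $ i $ j =
        h i * (conj_by Q N $ i $ j - dfac Q M N i * conj_by Q M $ i $ j * dfac Q M N j) * h j" for i j
      using dfac_pos[OF M, of Q N i] dfac_pos[OF M, of Q N j]
      by (cases "conj_by Q N $ i $ i > 0 \<and> conj_by Q N $ j $ j > 0")
         (auto simp: SigmaJ_nth h_def field_simps)
    then show ?thesis
      by (simp add: vec_eq_iff conj_by_diff conj_by_J diagm_sandwich_nth Dmat_eq)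
  qed
  moreover have "psd (diagm h ** (conj_by Q N - Dmat Q M N ** conj_by Q M ** Dmat Q M N) ** diagm h)"
    using psd_congruence[of _ "diagm h"] adm by (simp add: admissible_def loewner_le_def)
  ultimately show ?thesis using psd_conj_by_iff[OF admissible_orthogonal[OF adm]] by metis
qed

lemma psd_J: "psd J"
  using psd_add[OF psd_J_diff M] by simp

lemma le_J: "M \<le>\<^sub>L J"
  using psd_J_diff by (simp add: loewner_le_def)

text \<open>A zero diagonal entry of the positive semi-definite \<open>N\<close> forces its whole
  row and column to vanish, which matches the directions killed by \<open>efac\<close>.\<close>

lemma spec_sandwich_J: "spec Q (efac Q M N) ** J ** spec Q (efac Q M N) = N"
proof (rule conj_by_inj[OF admissible_orthogonal[OF adm]])
  have "efac Q M N i * SigmaJ Q M N $ i $ j * efac Q M N j = conj_by Q N $ i $ j" for i j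
  proof (cases "conj_by Q N $ i $ i > 0 \<and> conj_by Q N $ j $ j > 0")
    case True
    then show ?thesis using dfac_pos[OF M, of Q N i] dfac_pos[OF M, of Q N j]
      by (simp add: SigmaJ_nth efac_def)
  next
    case False
    then have "conj_by Q N $ i $ i = 0 \<or> conj_by Q N $ j $ j = 0"
      using conj_by_diag_nonneg[OF N, of Q] by (metis less_eq_real_def)
    then have "conj_by Q N $ i $ j = 0"
      using psd_diag_zero(1)[OF psd_conj_by[OF N], of Q i j]
        psd_diag_zero(2)[OF psd_conj_by[OF N], of Q j i] by blast
    then show ?thesis using False by (auto simp: efac_def)
  qed
  then show "conj_by Q (spec Q (efac Q M N) ** J ** spec Q (efac Q M N)) = conj_by Q N"
    by (simp add: conj_by_spec_sandwich admissible_orthogonal[OF adm] conj_by_J vec_eq_iff diagm_sandwich_nth)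
qed

text \<open>The sandwich identity determines the entries between directions of positive variance of
  \<open>N\<close>. In a null direction \<open>diag\<close> makes a diagonal entry of
  \<open>S - M\<close> vanish, and semi-definiteness then clears its row and column. Both conditions
  come from equality in the transport bound.\<close>

lemma J_unique:
  assumes S: "psd S" and le: "M \<le>\<^sub>L S"
    and sand: "spec Q (efac Q M N) ** S ** spec Q (efac Q M N) = N"
    and diag: "\<And>i. efac Q M N i < 1 \<Longrightarrow> conj_by Q S $ i $ i = conj_by Q M $ i $ i"
  shows "S = J"
proof (rule conj_by_inj[OF admissible_orthogonal[OF adm]])
  have e: "efac Q M N i * conj_by Q S $ i $ j * efac Q M N j = conj_by Q N $ i $ j" for i j
    using arg_cong[OF sand, of "\<lambda>X. conj_by Q X $ i $ j"]
    by (simp add: conj_by_spec_sandwich admissible_orthogonal[OF adm] diagm_sandwich_nth)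
  have dz: "conj_by Q S $ i $ j = conj_by Q M $ i $ j \<and> conj_by Q S $ j $ i = conj_by Q M $ j $ i"
    if "\<not> conj_by Q N $ i $ i > 0" for i j
  proof -
    have "psd (conj_by Q (S - M))" using le by (simp add: loewner_le_def psd_conj_by)
    moreover have "conj_by Q (S - M) $ i $ i = 0"
      using diag[of i] that by (simp add: conj_by_diff efac_def)
    ultimately show ?thesis using psd_diag_zero[of "conj_by Q (S - M)" i j] by (simp add: conj_by_diff)
  qed
  have "conj_by Q S $ i $ j = SigmaJ Q M N $ i $ j" for i j
    using e[of i j] dz dfac_pos[OF M, of Q N i] dfac_pos[OF M, of Q N j]
    by (cases "conj_by Q N $ i $ i > 0 \<and> conj_by Q N $ j $ j > 0")
       (auto simp: SigmaJ_nth efac_def nonzero_eq_divide_eq mult_ac)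
  then show "conj_by Q S = conj_by Q J" by (simp add: conj_by_J vec_eq_iff)
qed

end

subsection \<open>The standard Gaussian measure\<close>

lemma measurable_mult_vec [measurable]: "(*v) (A :: real^'n^'m) \<in> borel_measurable borel"
  by (intro borel_measurable_continuous_onI matrix_vector_mult_linear_continuous_on)

lemma measurable_mult_vec' [measurable (raw)]:
  "f \<in> borel_measurable M \<Longrightarrow> (\<lambda>x. (A :: real^'n^'m) *v f x) \<in> borel_measurable M"
  using measurable_compose[OF _ measurable_mult_vec] by blast

lemma nn_integral_lborel_affine:
  fixes f :: "'a::euclidean_space \<Rightarrow> ennreal"
  assumes [measurable]: "f \<in> borel_measurable borel" and c: "\<bar>c\<bar> = 1"
  shows "(\<integral>\<^sup>+x. f (t + c *\<^sub>R x) \<partial>lborel) = (\<integral>\<^sup>+x. f x \<partial>lborel)"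
proof -
  have "c \<noteq> 0" using c by auto
  then have "lborel = distr lborel borel (\<lambda>x. t + c *\<^sub>R x :: 'a)"
    using lborel_affine[of c t] c by (simp add: density_1)
  then have "(\<integral>\<^sup>+x. f x \<partial>lborel) = (\<integral>\<^sup>+x. f x \<partial>distr lborel borel (\<lambda>x. t + c *\<^sub>R x))" by simp
  also have "\<dots> = (\<integral>\<^sup>+x. f (t + c *\<^sub>R x) \<partial>lborel)" by (simp add: nn_integral_distr)
  finally show ?thesis by simp
qed

definition gdens :: "real^'n \<Rightarrow> real" where
  "gdens x = (\<Prod>i\<in>UNIV. std_normal_density (x $ i))"

text \<open>The product density depends on the norm alone; this is the rotation invariance behind
  \<open>nn_integral_lborel_orthogonal\<close>.\<close>

lemma gdens_norm: "gdens (x :: real^'n) = (1 / sqrt (2 * pi)) ^ CARD('n) * exp (- (norm x)\<^sup>2 / 2)"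
proof -
  have "gdens x = (\<Prod>i::'n\<in>UNIV. 1 / sqrt (2 * pi)) * (\<Prod>i\<in>UNIV. exp (- (x $ i)\<^sup>2 / 2))"
    unfolding gdens_def std_normal_density_def prod.distrib ..
  also have "(\<Prod>i\<in>UNIV. exp (- (x $ i)\<^sup>2 / 2)) = exp (\<Sum>i\<in>UNIV. - (x $ i)\<^sup>2 / 2)"
    by (simp add: exp_sum)
  also have "(\<Sum>i\<in>UNIV. - (x $ i)\<^sup>2 / 2) = - (norm x)\<^sup>2 / 2"
    by (simp add: power2_norm_eq_inner inner_vec_def power2_eq_square[of "_ $ _"] sum_negf flip: sum_divide_distrib)
  finally show ?thesis by simp
qed

lemma gdens_nonneg: "0 \<le> gdens x"
  by (simp add: gdens_norm)

lemma measurable_gdens [measurable]: "gdens \<in> borel_measurable borel"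
  unfolding gdens_norm[abs_def] by measurable

lemma std_gaussian_eq: "std_gaussian = density lborel (\<lambda>x. ennreal (gdens x))"
  by (simp add: std_gaussian_def gdens_def)

lemma sets_std_gaussian [simp, measurable_cong]: "sets std_gaussian = sets borel"
  by (simp add: std_gaussian_eq)

lemma space_std_gaussian [simp]: "space std_gaussian = UNIV"
  by (simp add: std_gaussian_eq)

text \<open>Fubini for Lebesgue measure seen as an image of the product over \<open>Basis\<close>;
  the work lies in reindexing \<open>Basis\<close> by the coordinates.\<close>

lemma lborel_prod_integral:
  fixes f :: "'n::finite \<Rightarrow> real \<Rightarrow> real"
  assumes f: "\<And>i. integrable lborel (f i)"
  shows "integrable lborel (\<lambda>z::real^'n. \<Prod>i\<in>UNIV. f i (z $ i))" (is ?I)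
    and "(\<integral>z. (\<Prod>i\<in>UNIV. f i (z $ i)) \<partial>(lborel :: (real^'n) measure)) = (\<Prod>i\<in>UNIV. \<integral>x. f i x \<partial>lborel)" (is ?E)
proof -
  interpret product_sigma_finite "\<lambda>_::real^'n. lborel :: real measure" ..
  have [measurable]: "f i \<in> borel_measurable borel" for i using f[of i] by simp
  have inj: "inj_on (\<lambda>i. axis i (1::real) :: real^'n) UNIV"
    by (auto simp: inj_on_def axis_eq_axis)
  have B: "Basis = range (\<lambda>i. axis i (1::real) :: real^'n)" by (auto simp: Basis_vec_def)
  have reindex: "(\<Prod>b\<in>Basis. g (axis_index b) b) = (\<Prod>i\<in>UNIV. g i (axis i 1 :: real^'n))"
    for g :: "'n \<Rightarrow> real^'n \<Rightarrow> real"
    by (simp add: B prod.reindex[OF inj])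
  have nth: "(\<Sum>b\<in>Basis. y b *\<^sub>R b) $ i = y (axis i 1 :: real^'n)" for y :: "real^'n \<Rightarrow> real" and i
  proof -
    have "axis i 1 \<in> (Basis :: (real^'n) set)" by (simp add: B)
    then have "(\<Sum>b\<in>Basis. y b *\<^sub>R b) \<bullet> axis i 1 = y (axis i 1)" by (rule inner_sum_left_Basis)
    then show ?thesis unfolding cart_eq_inner_axis .
  qed
  have int: "integrable (\<Pi>\<^sub>M b\<in>(Basis::(real^'n) set). lborel) (\<lambda>y. \<Prod>b\<in>Basis. f (axis_index b) (y b))"
    by (rule product_integrable_prod) (simp_all add: f)
  have F: "(\<lambda>y. \<Prod>i\<in>UNIV. f i ((\<Sum>b\<in>Basis. y b *\<^sub>R b :: real^'n) $ i)) = (\<lambda>y. \<Prod>b\<in>Basis. f (axis_index b) (y b))"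
  proof
    fix y :: "real^'n \<Rightarrow> real"
    show "(\<Prod>i\<in>UNIV. f i ((\<Sum>b\<in>Basis. y b *\<^sub>R b :: real^'n) $ i)) = (\<Prod>b\<in>Basis. f (axis_index b) (y b))"
      unfolding nth using reindex[of "\<lambda>i b. f i (y b)"] by simp
  qed
  show ?I
    unfolding lborel_eq[where 'a="real^'n"] using int by (subst integrable_distr_eq) (simp_all add: F del: sum_component)
  have "(\<integral>z. (\<Prod>i\<in>UNIV. f i (z $ i)) \<partial>(lborel :: (real^'n) measure)) =
     (\<integral>y. (\<Prod>b\<in>Basis. f (axis_index b) (y b)) \<partial>(\<Pi>\<^sub>M b\<in>(Basis::(real^'n) set). lborel))"
    unfolding lborel_eq[where 'a="real^'n"] by (subst integral_distr) (simp_all add: F del: sum_component)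
  also have "\<dots> = (\<Prod>b\<in>(Basis::(real^'n) set). \<integral>x. f (axis_index b) x \<partial>lborel)"
    by (rule product_integral_prod) (simp_all add: f)
  also have "\<dots> = (\<Prod>i\<in>UNIV. \<integral>x. f i x \<partial>lborel)"
    using reindex[of "\<lambda>i b. \<integral>x. f i x \<partial>lborel"] by simp
  finally show ?E .
qed

lemma std_gaussian_prod_integral:
  fixes h :: "'n::finite \<Rightarrow> real \<Rightarrow> real"
  assumes h: "\<And>i. integrable lborel (\<lambda>x. std_normal_density x * h i x)"
    and [measurable]: "\<And>i. h i \<in> borel_measurable borel"
  shows "integrable std_gaussian (\<lambda>z::real^'n. \<Prod>i\<in>UNIV. h i (z $ i))"
    and "(\<integral>z. (\<Prod>i\<in>UNIV. h i (z $ i)) \<partial>(std_gaussian :: (real^'n) measure)) =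
      (\<Prod>i\<in>UNIV. \<integral>x. std_normal_density x * h i x \<partial>lborel)"
  using lborel_prod_integral[OF h]
  by (simp_all add: std_gaussian_eq integrable_density integral_density gdens_nonneg)
     (simp_all add: gdens_def prod.distrib)

lemma prob_space_std_gaussian: "prob_space (std_gaussian :: (real^'n) measure)"
proof
  have 1: "integrable lborel std_normal_density" "(\<integral>x. std_normal_density x \<partial>lborel) = 1"
    using integrable_std_normal_moment[of 0] integral_std_normal_moment_even[of 0] by simp_all
  have "emeasure (std_gaussian :: (real^'n) measure) UNIV = (\<integral>\<^sup>+z. ennreal (gdens (z :: real^'n)) \<partial>lborel)"
    by (simp add: std_gaussian_eq emeasure_density)
  also have "\<dots> = ennreal (\<integral>z. gdens (z :: real^'n) \<partial>lborel)"
  proof (rule nn_integral_eq_integral)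
    show "integrable lborel (gdens :: real^'n \<Rightarrow> real)"
      using lborel_prod_integral(1)[of "\<lambda>_::'n. std_normal_density"] 1 by (simp add: gdens_def[abs_def])
  qed (simp add: gdens_nonneg)
  also have "\<dots> = 1"
    using lborel_prod_integral(2)[of "\<lambda>_::'n. std_normal_density"] 1 by (simp add: gdens_def)
  finally show "emeasure (std_gaussian :: (real^'n) measure) (space std_gaussian) = 1" by simp
qed

lemma std_gaussian_coord:
  fixes i j :: "'n::finite"
  shows "integrable (std_gaussian :: (real^'n) measure) (\<lambda>z. z $ i)"
    and "(\<integral>z. z $ i \<partial>(std_gaussian :: (real^'n) measure)) = 0"
    and "integrable (std_gaussian :: (real^'n) measure) (\<lambda>z. z $ i * z $ j)"
    and "(\<integral>z. z $ i * z $ j \<partial>(std_gaussian :: (real^'n) measure)) = (if i = j then 1 else 0)"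
proof -
  have mom: "integrable lborel (\<lambda>x. std_normal_density x * (x * x))"
    "integrable lborel (\<lambda>x. std_normal_density x * x)"
    "integrable lborel (\<lambda>x. std_normal_density x)"
    "(\<integral>x. std_normal_density x * (x * x) \<partial>lborel) = 1"
    "(\<integral>x. std_normal_density x * x \<partial>lborel) = 0"
    "(\<integral>x. std_normal_density x \<partial>lborel) = 1"
    using integrable_std_normal_moment[of 0] integrable_std_normal_moment[of 1]
      integrable_std_normal_moment[of 2] integral_std_normal_moment_even[of 0]
      integral_std_normal_moment_even[of 1] integral_std_normal_moment_odd[of 0]
    by (simp_all add: power2_eq_square)
  \<comment> \<open>The monomials are written as full products over the coordinates, with factor 1
    away from \<open>i\<close> and \<open>j\<close>; for \<open>i = j\<close> the factor of
    \<open>h2\<close> is a square.\<close>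
  define h1 where "h1 k x = (if k = i then x else 1)" for k and x :: real
  define h2 where "h2 k x = (if k = i then x else 1) * (if k = j then x else 1)" for k and x :: real
  have p1: "(\<Prod>k\<in>UNIV. h1 k (z $ k)) = z $ i" for z :: "real^'n"
    by (simp add: h1_def)
  have p2: "(\<Prod>k\<in>UNIV. h2 k (z $ k)) = z $ i * z $ j" for z :: "real^'n"
    by (simp add: h2_def prod.distrib)
  have [measurable]: "h1 k \<in> borel_measurable borel" "h2 k \<in> borel_measurable borel" for k
    by (simp_all add: h1_def[abs_def] h2_def[abs_def])
  have 1: "integrable lborel (\<lambda>x. std_normal_density x * h1 k x)" for k
    using mom by (cases "k = i") (simp_all add: h1_def)
  have 2: "integrable lborel (\<lambda>x. std_normal_density x * h2 k x)" for k
    using mom by (cases "k = i"; cases "k = j") (simp_all add: h2_def)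
  show "integrable (std_gaussian :: (real^'n) measure) (\<lambda>z. z $ i)"
    using std_gaussian_prod_integral(1)[of h1, OF 1] by (simp add: p1)
  show "integrable (std_gaussian :: (real^'n) measure) (\<lambda>z. z $ i * z $ j)"
    using std_gaussian_prod_integral(1)[of h2, OF 2] by (simp add: p2)
  have "(\<Prod>k\<in>UNIV. \<integral>x. std_normal_density x * h1 k x \<partial>lborel) = 0"
    by (rule prod_zero) (auto intro!: exI[of _ i] simp: h1_def mom)
  then show "(\<integral>z. z $ i \<partial>(std_gaussian :: (real^'n) measure)) = 0"
    using std_gaussian_prod_integral(2)[of h1, OF 1] by (simp add: p1)
  have "(\<Prod>k\<in>UNIV. \<integral>x. std_normal_density x * h2 k x \<partial>lborel) = (if i = j then 1 else 0)"
  proof (cases "i = j")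
    case True
    then have "(\<integral>x. std_normal_density x * h2 k x \<partial>lborel) = 1" for k
      using mom by (cases "k = i") (simp_all add: h2_def)
    then show ?thesis using True by simp
  next
    case False
    then have "(\<integral>x. std_normal_density x * h2 i x \<partial>lborel) = 0" using mom by (simp add: h2_def)
    then show ?thesis using False by (auto intro!: prod_zero)
  qed
  then show "(\<integral>z. z $ i * z $ j \<partial>(std_gaussian :: (real^'n) measure)) = (if i = j then 1 else 0)"
    using std_gaussian_prod_integral(2)[of h2, OF 2] by (simp add: p2)
qed

lemma orthogonal_norm: "orthogonal_matrix W \<Longrightarrow> norm (W *v x) = norm (x :: real^'n)"
  using orthogonal_transformation_norm[of "(*v) W" x] by (simp add: orthogonal_transformation_matrix)

text \<open>Uniqueness of Haar measure, tested against the rotation invariant density \<^const>\<open>gdens\<close>: after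
  inserting its integral, two translations exchange the roles of \<open>f\<close> and the density.\<close>

lemma nn_integral_lborel_orthogonal:
  fixes f :: "real^'n \<Rightarrow> ennreal"
  assumes W: "orthogonal_matrix W" and [measurable]: "f \<in> borel_measurable borel"
  shows "(\<integral>\<^sup>+z. f (W *v z) \<partial>lborel) = (\<integral>\<^sup>+z. f z \<partial>lborel)"
proof -
  interpret G: prob_space "std_gaussian :: (real^'n) measure" by (rule prob_space_std_gaussian)
  define h :: "real^'n \<Rightarrow> ennreal" where "h x = ennreal (gdens x)" for x
  have hm [measurable]: "h \<in> borel_measurable borel" unfolding h_def[abs_def] by simp
  have h1: "(\<integral>\<^sup>+x. h x \<partial>lborel) = 1"
    using G.emeasure_space_1 by (simp add: std_gaussian_eq emeasure_density h_def)
  have hW: "h (W *v z) = h z" for z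
    using W by (simp add: h_def gdens_norm orthogonal_norm)
  have [simp]: "W *v (transpose W *v x) = x" for x
    using W by (simp add: matrix_vector_mul_assoc orthogonal_mult_transpose)
  have sh: "(\<integral>\<^sup>+x. g (t + x) \<partial>lborel) = (\<integral>\<^sup>+x. g x \<partial>lborel)" "(\<integral>\<^sup>+x. g (t - x) \<partial>lborel) = (\<integral>\<^sup>+x. g x \<partial>lborel)"
    if "g \<in> borel_measurable borel" for g :: "real^'n \<Rightarrow> ennreal" and t
    using nn_integral_lborel_affine[OF that, of 1 t] nn_integral_lborel_affine[OF that, of "-1" t] by simp_all
  have "(\<integral>\<^sup>+z. f (W *v z) \<partial>lborel) = (\<integral>\<^sup>+z. \<integral>\<^sup>+x. f (W *v z) * h (W *v z + x) \<partial>lborel \<partial>lborel)"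
    by (simp add: nn_integral_cmult sh h1)
  also have "\<dots> = (\<integral>\<^sup>+x. \<integral>\<^sup>+z. f (W *v z) * h (W *v z + x) \<partial>lborel \<partial>lborel)"
    by (rule lborel_pair.Fubini') measurable
  also have "\<dots> = (\<integral>\<^sup>+x. \<integral>\<^sup>+z. f (W *v z - x) * h (W *v z) \<partial>lborel \<partial>lborel)"
  proof (rule nn_integral_cong)
    fix x :: "real^'n"
    have "(\<integral>\<^sup>+z. f (W *v z) * h (W *v z + x) \<partial>lborel) =
        (\<integral>\<^sup>+z. f (W *v (- (transpose W *v x) + z)) * h (W *v (- (transpose W *v x) + z) + x) \<partial>lborel)"
      by (rule sh(1)[symmetric]) measurable
    then show "(\<integral>\<^sup>+z. f (W *v z) * h (W *v z + x) \<partial>lborel) = (\<integral>\<^sup>+z. f (W *v z - x) * h (W *v z) \<partial>lborel)"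
      by (simp add: matrix_vector_right_distrib matrix_vector_mult_diff_distrib)
  qed
  also have "\<dots> = (\<integral>\<^sup>+z. \<integral>\<^sup>+x. f (W *v z - x) * h (W *v z) \<partial>lborel \<partial>lborel)"
    by (rule lborel_pair.Fubini') measurable
  also have "\<dots> = (\<integral>\<^sup>+z. h z * (\<integral>\<^sup>+x. f x \<partial>lborel) \<partial>lborel)"
  proof (rule nn_integral_cong)
    fix z :: "real^'n"
    have "(\<integral>\<^sup>+x. f (W *v z - x) * h (W *v z) \<partial>lborel) = (\<integral>\<^sup>+x. f (W *v z - x) \<partial>lborel) * h (W *v z)"
      by (rule nn_integral_multc) measurable
    then show "(\<integral>\<^sup>+x. f (W *v z - x) * h (W *v z) \<partial>lborel) = h z * (\<integral>\<^sup>+x. f x \<partial>lborel)"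
      by (simp add: sh hW mult.commute)
  qed
  also have "\<dots> = (\<integral>\<^sup>+z. f z \<partial>lborel)"
    using nn_integral_multc[of h lborel "\<integral>\<^sup>+x. f x \<partial>lborel"] by (simp add: h1)
  finally show ?thesis .
qed

lemma distr_std_gaussian_orthogonal:
  fixes W :: "real^'n^'n"
  assumes W: "orthogonal_matrix W"
  shows "distr std_gaussian borel ((*v) W) = std_gaussian"
proof (rule measure_eqI)
  fix A :: "(real^'n) set" assume "A \<in> sets (distr std_gaussian borel ((*v) W))"
  then have [measurable]: "A \<in> sets borel" by simp
  have "emeasure (distr std_gaussian borel ((*v) W)) A = (\<integral>\<^sup>+z. ennreal (gdens z) * indicator A (W *v z) \<partial>lborel)"
    using measurable_sets_borel[OF measurable_mult_vec, of A W]
    by (simp add: emeasure_distr std_gaussian_eq emeasure_density indicator_vimage)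
  also have "\<dots> = (\<integral>\<^sup>+z. ennreal (gdens (W *v z)) * indicator A (W *v z) \<partial>lborel)"
    using W by (simp add: gdens_norm orthogonal_norm)
  also have "\<dots> = (\<integral>\<^sup>+z. ennreal (gdens z) * indicator A z \<partial>lborel)"
    by (rule nn_integral_lborel_orthogonal[OF W]) measurable
  also have "\<dots> = emeasure std_gaussian A"
    by (simp add: std_gaussian_eq emeasure_density)
  finally show "emeasure (distr std_gaussian borel ((*v) W)) A = emeasure std_gaussian A" .
qed simp

subsection \<open>Gaussian measures and the convex order\<close>

lemma dot_vec_sum: "u \<bullet> (z :: real^'n) = (\<Sum>i\<in>UNIV. u $ i * z $ i)"
  by (simp add: inner_vec_def)

lemma std_gaussian_linear:
  shows "integrable std_gaussian (\<lambda>z. u \<bullet> (z :: real^'n))"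
    and "(\<integral>z. u \<bullet> z \<partial>(std_gaussian :: (real^'n) measure)) = 0"
  by (simp_all add: dot_vec_sum std_gaussian_coord)

lemma std_gaussian_quadratic:
  shows "integrable std_gaussian (\<lambda>z. (u \<bullet> z) * (v \<bullet> (z :: real^'n)))"
    and "(\<integral>z. (u \<bullet> z) * (v \<bullet> z) \<partial>(std_gaussian :: (real^'n) measure)) = u \<bullet> v"
proof -
  have eq: "(u \<bullet> z) * (v \<bullet> z) = (\<Sum>i\<in>UNIV. \<Sum>j\<in>UNIV. u $ i * v $ j * (z $ i * z $ j))" for z :: "real^'n"
    unfolding dot_vec_sum sum_product by (simp add: mult_ac)
  show "integrable std_gaussian (\<lambda>z. (u \<bullet> z) * (v \<bullet> (z :: real^'n)))"
    unfolding eq by (intro Bochner_Integration.integrable_sum integrable_mult_right std_gaussian_coord)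
  have "(\<integral>z. (u \<bullet> z) * (v \<bullet> z) \<partial>(std_gaussian :: (real^'n) measure)) =
      (\<Sum>i\<in>UNIV. \<Sum>j\<in>UNIV. u $ i * v $ j * (if i = j then 1 else 0))"
    unfolding eq by (simp add: Bochner_Integration.integral_sum std_gaussian_coord)
  then show "(\<integral>z. (u \<bullet> z) * (v \<bullet> z) \<partial>(std_gaussian :: (real^'n) measure)) = u \<bullet> v"
    by (simp add: dot_vec_sum if_distrib[of "\<lambda>x. _ * x"] cong: if_cong)
qed

lemma sets_gaussian [simp, measurable_cong]: "sets (gaussian m S) = sets borel"
  by (simp add: gaussian_def)

lemma space_gaussian [simp]: "space (gaussian m S) = UNIV"
  by (simp add: gaussian_def)

lemma prob_space_gaussian: "prob_space (gaussian m S)"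
  unfolding gaussian_def by (intro prob_space.prob_space_distr prob_space_std_gaussian) simp

lemma gaussian_dot:
  fixes S :: "real^'n^'n"
  assumes S: "psd S"
  shows "integrable (gaussian m S) (\<lambda>x. u \<bullet> x)"
    and "(\<integral>x. u \<bullet> x \<partial>gaussian m S) = u \<bullet> m"
    and "integrable (gaussian m S) (\<lambda>x. (u \<bullet> x) * (v \<bullet> x))"
    and "(\<integral>x. (u \<bullet> x) * (v \<bullet> x) \<partial>gaussian m S) = (u \<bullet> m) * (v \<bullet> m) + u \<bullet> (S *v v)"
proof -
  interpret G: prob_space "std_gaussian :: (real^'n) measure" by (rule prob_space_std_gaussian)
  have G1: "measure (std_gaussian :: (real^'n) measure) UNIV = 1" using G.prob_space by simp
  define L where "L = psd_sqrt S"
  have L: "transpose L = L" "L ** L = S" using psd_sqrt[OF S] by (simp_all add: L_def psd_symD)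
  have lin: "u \<bullet> (m + L *v z) = u \<bullet> m + (L *v u) \<bullet> z" for u z
    by (simp add: inner_add_right dot_matrix_transpose[of u L] L)
  have quad: "(u \<bullet> (m + L *v z)) * (v \<bullet> (m + L *v z)) = (u \<bullet> m) * (v \<bullet> m) +
     ((u \<bullet> m) * ((L *v v) \<bullet> z) + (v \<bullet> m) * ((L *v u) \<bullet> z)) + ((L *v u) \<bullet> z) * ((L *v v) \<bullet> z)" for z
    unfolding lin by (simp add: algebra_simps)
  have LL: "(L *v u) \<bullet> (L *v v) = u \<bullet> (S *v v)"
    using dot_matrix_transpose[of u L "L *v v"] L by (simp add: matrix_vector_mul_assoc)
  note [simp] = std_gaussian_linear std_gaussian_quadratic
  have i1: "integrable std_gaussian (\<lambda>z. u \<bullet> (m + L *v z))" unfolding lin by simp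
  have i2: "integrable std_gaussian (\<lambda>z. (u \<bullet> (m + L *v z)) * (v \<bullet> (m + L *v z)))"
    unfolding quad by simp
  show "integrable (gaussian m S) (\<lambda>x. u \<bullet> x)"
    using i1 unfolding gaussian_def L_def[symmetric] by (subst integrable_distr_eq) simp_all
  show "integrable (gaussian m S) (\<lambda>x. (u \<bullet> x) * (v \<bullet> x))"
    using i2 unfolding gaussian_def L_def[symmetric] by (subst integrable_distr_eq) simp_all
  have "(\<integral>x. u \<bullet> x \<partial>gaussian m S) = (\<integral>z. u \<bullet> (m + L *v z) \<partial>std_gaussian)"
    unfolding gaussian_def L_def[symmetric] by (rule integral_distr) simp_all
  also have "\<dots> = u \<bullet> m" unfolding lin by (simp add: G1)
  finally show "(\<integral>x. u \<bullet> x \<partial>gaussian m S) = u \<bullet> m" .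
  have "(\<integral>x. (u \<bullet> x) * (v \<bullet> x) \<partial>gaussian m S) =
      (\<integral>z. (u \<bullet> (m + L *v z)) * (v \<bullet> (m + L *v z)) \<partial>std_gaussian)"
    unfolding gaussian_def L_def[symmetric] by (rule integral_distr) simp_all
  also have "\<dots> = (u \<bullet> m) * (v \<bullet> m) + u \<bullet> (S *v v)"
    unfolding quad by (simp add: G1 LL)
  finally show "(\<integral>x. (u \<bullet> x) * (v \<bullet> x) \<partial>gaussian m S) = (u \<bullet> m) * (v \<bullet> m) + u \<bullet> (S *v v)" .
qed

lemma norm_sq_eq_sum_axis: "(norm (x :: real^'n))\<^sup>2 = (\<Sum>i\<in>UNIV. (axis i 1 \<bullet> x) * (axis i 1 \<bullet> x))"
  unfolding power2_norm_eq_inner inner_axis' by (simp add: inner_vec_def)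

lemma gaussian_in_P2: "psd S \<Longrightarrow> gaussian m S \<in> P2"
  unfolding P2_def norm_sq_eq_sum_axis by (simp add: prob_space_gaussian gaussian_dot)

lemma gaussian_inj:
  assumes S: "psd S" and S': "psd S'" and eq: "gaussian 0 S = gaussian 0 S'"
  shows "S = S'"
  using gaussian_dot(4)[OF S, where m=0] gaussian_dot(4)[OF S', where m=0]
  by (intro matrix_eq_dotI) (simp add: eq)

text \<open>The factors differ by an orthogonal matrix acting first, which preserves the standard
  Gaussian. Thus a centred Gaussian law depends only on its covariance.\<close>

lemma distr_gram_std_gaussian:
  fixes L1 L2 :: "real^'n^'n"
  assumes "L1 ** transpose L1 = L2 ** transpose L2"
  shows "distr std_gaussian borel ((*v) L1) = distr std_gaussian borel ((*v) L2)"
proof -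
  obtain W where W: "orthogonal_matrix W" "L1 = L2 ** W"
    using gram_eq_orthogonal[OF assms] by blast
  have "distr std_gaussian borel ((*v) L2) = distr (distr std_gaussian borel ((*v) W)) borel ((*v) L2)"
    using W by (simp add: distr_std_gaussian_orthogonal)
  also have "\<dots> = distr std_gaussian borel ((*v) L2 \<circ> (*v) W)"
    by (rule distr_distr) simp_all
  also have "(*v) L2 \<circ> (*v) W = (*v) L1"
    by (auto simp: W(2) matrix_vector_mul_assoc)
  finally show ?thesis by simp
qed

lemma gaussian_0: "gaussian 0 S = distr std_gaussian borel ((*v) (psd_sqrt S))"
  by (simp add: gaussian_def)

lemma distr_gaussian_linear:
  fixes S T :: "real^'n^'n"
  assumes S: "psd S"
  shows "distr (gaussian 0 S) borel ((*v) T) = gaussian 0 (T ** S ** transpose T)"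
proof -
  define L where "L = psd_sqrt S"
  have L: "psd L" "L ** L = S" using psd_sqrt[OF S] by (simp_all add: L_def)
  have pT: "psd (T ** S ** transpose T)" using psd_congruence[OF S, of "transpose T"] by simp
  have "distr (gaussian 0 S) borel ((*v) T) = distr std_gaussian borel ((*v) T \<circ> (*v) L)"
    unfolding gaussian_0 L_def[symmetric] by (rule distr_distr) simp_all
  also have "(*v) T \<circ> (*v) L = (*v) (T ** L)" by (auto simp: matrix_vector_mul_assoc)
  also have "distr std_gaussian borel ((*v) (T ** L)) = gaussian 0 (T ** S ** transpose T)"
    unfolding gaussian_0
  proof (rule distr_gram_std_gaussian)
    have "(T ** L) ** transpose (T ** L) = T ** (L ** L) ** transpose T"
      by (simp add: matrix_transpose_mul psd_symD[OF L(1)] matrix_mul_assoc)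
    then show "(T ** L) ** transpose (T ** L) =
        psd_sqrt (T ** S ** transpose T) ** transpose (psd_sqrt (T ** S ** transpose T))"
      using L(2) psd_sqrt_gram[OF pT] by simp
  qed
  finally show ?thesis .
qed

section \<open>Convex functions and matrices that shrink the Gaussian\<close>

lemma convex_on_UNIV_iff:
  fixes f :: "'a::real_vector \<Rightarrow> real"
  shows "convex_on UNIV f \<longleftrightarrow>
    (\<forall>t x y. 0 \<le> t \<longrightarrow> t \<le> 1 \<longrightarrow> f ((1 - t) *\<^sub>R x + t *\<^sub>R y) \<le> (1 - t) * f x + t * f y)"
proof
  assume f: "convex_on UNIV f"
  show "\<forall>t x y. 0 \<le> t \<longrightarrow> t \<le> 1 \<longrightarrow> f ((1 - t) *\<^sub>R x + t *\<^sub>R y) \<le> (1 - t) * f x + t * f y"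
    using convex_onD[OF f] by simp
qed (intro convex_onI, auto simp: less_imp_le)

lemma convex_on_mult_vec:
  fixes A :: "real^'n^'m"
  shows "convex_on UNIV f \<Longrightarrow> convex_on UNIV (\<lambda>x. f (A *v x))"
  by (simp add: convex_on_UNIV_iff matrix_vector_right_distrib matrix_vector_mult_scaleR)

lemma measurable_convex:
  fixes f :: "'a::euclidean_space \<Rightarrow> real"
  shows "convex_on UNIV f \<Longrightarrow> f \<in> borel_measurable borel"
  by (intro borel_measurable_continuous_onI convex_on_continuous) auto

text \<open>The matrices \<open>C\<close> for which the image of the standard Gaussian under
  \<open>C\<close> is below it in the convex order. The set is convex and contains the orthogonal
  matrices, hence the contractions.\<close>

definition shrinking :: "(real^'n^'n) set" where
  "shrinking = {C. \<forall>g. convex_on UNIV g \<longrightarrow> integrable std_gaussian g \<longrightarrow>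
     integrable std_gaussian (\<lambda>z. g (C *v z)) \<and>
     (\<integral>z. g (C *v z) \<partial>std_gaussian) \<le> (\<integral>z. g z \<partial>std_gaussian)}"

lemma std_gaussian_orthogonal_integral:
  fixes f :: "real^'n \<Rightarrow> real"
  assumes W: "orthogonal_matrix W" and [measurable]: "f \<in> borel_measurable borel"
  shows "integrable std_gaussian (\<lambda>z. f (W *v z)) \<longleftrightarrow> integrable std_gaussian f"
    and "(\<integral>z. f (W *v z) \<partial>std_gaussian) = (\<integral>z. f z \<partial>std_gaussian)"
  using integrable_distr_eq[of "(*v) W" std_gaussian borel f]
    integral_distr[of "(*v) W" std_gaussian borel f]
  by (simp_all add: distr_std_gaussian_orthogonal[OF W])

lemma orthogonal_shrinking: "orthogonal_matrix W \<Longrightarrow> W \<in> shrinking"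
  by (simp add: shrinking_def std_gaussian_orthogonal_integral measurable_convex)

lemma shrinking_orthogonal_mult:
  assumes C: "C \<in> shrinking" and U: "orthogonal_matrix U" and W: "orthogonal_matrix W"
  shows "U ** C ** W \<in> shrinking"
  unfolding shrinking_def
proof safe
  fix g :: "real^'a \<Rightarrow> real"
  assume g: "convex_on UNIV g" "integrable std_gaussian g"
  have gU: "convex_on UNIV (\<lambda>z. g (U *v z))" using g(1) by (rule convex_on_mult_vec)
  have gUC: "convex_on UNIV (\<lambda>z. g (U *v (C *v z)))" using convex_on_mult_vec[OF gU] .
  have eq: "g (U ** C ** W *v z) = g (U *v (C *v (W *v z)))" for z
    by (simp add: matrix_vector_mul_assoc matrix_mul_assoc)
  have iU: "integrable std_gaussian (\<lambda>z. g (U *v z))"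
    using std_gaussian_orthogonal_integral(1)[OF U measurable_convex[OF g(1)]] g(2) by simp
  have C': "integrable std_gaussian (\<lambda>z. g (U *v (C *v z)))"
    "(\<integral>z. g (U *v (C *v z)) \<partial>std_gaussian) \<le> (\<integral>z. g (U *v z) \<partial>std_gaussian)"
    using C gU iU unfolding shrinking_def by blast+
  show "integrable std_gaussian (\<lambda>z. g (U ** C ** W *v z))"
    unfolding eq using std_gaussian_orthogonal_integral(1)[OF W measurable_convex[OF gUC]] C' by simp
  show "(\<integral>z. g (U ** C ** W *v z) \<partial>std_gaussian) \<le> (\<integral>z. g z \<partial>std_gaussian)"
    unfolding eq using std_gaussian_orthogonal_integral(2)[OF W measurable_convex[OF gUC]] C'
      std_gaussian_orthogonal_integral(2)[OF U measurable_convex[OF g(1)]] by simp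
qed

lemma orthogonal_uminus_id: "orthogonal_matrix (- mat 1 :: real^'n^'n)"
proof -
  have "transpose (- mat 1 :: real^'n^'n) = - mat 1"
    by (auto simp: transpose_def mat_def vec_eq_iff)
  moreover have "(- mat 1) ** (- mat 1) = (mat 1 :: real^'n^'n)"
  proof -
    have neg: "(- mat 1 :: real^'n^'n) *v x = - x" for x
      using matrix_vector_mult_diff_rdistrib[of 0 "mat 1 :: real^'n^'n" x] by simp
    show ?thesis unfolding matrix_eq by (simp add: neg flip: matrix_vector_mul_assoc)
  qed
  ultimately show ?thesis by (simp add: orthogonal_matrix)
qed

text \<open>Convexity bounds \<open>g (C z)\<close> above by an integrable average. Integrability
  also asks for a lower bound: it comes from \<open>g x \<ge> 2 * g 0 - g (- x)\<close>, where the
  reflected function is again convex and integrable.\<close>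

lemma convex_shrinking: "convex (shrinking :: (real^'n^'n) set)"
proof (rule convexI)
  fix C1 C2 :: "real^'n^'n" and u v :: real
  assume C: "C1 \<in> shrinking" "C2 \<in> shrinking" and uv: "0 \<le> u" "0 \<le> v" "u + v = 1"
  let ?C = "u *\<^sub>R C1 + v *\<^sub>R C2"
  show "?C \<in> shrinking"
    unfolding shrinking_def
  proof safe
    fix g :: "real^'n \<Rightarrow> real"
    assume g: "convex_on UNIV g" "integrable std_gaussian g"
    have neg: "(- mat 1 :: real^'n^'n) *v x = - x" for x
      using matrix_vector_mult_diff_rdistrib[of 0 "mat 1 :: real^'n^'n" x] by simp
    define g' where "g' x = g (- x)" for x
    have g': "convex_on UNIV g'" "integrable std_gaussian g'"
      using convex_on_mult_vec[OF g(1), of "- mat 1"]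
        std_gaussian_orthogonal_integral(1)[OF orthogonal_uminus_id measurable_convex[OF g(1)]] g(2)
      by (simp_all add: g'_def[abs_def] neg)
    have Cz: "?C *v z = u *\<^sub>R (C1 *v z) + v *\<^sub>R (C2 *v z)" for z
      by (simp add: matrix_vector_mult_add_rdistrib scaleR_matrix_vector_assoc)
    have i1: "integrable std_gaussian (\<lambda>z. g (Ci *v z))" "integrable std_gaussian (\<lambda>z. g' (Ci *v z))"
      "(\<integral>z. g (Ci *v z) \<partial>std_gaussian) \<le> (\<integral>z. g z \<partial>std_gaussian)"
      if "Ci \<in> {C1, C2}" for Ci
      using that C g g' unfolding shrinking_def by blast+
    have cvx: "f (?C *v z) \<le> u * f (C1 *v z) + v * f (C2 *v z)" if "convex_on UNIV f" for f z
    proof -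
      have u: "u = 1 - v" and "v \<le> 1" using uv by simp_all
      then have "f ((1 - v) *\<^sub>R (C1 *v z) + v *\<^sub>R (C2 *v z)) \<le> (1 - v) * f (C1 *v z) + v * f (C2 *v z)"
        using convex_onD[OF that, of v "C1 *v z" "C2 *v z"] uv by simp
      then show ?thesis unfolding Cz unfolding u .
    qed
    have low: "2 * g 0 - g' x \<le> g x" for x
    proof -
      have "g ((1 - 1/2) *\<^sub>R x + (1/2) *\<^sub>R (- x)) \<le> (1 - 1/2) * g x + 1/2 * g (- x)"
        by (rule g(1)[unfolded convex_on_UNIV_iff, rule_format]) simp_all
      then show ?thesis by (simp add: g'_def)
    qed
    define h where "h z = u * g (C1 *v z) + v * g (C2 *v z)" for z
    define h' where "h' z = u * g' (C1 *v z) + v * g' (C2 *v z)" for z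
    have ih: "integrable std_gaussian h" "integrable std_gaussian h'"
      unfolding h_def[abs_def] h'_def[abs_def] using i1 by simp_all
    interpret G: prob_space "std_gaussian :: (real^'n) measure" by (rule prob_space_std_gaussian)
    have bound: "\<bar>g (?C *v z)\<bar> \<le> \<bar>h z\<bar> + \<bar>h' z\<bar> + \<bar>2 * g 0\<bar>" for z
      using cvx[OF g(1), of z] cvx[OF g'(1), of z] low[of "?C *v z"] unfolding h_def h'_def by linarith
    show int: "integrable std_gaussian (\<lambda>z. g (?C *v z))"
    proof (rule Bochner_Integration.integrable_bound)
      show "integrable std_gaussian (\<lambda>z. \<bar>h z\<bar> + \<bar>h' z\<bar> + \<bar>2 * g 0\<bar>)" using ih by simp
      show "(\<lambda>z. g (?C *v z)) \<in> borel_measurable std_gaussian"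
        using measurable_convex[OF convex_on_mult_vec[OF g(1), of ?C]] by simp
    qed (use bound in auto)
    have "(\<integral>z. g (?C *v z) \<partial>std_gaussian) \<le> (\<integral>z. h z \<partial>std_gaussian)"
      using int ih(1) cvx[OF g(1), folded h_def] by (rule integral_mono)
    also have "\<dots> = u * (\<integral>z. g (C1 *v z) \<partial>std_gaussian) + v * (\<integral>z. g (C2 *v z) \<partial>std_gaussian)"
      unfolding h_def using i1 by simp
    also have "\<dots> \<le> u * (\<integral>z. g z \<partial>std_gaussian) + v * (\<integral>z. g z \<partial>std_gaussian)"
      using i1(3) uv by (intro add_mono mult_left_mono) auto
    also have "\<dots> = (\<integral>z. g z \<partial>std_gaussian)" using uv by (metis distrib_right mult_1)
    finally show "(\<integral>z. g (?C *v z) \<partial>std_gaussian) \<le> (\<integral>z. g z \<partial>std_gaussian)" .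
  qed
qed

text \<open>Sign matrices are orthogonal and their convex hull contains every diagonal with entries
  in [-1, 1]. The induction resolves one entry at a time, \<open>u\<close> being the weight that
  writes \<open>k a\<close> as a mean of 1 and -1.\<close>

lemma diagm_shrinking:
  fixes k :: "'n::finite \<Rightarrow> real"
  assumes "\<And>i. \<bar>k i\<bar> \<le> 1"
  shows "diagm k \<in> shrinking"
proof -
  have "diagm k \<in> shrinking" if "finite I" "\<And>i. \<bar>k i\<bar> \<le> 1" "\<And>i. i \<notin> I \<Longrightarrow> \<bar>k i\<bar> = 1"
    for I and k :: "'n \<Rightarrow> real"
    using that
  proof (induction I arbitrary: k rule: finite_induct)
    case empty
    have "k i * k i = 1" for i
      using empty(2)[of i] by (metis abs_mult_self_eq empty_iff mult_1)
    then have "orthogonal_matrix (diagm k)"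
      by (auto simp: orthogonal_matrix diagm_mult vec_eq_iff mat_def)
    then show ?case by (rule orthogonal_shrinking)
  next
    case (insert a I)
    define u where "u = (1 + k a) / 2"
    have u: "0 \<le> u" "0 \<le> 1 - u" "u + (1 - u) = 1"
      using insert.prems(1)[of a] by (auto simp: u_def abs_le_iff field_simps)
    have "diagm (k(a := 1)) \<in> shrinking" "diagm (k(a := -1)) \<in> shrinking"
      using insert by (auto intro!: insert.IH)
    then have "u *\<^sub>R diagm (k(a := 1)) + (1 - u) *\<^sub>R diagm (k(a := -1)) \<in> shrinking"
      using convexD[OF convex_shrinking] u by blast
    also have "u *\<^sub>R diagm (k(a := 1)) + (1 - u) *\<^sub>R diagm (k(a := -1)) = diagm k"
      by (auto simp: vec_eq_iff u_def field_simps)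
    finally show ?case .
  qed
  from this[of UNIV k] assms show ?thesis by simp
qed

lemma contraction_shrinking:
  assumes "\<And>x. norm (transpose C *v x) \<le> norm x"
  shows "C \<in> shrinking"
proof -
  obtain Q k W where Q: "orthogonal_matrix Q" "orthogonal_matrix W" "C = spec Q k ** W"
    and k: "\<And>i. 0 \<le> k i" "\<And>i. k i \<le> 1"
    using contraction_factor[OF assms] by blast
  have "C = Q ** diagm k ** (transpose Q ** W)"
    by (simp add: Q(3) spec_def matrix_mul_assoc)
  moreover have "diagm k \<in> shrinking" using k by (intro diagm_shrinking) (simp add: abs_le_iff minus_le_iff)
  ultimately show ?thesis
    using shrinking_orthogonal_mult Q by (metis orthogonal_matrix_mul orthogonal_matrix_transpose)
qed

lemma gaussian_convex_order:
  assumes A: "psd A" and B: "psd B" and AB: "A \<le>\<^sub>L B"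
  shows "gaussian 0 A \<le>\<^sub>c\<^sub>x gaussian 0 B"
  unfolding convex_order_def
proof (intro allI impI)
  fix f :: "real^'a \<Rightarrow> real"
  assume f: "convex_on UNIV f" and int: "integrable (gaussian 0 B) f"
  have [measurable]: "f \<in> borel_measurable borel" using f by (rule measurable_convex)
  obtain C where C: "psd_sqrt A = psd_sqrt B ** C" "\<And>x. norm (transpose C *v x) \<le> norm x"
    using loewner_le_factor[OF A B AB] by blast
  define g where "g z = f (psd_sqrt B *v z)" for z
  have g: "convex_on UNIV g" unfolding g_def[abs_def] using f by (rule convex_on_mult_vec)
  have S: "integrable (gaussian 0 S) f \<longleftrightarrow> integrable std_gaussian (\<lambda>z. f (psd_sqrt S *v z))"
    "integral\<^sup>L (gaussian 0 S) f = (\<integral>z. f (psd_sqrt S *v z) \<partial>std_gaussian)" for S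
    unfolding gaussian_0 by (simp_all add: integrable_distr_eq integral_distr)
  have "integrable std_gaussian g" using int by (simp add: S g_def[abs_def])
  then have "integrable std_gaussian (\<lambda>z. g (C *v z)) \<and>
     (\<integral>z. g (C *v z) \<partial>std_gaussian) \<le> (\<integral>z. g z \<partial>std_gaussian)"
    using contraction_shrinking[OF C(2)] g unfolding shrinking_def by blast
  then show "integrable (gaussian 0 A) f \<and> integral\<^sup>L (gaussian 0 A) f \<le> integral\<^sup>L (gaussian 0 B) f"
    by (simp add: S g_def C(1) matrix_vector_mul_assoc)
qed

subsection \<open>Couplings and the Wasserstein distance\<close>

lemma P2D:
  assumes "\<eta> \<in> P2"
  shows "sets \<eta> = sets borel" "prob_space \<eta>" "integrable \<eta> (\<lambda>x. (norm x)\<^sup>2)"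
  using assms by (simp_all add: P2_def)

lemma P2_dot:
  fixes \<eta> :: "(real^'n) measure"
  assumes \<eta>: "\<eta> \<in> P2"
  shows "integrable \<eta> (\<lambda>x. u \<bullet> x)" and "integrable \<eta> (\<lambda>x. (u \<bullet> x)\<^sup>2)"
proof -
  interpret prob_space \<eta> by (rule P2D[OF \<eta>])
  note [measurable_cong] = P2D(1)[OF \<eta>]
  have le: "(u \<bullet> x)\<^sup>2 \<le> (norm u)\<^sup>2 * (norm x)\<^sup>2" for x
    using Cauchy_Schwarz_ineq2[of u x] by (metis abs_le_square_iff abs_mult abs_norm_cancel power_mult_distrib)
  show sq: "integrable \<eta> (\<lambda>x. (u \<bullet> x)\<^sup>2)"
    by (rule Bochner_Integration.integrable_bound[of _ "\<lambda>x. (norm u)\<^sup>2 * (norm x)\<^sup>2"])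
       (use P2D(3)[OF \<eta>] le in auto)
  show "integrable \<eta> (\<lambda>x. u \<bullet> x)"
    by (rule square_integrable_imp_integrable) (use sq in auto)
qed

section \<open>Identification of laws at zero quadratic distance\<close>

lemma measure_eqI_closed:
  fixes \<mu> \<nu> :: "(real^'n) measure"
  assumes "prob_space \<mu>" and sets: "sets \<mu> = sets borel" "sets \<nu> = sets borel"
    and eq: "\<And>F. closed F \<Longrightarrow> emeasure \<mu> F = emeasure \<nu> F"
  shows "\<mu> = \<nu>"
proof (rule measure_eqI_generator_eq[where E="Collect closed" and \<Omega>=UNIV and A="\<lambda>_. UNIV"])
  interpret prob_space \<mu> by fact
  show "emeasure \<mu> UNIV \<noteq> \<infinity>" by simp
qed (use assms in \<open>auto simp: Int_stable_def borel_eq_closed\<close>)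

text \<open>Integrals of bounded Lipschitz functions agree under both laws, and such functions
  approximate indicators of closed sets. The pair \<open>X\<close>, \<open>Y\<close> may live on any
  space, so near-optimal couplings can be fed in after applying a linear map to one
  marginal.\<close>

lemma law_eq_of_close:
  fixes \<mu> \<nu> :: "(real^'n) measure"
  assumes close: "\<And>\<epsilon>. 0 < \<epsilon> \<Longrightarrow> \<exists>(\<pi> :: 'b measure) X Y. prob_space \<pi> \<and>
      X \<in> borel_measurable \<pi> \<and> Y \<in> borel_measurable \<pi> \<and> distr \<pi> borel X = \<mu> \<and> distr \<pi> borel Y = \<nu> \<and>
      integrable \<pi> (\<lambda>w. (norm (X w - Y w))\<^sup>2) \<and> (\<integral>w. (norm (X w - Y w))\<^sup>2 \<partial>\<pi>) \<le> \<epsilon>"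
  shows "\<mu> = \<nu>"
proof -
  obtain \<pi> :: "'b measure" and X Y where XY: "prob_space \<pi>" "X \<in> borel_measurable \<pi>"
    "Y \<in> borel_measurable \<pi>" "distr \<pi> borel X = \<mu>" "distr \<pi> borel Y = \<nu>"
    using close[OF zero_less_one] by blast
  interpret M: prob_space \<mu> using XY prob_space.prob_space_distr by blast
  interpret N: prob_space \<nu> using XY prob_space.prob_space_distr by blast
  have sets [simp, measurable_cong]: "sets \<mu> = sets borel" "sets \<nu> = sets borel"
    using XY by auto
  have lip: "(\<integral>x. f x \<partial>\<mu>) = (\<integral>x. f x \<partial>\<nu>)"
    if f [measurable]: "f \<in> borel_measurable borel" and b: "\<And>x. \<bar>f x\<bar> \<le> 1"
      and L: "\<And>x y. \<bar>f x - f y\<bar> \<le> K * norm (x - y)" and K: "0 < K" for f :: "real^'n \<Rightarrow> real" and K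
  proof -
    have "\<bar>(\<integral>x. f x \<partial>\<mu>) - (\<integral>x. f x \<partial>\<nu>)\<bar> \<le> e" if e: "0 < e" for e
    proof -
      have "0 < e\<^sup>2 / K\<^sup>2" using e K by simp
      then obtain \<pi> :: "'b measure" and X Y where P: "prob_space \<pi>" "X \<in> borel_measurable \<pi>"
        "Y \<in> borel_measurable \<pi>" "distr \<pi> borel X = \<mu>" "distr \<pi> borel Y = \<nu>"
        "integrable \<pi> (\<lambda>w. (norm (X w - Y w))\<^sup>2)" "(\<integral>w. (norm (X w - Y w))\<^sup>2 \<partial>\<pi>) \<le> e\<^sup>2 / K\<^sup>2"
        using close by blast
      interpret P: prob_space \<pi> by fact
      note [measurable] = P(2,3)
      have iX: "integrable \<pi> (\<lambda>w. f (X w))" "integrable \<pi> (\<lambda>w. f (Y w))"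
        by (rule P.integrable_const_bound[of _ 1], use b in auto)+
      have "(\<integral>x. f x \<partial>\<mu>) = (\<integral>w. f (X w) \<partial>\<pi>)" "(\<integral>x. f x \<partial>\<nu>) = (\<integral>w. f (Y w) \<partial>\<pi>)"
        unfolding P(4,5)[symmetric] by (simp_all add: integral_distr)
      then have eq: "(\<integral>x. f x \<partial>\<mu>) - (\<integral>x. f x \<partial>\<nu>) = (\<integral>w. f (X w) - f (Y w) \<partial>\<pi>)"
        using iX by simp
      \<comment> \<open>Young's inequality trades the Lipschitz bound for a squared distance,
        weighted so that a cost of \<open>e\<^sup>2 / K\<^sup>2\<close> contributes just the other
        half of \<open>e\<close>.\<close>
      have pt: "\<bar>f (X w) - f (Y w)\<bar> \<le> e / 2 + (K\<^sup>2 / (2 * e)) * (norm (X w - Y w))\<^sup>2" for w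
      proof -
        define r where "r = norm (X w - Y w)"
        have "0 \<le> (K * r - e)\<^sup>2" by simp
        then have "2 * e * (K * r) \<le> e\<^sup>2 + K\<^sup>2 * r\<^sup>2" by (simp add: power2_diff power_mult_distrib algebra_simps)
        then have "K * r \<le> (e\<^sup>2 + K\<^sup>2 * r\<^sup>2) / (2 * e)" using e by (simp add: le_divide_eq mult_ac)
        also have "\<dots> = e / 2 + (K\<^sup>2 / (2 * e)) * r\<^sup>2" using e by (simp add: field_simps power2_eq_square)
        finally show ?thesis using L[of "X w" "Y w"] by (simp add: r_def)
      qed
      have "\<bar>\<integral>w. f (X w) - f (Y w) \<partial>\<pi>\<bar> \<le> (\<integral>w. \<bar>f (X w) - f (Y w)\<bar> \<partial>\<pi>)" by (rule integral_abs_bound)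
      also have "\<dots> \<le> (\<integral>w. e / 2 + (K\<^sup>2 / (2 * e)) * (norm (X w - Y w))\<^sup>2 \<partial>\<pi>)"
        using iX P(6) pt by (intro integral_mono) auto
      also have "\<dots> = e / 2 + (K\<^sup>2 / (2 * e)) * (\<integral>w. (norm (X w - Y w))\<^sup>2 \<partial>\<pi>)"
        using P(6) by (simp add: P.prob_space)
      also have "\<dots> \<le> e / 2 + (K\<^sup>2 / (2 * e)) * (e\<^sup>2 / K\<^sup>2)"
        using P(7) e by (intro add_left_mono mult_left_mono) auto
      also have "\<dots> = e" using e K by (simp add: field_simps power2_eq_square)
      finally show ?thesis by (simp add: eq)
    qed
    then have "\<bar>(\<integral>x. f x \<partial>\<mu>) - (\<integral>x. f x \<partial>\<nu>)\<bar> \<le> 0" by (rule field_le_epsilon[of _ 0, simplified])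
    then show ?thesis by simp
  qed
  show ?thesis
  proof (rule measure_eqI_closed)
    fix F :: "(real^'n) set" assume F: "closed F"
    show "emeasure \<mu> F = emeasure \<nu> F"
    \<comment> \<open>\<open>infdist\<close> to the empty set is 0 by convention, so the
      approximants below would be constantly 1 there.\<close>
    proof (cases "F = {}")
      case False
      define f where "f k x = max 0 (1 - real (Suc k) * infdist x F)" for k x
      have fm [measurable]: "f k \<in> borel_measurable borel" for k
        unfolding f_def by (intro borel_measurable_continuous_onI continuous_intros)
      have fb: "\<bar>f k x\<bar> \<le> 1" for k x by (simp add: f_def infdist_nonneg)
      have eq: "(\<integral>x. f k x \<partial>\<mu>) = (\<integral>x. f k x \<partial>\<nu>)" for k
      proof (rule lip[OF fm fb])
        fix x y
        have "\<bar>infdist x F - infdist y F\<bar> \<le> norm (x - y)"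
          using infdist_triangle_abs[of x F y] by (simp add: dist_norm)
        then have "real (Suc k) * \<bar>infdist x F - infdist y F\<bar> \<le> real (Suc k) * norm (x - y)"
          by (intro mult_left_mono) auto
        moreover have "real (Suc k) * \<bar>infdist x F - infdist y F\<bar> =
            \<bar>real (Suc k) * infdist x F - real (Suc k) * infdist y F\<bar>"
          by (simp add: abs_mult flip: right_diff_distrib)
        ultimately show "\<bar>f k x - f k y\<bar> \<le> real (Suc k) * norm (x - y)"
          unfolding f_def by linarith
      qed simp
      have lim: "(\<lambda>k. f k x) \<longlonglongrightarrow> indicator F x" for x
      proof (cases "x \<in> F")
        case True
        then show ?thesis by (simp add: f_def)
      next
        case out: False
        then have pos: "0 < infdist x F"
          using F False infdist_nonneg[of x F] by (simp add: in_closed_iff_infdist_zero less_le)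
        obtain n where n: "1 < real n * infdist x F" using reals_Archimedean3[OF pos] by blast
        have "f k x = 0" if "n \<le> k" for k
        proof -
          have "real n * infdist x F \<le> real (Suc k) * infdist x F"
            using that pos by (intro mult_right_mono) auto
          then show ?thesis using n by (simp add: f_def)
        qed
        then have "eventually (\<lambda>k. f k x = 0) sequentially"
          unfolding eventually_sequentially by blast
        then show ?thesis using out by (simp add: tendsto_eventually)
      qed
      have conv: "(\<lambda>k. \<integral>x. f k x \<partial>\<rho>) \<longlonglongrightarrow> measure \<rho> F"
        if "prob_space \<rho>" and s [measurable_cong]: "sets \<rho> = sets borel" for \<rho> :: "(real^'n) measure"
      proof -
        interpret R: prob_space \<rho> by fact
        have FM [measurable]: "F \<in> sets borel" using F by simp
        have "(\<lambda>k. \<integral>x. f k x \<partial>\<rho>) \<longlonglongrightarrow> (\<integral>x. indicator F x \<partial>\<rho>)"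
          by (rule integral_dominated_convergence[where w="\<lambda>_. 1"]) (use lim fb in auto)
        then show ?thesis using FM s sets_eq_imp_space_eq[OF s] by simp
      qed
      have "measure \<mu> F = measure \<nu> F"
        using conv[OF M.prob_space_axioms] conv[OF N.prob_space_axioms] eq LIMSEQ_unique by simp
      then show ?thesis by (simp add: M.emeasure_eq_measure N.emeasure_eq_measure)
    qed simp
  qed (simp_all add: M.prob_space_axioms)
qed

section \<open>Marginals, transport costs and near-optimal couplings\<close>

lemma couplings_P2:
  fixes \<mu> \<nu> :: "(real^'n) measure"
  assumes \<pi>: "\<pi> \<in> couplings \<mu> \<nu>" and \<mu>: "\<mu> \<in> P2" and \<nu>: "\<nu> \<in> P2"
  shows "sets \<pi> = sets borel" "prob_space \<pi>"
    and "distr \<pi> borel fst = \<mu>" "distr \<pi> borel snd = \<nu>"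
    and "f \<in> borel_measurable borel \<Longrightarrow> integrable \<pi> (\<lambda>w. f (fst w)) \<longleftrightarrow> integrable \<mu> (f :: real^'n \<Rightarrow> real)"
    and "f \<in> borel_measurable borel \<Longrightarrow> integrable \<pi> (\<lambda>w. f (snd w)) \<longleftrightarrow> integrable \<nu> (f :: real^'n \<Rightarrow> real)"
    and "f \<in> borel_measurable borel \<Longrightarrow> (\<integral>w. f (fst w) \<partial>\<pi>) = integral\<^sup>L \<mu> f"
    and "f \<in> borel_measurable borel \<Longrightarrow> (\<integral>w. f (snd w) \<partial>\<pi>) = integral\<^sup>L \<nu> f"
proof -
  show s [measurable_cong]: "sets \<pi> = sets borel" and d: "distr \<pi> borel fst = \<mu>" "distr \<pi> borel snd = \<nu>"
    using \<pi> by (simp_all add: couplings_def)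
  have fm [measurable]: "fst \<in> measurable \<pi> borel" "snd \<in> measurable \<pi> borel"
    unfolding measurable_cong_sets[OF s refl]
    by (auto intro!: borel_measurable_continuous_onI continuous_intros)
  show "prob_space \<pi>"
  proof
    have "emeasure \<mu> (space \<mu>) = 1" using P2D(2)[OF \<mu>] by (rule prob_space.emeasure_space_1)
    then have "emeasure (distr \<pi> borel fst) UNIV = 1" unfolding d(1)[symmetric] by simp
    then show "emeasure \<pi> (space \<pi>) = 1" by (simp add: emeasure_distr)
  qed
  assume f: "f \<in> borel_measurable borel"
  show "integrable \<pi> (\<lambda>w. f (fst w)) \<longleftrightarrow> integrable \<mu> f" "(\<integral>w. f (fst w) \<partial>\<pi>) = integral\<^sup>L \<mu> f"
    unfolding d(1)[symmetric] using f by (simp_all add: integrable_distr_eq integral_distr)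
  show "integrable \<pi> (\<lambda>w. f (snd w)) \<longleftrightarrow> integrable \<nu> f" "(\<integral>w. f (snd w) \<partial>\<pi>) = integral\<^sup>L \<nu> f"
    unfolding d(2)[symmetric] using f by (simp_all add: integrable_distr_eq integral_distr)
qed

lemma coupling_measurable:
  assumes "sets \<pi> = sets (borel :: ('a::second_countable_topology \<times> 'b::second_countable_topology) measure)"
  shows "fst \<in> measurable \<pi> borel" "snd \<in> measurable \<pi> borel"
  unfolding measurable_cong_sets[OF assms refl]
  by (auto intro!: borel_measurable_continuous_onI continuous_intros)

definition transport_cost :: "((real^'n) \<times> (real^'n)) measure \<Rightarrow> real" where
  "transport_cost \<pi> = (\<integral>w. (norm (fst w - snd w))\<^sup>2 \<partial>\<pi>)"

lemma coupling_cost: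
  assumes \<pi>: "\<pi> \<in> couplings \<mu> \<nu>" and \<mu>: "\<mu> \<in> P2" and \<nu>: "\<nu> \<in> P2"
  shows "integrable \<pi> (\<lambda>w. (norm (fst w - snd w))\<^sup>2)"
    and "(\<integral>\<^sup>+ (x, y). ennreal ((norm (x - y))\<^sup>2) \<partial>\<pi>) = ennreal (transport_cost \<pi>)"
proof -
  note [measurable] = coupling_measurable[OF couplings_P2(1)[OF \<pi> \<mu> \<nu>]]
  have n: "(\<lambda>x::real^'n. (norm x)\<^sup>2) \<in> borel_measurable borel" by measurable
  have le: "(norm (x - y))\<^sup>2 \<le> 2 * (norm x)\<^sup>2 + 2 * (norm y)\<^sup>2" for x y :: "real^'n"
  proof -
    have "(norm (x - y))\<^sup>2 \<le> (norm x + norm y)\<^sup>2" by (intro power_mono norm_triangle_ineq4) simp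
    also have "\<dots> \<le> 2 * (norm x)\<^sup>2 + 2 * (norm y)\<^sup>2"
      using zero_le_power2[of "norm x - norm y"] by (simp add: power2_eq_square algebra_simps)
    finally show ?thesis .
  qed
  show int: "integrable \<pi> (\<lambda>w. (norm (fst w - snd w))\<^sup>2)"
  proof (rule Bochner_Integration.integrable_bound)
    show "integrable \<pi> (\<lambda>w. 2 * (norm (fst w))\<^sup>2 + 2 * (norm (snd w))\<^sup>2)"
      using couplings_P2(5,6)[OF \<pi> \<mu> \<nu> n] P2D(3)[OF \<mu>] P2D(3)[OF \<nu>] by simp
  qed (use le in auto)
  show "(\<integral>\<^sup>+ (x, y). ennreal ((norm (x - y))\<^sup>2) \<partial>\<pi>) = ennreal (transport_cost \<pi>)"
    unfolding transport_cost_def case_prod_beta using int by (intro nn_integral_eq_integral) auto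
qed

lemma pair_measure_coupling:
  fixes \<mu> \<nu> :: "(real^'n) measure"
  assumes \<mu>: "\<mu> \<in> P2" and \<nu>: "\<nu> \<in> P2"
  shows "\<mu> \<Otimes>\<^sub>M \<nu> \<in> couplings \<mu> \<nu>"
proof -
  interpret M: prob_space \<mu> using P2D[OF \<mu>] by simp
  interpret N: prob_space \<nu> using P2D[OF \<nu>] by simp
  interpret pair_prob_space \<mu> \<nu> ..
  note s [simp, measurable_cong] = P2D(1)[OF \<mu>] P2D(1)[OF \<nu>]
  have [simp]: "space \<mu> = UNIV" "space \<nu> = UNIV" using s[THEN sets_eq_imp_space_eq] by simp_all
  have "distr (\<mu> \<Otimes>\<^sub>M \<nu>) borel fst = \<mu>"
  proof (rule measure_eqI)
    fix A assume "A \<in> sets (distr (\<mu> \<Otimes>\<^sub>M \<nu>) borel fst)"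
    then have A [measurable]: "A \<in> sets borel" by simp
    have "fst -` A \<inter> space (\<mu> \<Otimes>\<^sub>M \<nu>) = A \<times> space \<nu>" by (auto simp: space_pair_measure)
    then show "emeasure (distr (\<mu> \<Otimes>\<^sub>M \<nu>) borel fst) A = emeasure \<mu> A"
      using N.emeasure_pair_measure_Times[of A \<mu> "space \<nu>"] N.emeasure_space_1
      by (simp add: emeasure_distr)
  qed simp
  moreover have "distr (\<mu> \<Otimes>\<^sub>M \<nu>) borel snd = \<nu>"
  proof (rule measure_eqI)
    fix A assume "A \<in> sets (distr (\<mu> \<Otimes>\<^sub>M \<nu>) borel snd)"
    then have A [measurable]: "A \<in> sets borel" by simp
    have "snd -` A \<inter> space (\<mu> \<Otimes>\<^sub>M \<nu>) = space \<mu> \<times> A" by (auto simp: space_pair_measure)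
    then show "emeasure (distr (\<mu> \<Otimes>\<^sub>M \<nu>) borel snd) A = emeasure \<nu> A"
      using N.emeasure_pair_measure_Times[of "space \<mu>" \<mu> A] M.emeasure_space_1
      by (simp add: emeasure_distr)
  qed simp
  moreover have "sets (\<mu> \<Otimes>\<^sub>M \<nu>) = sets borel"
    unfolding borel_prod[symmetric] by (rule sets_pair_measure_cong[OF s])
  ultimately show ?thesis by (simp add: couplings_def)
qed

lemma W2_nonneg: "0 \<le> W2 \<mu> \<nu>"
  by (simp add: W2_def)

lemma
  fixes \<mu> \<nu> :: "(real^'n) measure"
  assumes \<mu>: "\<mu> \<in> P2" and \<nu>: "\<nu> \<in> P2"
  shows W2_le_cost: "\<pi> \<in> couplings \<mu> \<nu> \<Longrightarrow> (W2 \<mu> \<nu>)\<^sup>2 \<le> transport_cost \<pi>"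
    and W2_ge: "(\<And>\<pi>. \<pi> \<in> couplings \<mu> \<nu> \<Longrightarrow> c \<le> transport_cost \<pi>) \<Longrightarrow> c \<le> (W2 \<mu> \<nu>)\<^sup>2"
proof -
  define I where "I = (INF \<pi>\<in>couplings \<mu> \<nu>. ennreal (transport_cost \<pi>))"
  have nn: "0 \<le> transport_cost \<pi>" for \<pi> :: "((real^'n) \<times> (real^'n)) measure"
    by (simp add: transport_cost_def)
  have W: "(W2 \<mu> \<nu>)\<^sup>2 = enn2real I"
    unfolding W2_def I_def using coupling_cost(2)[OF _ \<mu> \<nu>] by (simp cong: INF_cong)
  show le: "(W2 \<mu> \<nu>)\<^sup>2 \<le> transport_cost \<pi>" if "\<pi> \<in> couplings \<mu> \<nu>" for \<pi>
  proof -
    have "I \<le> ennreal (transport_cost \<pi>)" unfolding I_def using that by (rule INF_lower)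
    then show ?thesis unfolding W using nn[of \<pi>] enn2real_leI by blast
  qed
  show "c \<le> (W2 \<mu> \<nu>)\<^sup>2" if c: "\<And>\<pi>. \<pi> \<in> couplings \<mu> \<nu> \<Longrightarrow> c \<le> transport_cost \<pi>"
  proof -
    have "ennreal c \<le> I" unfolding I_def using c by (intro INF_greatest ennreal_leI)
    \<comment> \<open>The product coupling has finite cost, so the infimum is finite and
      \<open>enn2real\<close> preserves the bound.\<close>
    moreover have "I \<le> ennreal (transport_cost (\<mu> \<Otimes>\<^sub>M \<nu>))"
      unfolding I_def by (rule INF_lower) (rule pair_measure_coupling[OF \<mu> \<nu>])
    then have "I < \<top>" by (metis ennreal_less_top order_le_less_trans)
    ultimately show ?thesis unfolding W
      by (cases I) (auto simp: enn2real_nonneg ennreal_le_iff2 intro: order_trans)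
  qed
qed

lemma W2_approx_coupling:
  fixes \<mu> \<nu> :: "(real^'n) measure"
  assumes \<mu>: "\<mu> \<in> P2" and \<nu>: "\<nu> \<in> P2" and e: "(W2 \<mu> \<nu>)\<^sup>2 < c"
  obtains \<pi> where "\<pi> \<in> couplings \<mu> \<nu>" "transport_cost \<pi> < c"
  using W2_ge[OF \<mu> \<nu>, of c] e that by fastforce

subsection \<open>The two projections\<close>

lemma square_integrable_mult:
  fixes X Y :: "'a \<Rightarrow> real"
  assumes [measurable]: "X \<in> borel_measurable M" "Y \<in> borel_measurable M"
    and sq: "integrable M (\<lambda>w. (X w)\<^sup>2)" "integrable M (\<lambda>w. (Y w)\<^sup>2)"
  shows "integrable M (\<lambda>w. X w * Y w)"
proof (rule Bochner_Integration.integrable_bound)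
  show "integrable M (\<lambda>w. (X w)\<^sup>2 + (Y w)\<^sup>2)" using sq by simp
  have "\<bar>x * y\<bar> \<le> x\<^sup>2 + y\<^sup>2" for x y :: real
    using zero_le_power2[of "\<bar>x\<bar> - \<bar>y\<bar>"] zero_le_power2[of x] zero_le_power2[of y]
    unfolding power2_diff power2_abs abs_mult by linarith
  then show "AE w in M. norm (X w * Y w) \<le> norm ((X w)\<^sup>2 + (Y w)\<^sup>2)" by auto
qed simp

lemma integral_diff_sq:
  fixes X Y :: "'a \<Rightarrow> real"
  assumes "X \<in> borel_measurable M" "Y \<in> borel_measurable M"
    and sq: "integrable M (\<lambda>w. (X w)\<^sup>2)" "integrable M (\<lambda>w. (Y w)\<^sup>2)"
  shows "integrable M (\<lambda>w. (Y w - c * X w)\<^sup>2)"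
    and "(\<integral>w. (Y w - c * X w)\<^sup>2 \<partial>M) =
      (\<integral>w. (Y w)\<^sup>2 \<partial>M) - 2 * c * (\<integral>w. X w * Y w \<partial>M) + c\<^sup>2 * (\<integral>w. (X w)\<^sup>2 \<partial>M)"
proof -
  have eq: "(Y w - c * X w)\<^sup>2 = (Y w)\<^sup>2 - 2 * c * (X w * Y w) + c\<^sup>2 * (X w)\<^sup>2" for w
    by (simp add: power2_diff power_mult_distrib)
  show "integrable M (\<lambda>w. (Y w - c * X w)\<^sup>2)"
    "(\<integral>w. (Y w - c * X w)\<^sup>2 \<partial>M) =
      (\<integral>w. (Y w)\<^sup>2 \<partial>M) - 2 * c * (\<integral>w. X w * Y w \<partial>M) + c\<^sup>2 * (\<integral>w. (X w)\<^sup>2 \<partial>M)"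
    unfolding eq using sq square_integrable_mult[OF assms] by simp_all
qed

lemma Cauchy_Schwarz_integral:
  fixes X Y :: "'a \<Rightarrow> real"
  assumes "X \<in> borel_measurable M" "Y \<in> borel_measurable M"
    and "integrable M (\<lambda>w. (X w)\<^sup>2)" "integrable M (\<lambda>w. (Y w)\<^sup>2)"
  shows "(\<integral>w. X w * Y w \<partial>M)\<^sup>2 \<le> (\<integral>w. (X w)\<^sup>2 \<partial>M) * (\<integral>w. (Y w)\<^sup>2 \<partial>M)"
proof -
  define a b c where "a = (\<integral>w. (X w)\<^sup>2 \<partial>M)" and "b = (\<integral>w. (Y w)\<^sup>2 \<partial>M)" and "c = (\<integral>w. X w * Y w \<partial>M)"
  have nn: "0 \<le> a" "0 \<le> b" by (simp_all add: a_def b_def)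
  have q: "0 \<le> b - 2 * s * c + s\<^sup>2 * a" for s
  proof -
    have "0 \<le> (\<integral>w. (Y w - s * X w)\<^sup>2 \<partial>M)" by simp
    then show ?thesis unfolding integral_diff_sq(2)[OF assms] a_def b_def c_def .
  qed
  have "c\<^sup>2 \<le> a * b"
  proof (cases "a = 0")
    case True
    have "c = 0"
    proof (rule ccontr)
      assume "c \<noteq> 0"
      \<comment> \<open>For \<open>a = 0\<close> the quadratic is affine in \<open>s\<close>, and
        this \<open>s\<close> gives it the value -1.\<close>
      then show False using q[of "(b + 1) / (2 * c)"] nn True by simp
    qed
    then show ?thesis using nn by simp
  next
    case False
    then have "0 \<le> a * (b - 2 * (c / a) * c + (c / a)\<^sup>2 * a)" using q[of "c / a"] nn by simp
    also have "\<dots> = a * b - c\<^sup>2" using False by (simp add: field_simps power2_eq_square)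
    finally show ?thesis by simp
  qed
  then show ?thesis by (simp add: a_def b_def c_def)
qed

text \<open>The quadratic growth in the next two lemmas is what identifies every minimizer, without
  appealing to the existence of optimal couplings.\<close>

lemma shrink_sq_bound:
  fixes X Y :: "'a \<Rightarrow> real"
  assumes XY: "X \<in> borel_measurable M" "Y \<in> borel_measurable M"
    "integrable M (\<lambda>w. (X w)\<^sup>2)" "integrable M (\<lambda>w. (Y w)\<^sup>2)"
    and t: "0 \<le> t" "t \<le> 1" and a: "a = (\<integral>w. (X w)\<^sup>2 \<partial>M)" and b: "(\<integral>w. (Y w)\<^sup>2 \<partial>M) \<le> b"
    and tab: "t = 1 \<or> b = t\<^sup>2 * a"
  shows "(1 - t)\<^sup>2 * a + (\<integral>w. (Y w - t * X w)\<^sup>2 \<partial>M) \<le> (\<integral>w. (X w - Y w)\<^sup>2 \<partial>M)"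
proof -
  define c where "c = (\<integral>w. X w * Y w \<partial>M)"
  define B where "B = (\<integral>w. (Y w)\<^sup>2 \<partial>M)"
  have a0: "0 \<le> a" by (simp add: a)
  have "(\<integral>w. (X w - Y w)\<^sup>2 \<partial>M) = (\<integral>w. (Y w - 1 * X w)\<^sup>2 \<partial>M)"
    by (simp add: power2_commute)
  also have "\<dots> = B - 2 * c + a"
    using integral_diff_sq(2)[OF XY, of 1] by (simp add: B_def c_def a)
  finally have 1: "(\<integral>w. (X w - Y w)\<^sup>2 \<partial>M) = B - 2 * c + a" .
  have 2: "(\<integral>w. (Y w - t * X w)\<^sup>2 \<partial>M) = B - 2 * t * c + t\<^sup>2 * a"
    using integral_diff_sq(2)[OF XY, of t] by (simp add: B_def c_def a)
  \<comment> \<open>This is exactly the gap in the claim. If \<open>t < 1\<close>, then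
    \<open>b = t\<^sup>2 * a\<close>, and Cauchy-Schwarz gives \<open>c \<le> t * a\<close>.\<close>
  have "0 \<le> 2 * ((1 - t) * (t * a - c))"
  proof (cases "t = 1")
    case False
    have "c\<^sup>2 \<le> a * B" using Cauchy_Schwarz_integral[OF XY] by (simp add: B_def c_def a)
    also have "\<dots> \<le> a * (t\<^sup>2 * a)" using False tab b a0 by (intro mult_left_mono) (auto simp: B_def)
    also have "\<dots> = (t * a)\<^sup>2" by (simp add: power2_eq_square)
    finally have "c \<le> t * a" by (rule power2_le_imp_le) (use a0 t in simp)
    then show ?thesis using t by simp
  qed simp
  moreover have "2 * ((1 - t) * (t * a - c)) =
      B - 2 * c + a - ((1 - t)\<^sup>2 * a + (B - 2 * t * c + t\<^sup>2 * a))"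
    by algebra
  ultimately show ?thesis unfolding 1 2 by linarith
qed

lemma stretch_sq_bound:
  fixes X Y :: "'a \<Rightarrow> real"
  assumes XY: "X \<in> borel_measurable M" "Y \<in> borel_measurable M"
    "integrable M (\<lambda>w. (X w)\<^sup>2)" "integrable M (\<lambda>w. (Y w)\<^sup>2)"
    and e: "0 \<le> e" "e \<le> 1" and a: "0 \<le> a" and B: "B = (\<integral>w. (Y w)\<^sup>2 \<partial>M)" and aB: "a \<le> B"
    and ea: "e = 1 \<or> (\<integral>w. (X w)\<^sup>2 \<partial>M) = e\<^sup>2 * a"
  shows "(1 - e)\<^sup>2 * a + (\<integral>w. (X w - e * Y w)\<^sup>2 \<partial>M) + (1 - e) * (B - a) \<le> (\<integral>w. (X w - Y w)\<^sup>2 \<partial>M)"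
proof -
  define c where "c = (\<integral>w. X w * Y w \<partial>M)"
  define A where "A = (\<integral>w. (X w)\<^sup>2 \<partial>M)"
  note YX = XY(2,1,4,3)
  have 1: "(\<integral>w. (X w - Y w)\<^sup>2 \<partial>M) = A - 2 * c + B"
    using integral_diff_sq(2)[OF YX, of 1] by (simp add: B c_def A_def mult.commute)
  have 2: "(\<integral>w. (X w - e * Y w)\<^sup>2 \<partial>M) = A - 2 * e * c + e\<^sup>2 * B"
    using integral_diff_sq(2)[OF YX, of e] by (simp add: B c_def A_def mult.commute)
  \<comment> \<open>Again the exact gap. If \<open>e < 1\<close>, Cauchy-Schwarz gives
    \<open>c\<^sup>2 \<le> e\<^sup>2 * (a * B)\<close>, and the mean inequality for \<open>a\<close>
    and \<open>B\<close> leaves the slack \<open>(1 - e) * (B - a)\<close>.\<close>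
  have "0 \<le> (1 - e) * (e * (a + B) - 2 * c)"
  proof (cases "e = 1")
    case False
    have "c\<^sup>2 \<le> A * B" using Cauchy_Schwarz_integral[OF XY] by (simp add: B c_def A_def)
    also have "\<dots> = e\<^sup>2 * (a * B)" using False ea by (simp add: A_def)
    also have "\<dots> \<le> e\<^sup>2 * ((a + B) / 2)\<^sup>2"
      using zero_le_power2[of "a - B"]
      by (intro mult_left_mono) (simp_all add: power2_eq_square field_simps)
    also have "\<dots> = (e * ((a + B) / 2))\<^sup>2" by (simp only: power_mult_distrib)
    finally have "c \<le> e * ((a + B) / 2)" by (rule power2_le_imp_le) (use a aB e in simp)
    then show ?thesis using e by simp
  qed simp
  moreover have "(1 - e) * (e * (a + B) - 2 * c) =
      A - 2 * c + B - ((1 - e)\<^sup>2 * a + (A - 2 * e * c + e\<^sup>2 * B) + (1 - e) * (B - a))"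
    by algebra
  ultimately show ?thesis unfolding 1 2 by linarith
qed

section \<open>Couplings resolved along an orthonormal frame\<close>

lemma column_dot_spec:
  assumes "orthogonal_matrix Q"
  shows "column i Q \<bullet> (spec Q t *v x) = t i * (column i Q \<bullet> x)"
  using dot_matrix_transpose[of "column i Q" "spec Q t" x] column_spec[OF assms, of t i] by simp

lemma gaussian_second_moment:
  "psd S \<Longrightarrow> (\<integral>x. (u \<bullet> x)\<^sup>2 \<partial>gaussian 0 S) = u \<bullet> (S *v u)"
  by (simp add: power2_eq_square gaussian_dot)

text \<open>These squares are the test functions through which the convex order enters the cost
  bounds: they compare the second moments in every direction.\<close>

lemma convex_dot_sq: "convex_on UNIV (\<lambda>x :: real^'n. (u \<bullet> x)\<^sup>2)"
  unfolding convex_on_UNIV_iff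
proof (intro allI impI)
  fix t :: real and x y assume t: "0 \<le> t" "t \<le> 1"
  define p q where "p = u \<bullet> x" and "q = u \<bullet> y"
  have "0 \<le> t * (1 - t) * (p - q)\<^sup>2" using t by simp
  also have "\<dots> = (1 - t) * p\<^sup>2 + t * q\<^sup>2 - ((1 - t) * p + t * q)\<^sup>2"
    by (simp add: power2_eq_square algebra_simps)
  finally show "(u \<bullet> ((1 - t) *\<^sub>R x + t *\<^sub>R y))\<^sup>2 \<le> (1 - t) * (u \<bullet> x)\<^sup>2 + t * (u \<bullet> y)\<^sup>2"
    by (simp add: inner_add_right p_def q_def)
qed

lemma convex_dot: "convex_on UNIV (\<lambda>x :: real^'n. u \<bullet> x)"
  by (simp add: convex_on_UNIV_iff inner_add_right)

lemma convex_order_second_moment: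
  fixes \<mu> \<nu> :: "(real^'n) measure"
  assumes "\<mu> \<le>\<^sub>c\<^sub>x \<nu>" "\<nu> \<in> P2"
  shows "(\<integral>x. (u \<bullet> x)\<^sup>2 \<partial>\<mu>) \<le> (\<integral>x. (u \<bullet> x)\<^sup>2 \<partial>\<nu>)"
  using assms convex_dot_sq P2_dot(2)[OF assms(2)] unfolding convex_order_def by blast

lemma convex_order_mean_le:
  fixes \<mu> \<nu> :: "(real^'n) measure"
  assumes "\<mu> \<le>\<^sub>c\<^sub>x \<nu>" "\<nu> \<in> P2"
  shows "(\<integral>x. u \<bullet> x \<partial>\<mu>) \<le> (\<integral>x. u \<bullet> x \<partial>\<nu>)"
  using assms convex_dot P2_dot(1)[OF assms(2)] unfolding convex_order_def by blast

text \<open>Parseval in the frame \<open>Q\<close>, which diagonalizes the maps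
  \<open>spec Q t\<close>, splits each quadratic cost into scalar ones to which the two scalar
  bounds apply.\<close>

lemma coupling_norm_sq:
  assumes \<pi>: "\<pi> \<in> couplings \<mu> \<nu>" and \<mu>: "\<mu> \<in> P2" and \<nu>: "\<nu> \<in> P2" and Q: "orthogonal_matrix Q"
  shows "transport_cost \<pi> = (\<Sum>i\<in>UNIV. \<integral>w. (column i Q \<bullet> fst w - column i Q \<bullet> snd w)\<^sup>2 \<partial>\<pi>)"
    and "integrable \<pi> (\<lambda>w. (norm (snd w - spec Q t *v fst w))\<^sup>2)"
    and "(\<integral>w. (norm (snd w - spec Q t *v fst w))\<^sup>2 \<partial>\<pi>) =
      (\<Sum>i\<in>UNIV. \<integral>w. (column i Q \<bullet> snd w - t i * (column i Q \<bullet> fst w))\<^sup>2 \<partial>\<pi>)"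
    and "integrable \<pi> (\<lambda>w. (norm (fst w - spec Q t *v snd w))\<^sup>2)"
    and "(\<integral>w. (norm (fst w - spec Q t *v snd w))\<^sup>2 \<partial>\<pi>) =
      (\<Sum>i\<in>UNIV. \<integral>w. (column i Q \<bullet> fst w - t i * (column i Q \<bullet> snd w))\<^sup>2 \<partial>\<pi>)"
    and "integrable \<pi> (\<lambda>w. (u \<bullet> fst w)\<^sup>2)" "integrable \<pi> (\<lambda>w. (u \<bullet> snd w)\<^sup>2)"
    and "(\<lambda>w. u \<bullet> fst w) \<in> borel_measurable \<pi>" "(\<lambda>w. u \<bullet> snd w) \<in> borel_measurable \<pi>"
    and "(\<integral>w. (u \<bullet> fst w)\<^sup>2 \<partial>\<pi>) = (\<integral>x. (u \<bullet> x)\<^sup>2 \<partial>\<mu>)"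
    and "(\<integral>w. (u \<bullet> snd w)\<^sup>2 \<partial>\<pi>) = (\<integral>x. (u \<bullet> x)\<^sup>2 \<partial>\<nu>)"
proof -
  note c = couplings_P2[OF \<pi> \<mu> \<nu>]
  note [measurable] = coupling_measurable[OF c(1)]
  have m: "(\<lambda>x. (u \<bullet> x)\<^sup>2) \<in> borel_measurable borel" for u :: "real^'a" by measurable
  show sq1: "integrable \<pi> (\<lambda>w. (u \<bullet> fst w)\<^sup>2)" for u
    using c(5)[OF m] P2_dot(2)[OF \<mu>] by blast
  show sq2: "integrable \<pi> (\<lambda>w. (u \<bullet> snd w)\<^sup>2)" for u
    using c(6)[OF m] P2_dot(2)[OF \<nu>] by blast
  show me: "(\<lambda>w. u \<bullet> fst w) \<in> borel_measurable \<pi>" "(\<lambda>w. u \<bullet> snd w) \<in> borel_measurable \<pi>" for u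
    by measurable
  show "(\<integral>w. (u \<bullet> fst w)\<^sup>2 \<partial>\<pi>) = (\<integral>x. (u \<bullet> x)\<^sup>2 \<partial>\<mu>)" using c(7)[OF m] by simp
  show "(\<integral>w. (u \<bullet> snd w)\<^sup>2 \<partial>\<pi>) = (\<integral>x. (u \<bullet> x)\<^sup>2 \<partial>\<nu>)" using c(8)[OF m] by simp
  have d1: "integrable \<pi> (\<lambda>w. (u \<bullet> snd w - k * (u \<bullet> fst w))\<^sup>2)" for u k
    using integral_diff_sq(1)[OF me(1) me(2) sq1 sq2] by blast
  have d2: "integrable \<pi> (\<lambda>w. (u \<bullet> fst w - k * (u \<bullet> snd w))\<^sup>2)" for u k
    using integral_diff_sq(1)[OF me(2) me(1) sq2 sq1] by blast
  have n1: "(norm (snd w - spec Q t *v fst w))\<^sup>2 =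
      (\<Sum>i\<in>UNIV. (column i Q \<bullet> snd w - t i * (column i Q \<bullet> fst w))\<^sup>2)" for w t
    by (simp add: norm_orthogonal_sum[OF Q] inner_diff_right column_dot_spec[OF Q])
  have n2: "(norm (fst w - spec Q t *v snd w))\<^sup>2 =
      (\<Sum>i\<in>UNIV. (column i Q \<bullet> fst w - t i * (column i Q \<bullet> snd w))\<^sup>2)" for w t
    by (simp add: norm_orthogonal_sum[OF Q] inner_diff_right column_dot_spec[OF Q])
  show "integrable \<pi> (\<lambda>w. (norm (snd w - spec Q t *v fst w))\<^sup>2)"
    "(\<integral>w. (norm (snd w - spec Q t *v fst w))\<^sup>2 \<partial>\<pi>) =
      (\<Sum>i\<in>UNIV. \<integral>w. (column i Q \<bullet> snd w - t i * (column i Q \<bullet> fst w))\<^sup>2 \<partial>\<pi>)"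
    unfolding n1 using d1 by (simp_all add: Bochner_Integration.integral_sum)
  show "integrable \<pi> (\<lambda>w. (norm (fst w - spec Q t *v snd w))\<^sup>2)"
    "(\<integral>w. (norm (fst w - spec Q t *v snd w))\<^sup>2 \<partial>\<pi>) =
      (\<Sum>i\<in>UNIV. \<integral>w. (column i Q \<bullet> fst w - t i * (column i Q \<bullet> snd w))\<^sup>2 \<partial>\<pi>)"
    unfolding n2 using d2 by (simp_all add: Bochner_Integration.integral_sum)
  show "transport_cost \<pi> = (\<Sum>i\<in>UNIV. \<integral>w. (column i Q \<bullet> fst w - column i Q \<bullet> snd w)\<^sup>2 \<partial>\<pi>)"
    unfolding transport_cost_def norm_orthogonal_sum[OF Q] inner_diff_right
    using d2[of _ 1] by (simp add: Bochner_Integration.integral_sum)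
qed

lemma transport_cost_distr:
  fixes f g :: "real^'n \<Rightarrow> real^'n"
  assumes s: "sets \<mu> = sets borel" and [measurable]: "f \<in> borel_measurable borel" "g \<in> borel_measurable borel"
  shows "distr \<mu> borel (\<lambda>x. (f x, g x)) \<in> couplings (distr \<mu> borel f) (distr \<mu> borel g)"
    and "transport_cost (distr \<mu> borel (\<lambda>x. (f x, g x))) = (\<integral>x. (norm (f x - g x))\<^sup>2 \<partial>\<mu>)"
proof -
  note [measurable_cong] = s
  have p [measurable]: "(\<lambda>x. (f x, g x)) \<in> measurable \<mu> borel"
    unfolding borel_prod[symmetric] by measurable
  have fs [measurable]: "fst \<in> measurable (borel :: ((real^'n) \<times> (real^'n)) measure) borel"
    "snd \<in> measurable (borel :: ((real^'n) \<times> (real^'n)) measure) borel"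
    by (auto intro!: borel_measurable_continuous_onI continuous_intros)
  show "distr \<mu> borel (\<lambda>x. (f x, g x)) \<in> couplings (distr \<mu> borel f) (distr \<mu> borel g)"
    by (simp add: couplings_def distr_distr comp_def)
  show "transport_cost (distr \<mu> borel (\<lambda>x. (f x, g x))) = (\<integral>x. (norm (f x - g x))\<^sup>2 \<partial>\<mu>)"
    unfolding transport_cost_def by (subst integral_distr) simp_all
qed

lemma gaussian_spec_cost:
  assumes S: "psd S" and Q: "orthogonal_matrix Q"
  shows "(\<integral>x. (norm (x - spec Q t *v x))\<^sup>2 \<partial>gaussian 0 S) = (\<Sum>i\<in>UNIV. (1 - t i)\<^sup>2 * conj_by Q S $ i $ i)"
proof -
  have eq: "(norm (x - spec Q t *v x))\<^sup>2 = (\<Sum>i\<in>UNIV. (1 - t i)\<^sup>2 * (column i Q \<bullet> x)\<^sup>2)" for x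
  proof -
    have "column i Q \<bullet> (x - spec Q t *v x) = (1 - t i) * (column i Q \<bullet> x)" for i
      by (simp add: inner_diff_right column_dot_spec[OF Q] algebra_simps)
    then show ?thesis by (simp add: norm_orthogonal_sum[OF Q] power_mult_distrib)
  qed
  show ?thesis
    unfolding eq using P2_dot(2)[OF gaussian_in_P2[OF S]]
    by (simp add: Bochner_Integration.integral_sum gaussian_second_moment[OF S] conj_by_nth)
qed

text \<open>Links the stated cost to the shrinking factors. The alternatives "factor 1 or
  \<open>b i\<close> equal to squared factor times \<open>a i\<close>" are complementary slackness,
  the form required by the scalar bounds. They hold for \<open>efac\<close> in null directions of
  \<open>N\<close> because both sides are then 0.\<close>

lemma max_sqrt_diff_eq:
  fixes Q M N :: "real^'n^'n"
  assumes M: "psd M" and N: "psd N"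
  defines "a \<equiv> \<lambda>i. conj_by Q M $ i $ i" and "b \<equiv> \<lambda>i. conj_by Q N $ i $ i"
  shows "(max (sqrt (a i) - sqrt (b i)) 0)\<^sup>2 = (1 - dfac Q M N i)\<^sup>2 * a i"
    and "(max (sqrt (a i) - sqrt (b i)) 0)\<^sup>2 = (1 - efac Q M N i)\<^sup>2 * a i"
    and "dfac Q M N i = 1 \<or> b i = (dfac Q M N i)\<^sup>2 * a i"
    and "efac Q M N i = 1 \<or> b i = (efac Q M N i)\<^sup>2 * a i"
    and "a i \<le> b i \<Longrightarrow> dfac Q M N i = 1"
proof -
  have nn: "0 \<le> a i" "0 \<le> b i" unfolding a_def b_def using M N by (simp_all add: conj_by_diag_nonneg)
  have d: "dfac Q M N i = (if a i = 0 then 1 else min 1 (sqrt (b i / a i)))"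
    by (simp add: dfac_def a_def b_def)
  have e: "efac Q M N i = (if 0 < b i then dfac Q M N i else 0)"
    by (simp add: efac_def b_def)
  show d1: "dfac Q M N i = 1" if "a i \<le> b i" using that nn by (auto simp: d)
  have d2: "dfac Q M N i = sqrt (b i) / sqrt (a i)" "0 < sqrt (a i)" if "\<not> a i \<le> b i"
    using that nn by (auto simp: d real_sqrt_divide min_def divide_le_eq)
  show A: "(max (sqrt (a i) - sqrt (b i)) 0)\<^sup>2 = (1 - dfac Q M N i)\<^sup>2 * a i"
  proof (cases "a i \<le> b i")
    case False
    have "sqrt (a i) - sqrt (b i) = (1 - dfac Q M N i) * sqrt (a i)"
      using d2[OF False] by (simp add: field_simps)
    moreover have "max (sqrt (a i) - sqrt (b i)) 0 = sqrt (a i) - sqrt (b i)" using False by simp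
    ultimately show ?thesis using nn by (simp add: power_mult_distrib)
  qed (simp add: d1)
  show B: "dfac Q M N i = 1 \<or> b i = (dfac Q M N i)\<^sup>2 * a i"
  proof (cases "a i \<le> b i")
    case False
    then show ?thesis using d2[OF False] nn by (simp add: power_divide)
  qed (simp add: d1)
  show "(max (sqrt (a i) - sqrt (b i)) 0)\<^sup>2 = (1 - efac Q M N i)\<^sup>2 * a i"
  proof (cases "0 < b i")
    case False
    then show ?thesis using nn by (simp add: e)
  qed (simp add: e A)
  show "efac Q M N i = 1 \<or> b i = (efac Q M N i)\<^sup>2 * a i"
  proof (cases "0 < b i")
    case False
    then show ?thesis using nn by (simp add: e)
  qed (use B in \<open>simp add: e\<close>)
qed

section \<open>Optimality and uniqueness for a fixed admissible frame\<close>

context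
  fixes Q M N :: "real^'n^'n"
  assumes M: "psd M" and N: "psd N" and adm: "admissible Q M N"
begin

definition opt_cost :: real where
  "opt_cost = (\<Sum>i\<in>UNIV. (max (sqrt (conj_by Q M $ i $ i) - sqrt (conj_by Q N $ i $ i)) 0)\<^sup>2)"

text \<open>\<open>TI\<close> transports the Gaussian of \<open>M\<close> to its projection.
  \<open>TJ\<close> works backwards, carrying the Gaussian of the other projection \<open>SJ\<close>
  to that of \<open>N\<close>.\<close>

abbreviation (input) TI :: "real^'n^'n" where "TI \<equiv> spec Q (dfac Q M N)"

abbreviation (input) TJ :: "real^'n^'n" where "TJ \<equiv> spec Q (efac Q M N)"

abbreviation (input) SI :: "real^'n^'n" where "SI \<equiv> TI ** M ** TI"

abbreviation (input) SJ :: "real^'n^'n" where "SJ \<equiv> Q ** SigmaJ Q M N ** transpose Q"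

lemma opt_cost_dfac: "opt_cost = (\<Sum>i\<in>UNIV. (1 - dfac Q M N i)\<^sup>2 * conj_by Q M $ i $ i)"
  unfolding opt_cost_def max_sqrt_diff_eq(1)[OF M N] ..

lemma opt_cost_efac: "opt_cost = (\<Sum>i\<in>UNIV. (1 - efac Q M N i)\<^sup>2 * conj_by Q M $ i $ i)"
  unfolding opt_cost_def max_sqrt_diff_eq(2)[OF M N] ..

text \<open>Wherever \<open>efac\<close> is below 1, \<open>SJ\<close> has the same diagonal entry
  as \<open>M\<close>: with positive variance of \<open>N\<close> it is
  \<open>b / t\<^sup>2 = a\<close>, and in a null direction it is copied from
  \<open>M\<close>.\<close>

lemma opt_cost_SJ: "opt_cost = (\<Sum>i\<in>UNIV. (1 - efac Q M N i)\<^sup>2 * conj_by Q SJ $ i $ i)"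
  unfolding opt_cost_efac
proof (rule sum.cong[OF refl])
  fix i
  show "(1 - efac Q M N i)\<^sup>2 * conj_by Q M $ i $ i = (1 - efac Q M N i)\<^sup>2 * conj_by Q SJ $ i $ i"
  proof (cases "0 < conj_by Q N $ i $ i \<and> dfac Q M N i \<noteq> 1")
    case True
    then have "conj_by Q N $ i $ i = (dfac Q M N i)\<^sup>2 * conj_by Q M $ i $ i"
      using max_sqrt_diff_eq(3)[OF M N, of Q i] by blast
    then show ?thesis
      using True dfac_pos[OF M, of Q N i]
      by (simp add: conj_by_J[OF M N adm refl] SigmaJ_nth[OF M N adm refl] power2_eq_square)
  next
    case False
    then show ?thesis
      by (auto simp: conj_by_J[OF M N adm refl] SigmaJ_nth[OF M N adm refl] efac_def)
  qed
qed

lemma psd_SI: "psd SI"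
  using M by (rule psd_spec_sandwich)

lemma SI_le: "SI \<le>\<^sub>L N"
  using adm admissible_iff by blast

lemma psd_SJ: "psd SJ"
  by (rule psd_J[OF M N adm refl])

lemma distr_TI: "distr (gaussian 0 M) borel ((*v) TI) = gaussian 0 SI"
  by (simp add: distr_gaussian_linear[OF M])

text \<open>\<open>shrink_sq_bound\<close> summed over the frame, the convex order bounding each
  variance of the second marginal by that of \<open>N\<close>. The extra integral measures how far a
  coupling is from the graph of \<open>TI\<close>.\<close>

lemma I2_coupling_bound:
  assumes \<eta>: "\<eta> \<in> P2" and cx: "\<eta> \<le>\<^sub>c\<^sub>x gaussian 0 N" and \<pi>: "\<pi> \<in> couplings (gaussian 0 M) \<eta>"
  shows "opt_cost + (\<integral>w. (norm (snd w - TI *v fst w))\<^sup>2 \<partial>\<pi>) \<le> transport_cost \<pi>"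
proof -
  note c = coupling_norm_sq[OF \<pi> gaussian_in_P2[OF M] \<eta> admissible_orthogonal[OF adm]]
  have "(1 - dfac Q M N i)\<^sup>2 * conj_by Q M $ i $ i +
      (\<integral>w. (column i Q \<bullet> snd w - dfac Q M N i * (column i Q \<bullet> fst w))\<^sup>2 \<partial>\<pi>)
      \<le> (\<integral>w. (column i Q \<bullet> fst w - column i Q \<bullet> snd w)\<^sup>2 \<partial>\<pi>)" for i
  proof (rule shrink_sq_bound[OF c(8,9,6,7)])
    show "conj_by Q M $ i $ i = (\<integral>w. (column i Q \<bullet> fst w)\<^sup>2 \<partial>\<pi>)"
      by (simp add: c(10) gaussian_second_moment[OF M] conj_by_nth)
    show "(\<integral>w. (column i Q \<bullet> snd w)\<^sup>2 \<partial>\<pi>) \<le> conj_by Q N $ i $ i"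
      using convex_order_second_moment[OF cx gaussian_in_P2[OF N], of "column i Q"]
      by (simp add: c(11) gaussian_second_moment[OF N] conj_by_nth)
  qed (simp_all add: dfac_bounds[OF M N] max_sqrt_diff_eq(3)[OF M N])
  then show ?thesis
    unfolding opt_cost_dfac c(1,3) sum.distrib[symmetric] by (intro sum_mono)
qed

lemma W2_SI: "(W2 (gaussian 0 M) (gaussian 0 SI))\<^sup>2 \<le> opt_cost"
proof -
  let ?\<pi> = "distr (gaussian 0 M) borel (\<lambda>x. (x, TI *v x))"
  have "?\<pi> \<in> couplings (distr (gaussian 0 M) borel (\<lambda>x. x)) (distr (gaussian 0 M) borel ((*v) TI))"
    by (rule transport_cost_distr) simp_all
  then have "?\<pi> \<in> couplings (gaussian 0 M) (gaussian 0 SI)"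
    unfolding distr_TI by (simp add: distr_id2)
  then have "(W2 (gaussian 0 M) (gaussian 0 SI))\<^sup>2 \<le> transport_cost ?\<pi>"
    by (rule W2_le_cost[OF gaussian_in_P2[OF M] gaussian_in_P2[OF psd_SI]])
  also have "transport_cost ?\<pi> = opt_cost"
    by (simp add: transport_cost_distr(2) gaussian_spec_cost[OF M admissible_orthogonal[OF adm]] opt_cost_dfac)
  finally show ?thesis .
qed

lemma I2_minimizers_eq: "I2_minimizers M N = {gaussian 0 SI}"
proof -
  have lower: "opt_cost \<le> (W2 (gaussian 0 M) \<eta>)\<^sup>2" if \<eta>: "\<eta> \<in> P2" and cx: "\<eta> \<le>\<^sub>c\<^sub>x gaussian 0 N" for \<eta>
  proof (rule W2_ge[OF gaussian_in_P2[OF M] \<eta>])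
    fix \<pi> assume "\<pi> \<in> couplings (gaussian 0 M) \<eta>"
    note I2_coupling_bound[OF \<eta> cx this]
    moreover have "0 \<le> (\<integral>w. (norm (snd w - TI *v fst w))\<^sup>2 \<partial>\<pi>)" by simp
    ultimately show "opt_cost \<le> transport_cost \<pi>" by linarith
  qed
  have feas: "gaussian 0 SI \<in> P2 \<and> gaussian 0 SI \<le>\<^sub>c\<^sub>x gaussian 0 N"
    using gaussian_in_P2[OF psd_SI] gaussian_convex_order[OF psd_SI N SI_le] by blast
  have "is_arg_min (W2 (gaussian 0 M)) (\<lambda>\<eta>. \<eta> \<in> P2 \<and> \<eta> \<le>\<^sub>c\<^sub>x gaussian 0 N) (gaussian 0 SI)"
    unfolding is_arg_min_def
  proof (intro conjI feas[THEN conjunct1] feas[THEN conjunct2] notI)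
    assume "\<exists>\<eta>. (\<eta> \<in> P2 \<and> \<eta> \<le>\<^sub>c\<^sub>x gaussian 0 N) \<and> W2 (gaussian 0 M) \<eta> < W2 (gaussian 0 M) (gaussian 0 SI)"
    then obtain \<eta> where \<eta>: "\<eta> \<in> P2" "\<eta> \<le>\<^sub>c\<^sub>x gaussian 0 N"
      "W2 (gaussian 0 M) \<eta> < W2 (gaussian 0 M) (gaussian 0 SI)" by blast
    have "(W2 (gaussian 0 M) \<eta>)\<^sup>2 < (W2 (gaussian 0 M) (gaussian 0 SI))\<^sup>2"
      using \<eta>(3) by (intro power_strict_mono) (simp_all add: W2_nonneg)
    then show False using W2_SI lower[OF \<eta>(1,2)] by linarith
  qed
  moreover have "\<eta> = gaussian 0 SI"
    if "is_arg_min (W2 (gaussian 0 M)) (\<lambda>\<eta>. \<eta> \<in> P2 \<and> \<eta> \<le>\<^sub>c\<^sub>x gaussian 0 N) \<eta>" for \<eta>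
  proof -
    have \<eta>: "\<eta> \<in> P2" "\<eta> \<le>\<^sub>c\<^sub>x gaussian 0 N" "W2 (gaussian 0 M) \<eta> \<le> W2 (gaussian 0 M) (gaussian 0 SI)"
      using that feas unfolding is_arg_min_def by (auto simp: not_less)
    have "(W2 (gaussian 0 M) \<eta>)\<^sup>2 \<le> (W2 (gaussian 0 M) (gaussian 0 SI))\<^sup>2"
      using \<eta>(3) by (intro power_mono) (simp_all add: W2_nonneg)
    then have le: "(W2 (gaussian 0 M) \<eta>)\<^sup>2 \<le> opt_cost" using W2_SI by linarith
    show ?thesis
    \<comment> \<open>Under a coupling within \<open>\<epsilon>\<close> of the optimal cost the
      second marginal is within \<open>\<epsilon>\<close> in mean square of \<open>TI\<close>
      applied to the first, whose law is the same for every coupling.\<close>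
    proof (rule law_eq_of_close)
      fix \<epsilon> :: real assume "0 < \<epsilon>"
      then obtain \<pi> where \<pi>: "\<pi> \<in> couplings (gaussian 0 M) \<eta>" and cost: "transport_cost \<pi> < opt_cost + \<epsilon>"
        using W2_approx_coupling[OF gaussian_in_P2[OF M] \<eta>(1) order_le_less_trans[OF le]]
        by (metis less_add_same_cancel1)
      note c = couplings_P2[OF \<pi> gaussian_in_P2[OF M] \<eta>(1)]
      note [measurable] = coupling_measurable[OF c(1)]
      have "distr \<pi> borel (\<lambda>w. TI *v fst w) = gaussian 0 SI"
        using distr_distr[of "(*v) TI" borel borel fst \<pi>] by (simp add: c(3) distr_TI comp_def)
      moreover have "distr \<pi> borel snd = \<eta>" by (rule c(4))
      moreover have "(\<integral>w. (norm (snd w - TI *v fst w))\<^sup>2 \<partial>\<pi>) \<le> \<epsilon>"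
        using I2_coupling_bound[OF \<eta>(1,2) \<pi>] cost by linarith
      moreover have "integrable \<pi> (\<lambda>w. (norm (snd w - TI *v fst w))\<^sup>2)"
        by (rule coupling_norm_sq(2)[OF \<pi> gaussian_in_P2[OF M] \<eta>(1) admissible_orthogonal[OF adm]])
      moreover have "snd \<in> borel_measurable \<pi>" "(\<lambda>w. TI *v fst w) \<in> borel_measurable \<pi>" by measurable
      ultimately show "\<exists>(\<pi> :: ((real^'n) \<times> (real^'n)) measure) X Y. prob_space \<pi> \<and>
          X \<in> borel_measurable \<pi> \<and> Y \<in> borel_measurable \<pi> \<and> distr \<pi> borel X = \<eta> \<and>
          distr \<pi> borel Y = gaussian 0 SI \<and> integrable \<pi> (\<lambda>w. (norm (X w - Y w))\<^sup>2) \<and>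
          (\<integral>w. (norm (X w - Y w))\<^sup>2 \<partial>\<pi>) \<le> \<epsilon>"
        using c(2) by blast
    qed
  qed
  ultimately show ?thesis unfolding I2_minimizers_def by blast
qed

lemma I2_eq: "I2 M N = SI"
  unfolding I2_def I2_minimizers_eq
proof (rule the_equality)
  show "S = SI" if "psd S \<and> {gaussian 0 SI} = {gaussian 0 S}" for S
    using that gaussian_inj[OF psd_SI, of S] by simp
qed (simp add: psd_SI)

lemma bw_I2: "(bw M SI)\<^sup>2 = opt_cost"
  using bw_spec[OF M admissible_orthogonal[OF adm] dfac_bounds(1)[OF M N]] by (simp add: opt_cost_dfac)

text \<open>\<open>stretch_sq_bound\<close> summed over the frame. The last sum keeps the excess of
  the variances of \<open>\<eta>\<close> over those of \<open>M\<close>, information that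
  \<open>TJ\<close> loses in the directions it kills.\<close>

lemma J2_coupling_bound:
  assumes \<eta>: "\<eta> \<in> P2" and cx: "gaussian 0 M \<le>\<^sub>c\<^sub>x \<eta>" and \<pi>: "\<pi> \<in> couplings (gaussian 0 N) \<eta>"
  shows "opt_cost + (\<integral>w. (norm (fst w - TJ *v snd w))\<^sup>2 \<partial>\<pi>) +
    (\<Sum>i\<in>UNIV. (1 - efac Q M N i) * ((\<integral>x. (column i Q \<bullet> x)\<^sup>2 \<partial>\<eta>) - conj_by Q M $ i $ i)) \<le> transport_cost \<pi>"
proof -
  note c = coupling_norm_sq[OF \<pi> gaussian_in_P2[OF N] \<eta> admissible_orthogonal[OF adm]]
  have "(1 - efac Q M N i)\<^sup>2 * conj_by Q M $ i $ i +
      (\<integral>w. (column i Q \<bullet> fst w - efac Q M N i * (column i Q \<bullet> snd w))\<^sup>2 \<partial>\<pi>) +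
      (1 - efac Q M N i) * ((\<integral>x. (column i Q \<bullet> x)\<^sup>2 \<partial>\<eta>) - conj_by Q M $ i $ i)
      \<le> (\<integral>w. (column i Q \<bullet> fst w - column i Q \<bullet> snd w)\<^sup>2 \<partial>\<pi>)" for i
  proof (rule stretch_sq_bound[OF c(8,9,6,7)])
    show "conj_by Q M $ i $ i \<le> (\<integral>x. (column i Q \<bullet> x)\<^sup>2 \<partial>\<eta>)"
      using convex_order_second_moment[OF cx \<eta>, of "column i Q"]
      by (simp add: gaussian_second_moment[OF M] conj_by_nth)
    show "efac Q M N i = 1 \<or> (\<integral>w. (column i Q \<bullet> fst w)\<^sup>2 \<partial>\<pi>) = (efac Q M N i)\<^sup>2 * conj_by Q M $ i $ i"
      using max_sqrt_diff_eq(4)[OF M N, of Q i]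
      by (simp add: c(10) gaussian_second_moment[OF N] conj_by_nth)
  qed (simp_all add: efac_bounds[OF M N] conj_by_diag_nonneg[OF M] c(11))
  then show ?thesis
    unfolding opt_cost_efac c(1,5) sum.distrib[symmetric] by (intro sum_mono)
qed

lemma distr_TJ: "distr (gaussian 0 SJ) borel ((*v) TJ) = gaussian 0 N"
  using spec_sandwich_J[OF M N adm refl] by (simp add: distr_gaussian_linear[OF psd_SJ])

lemma W2_SJ: "(W2 (gaussian 0 N) (gaussian 0 SJ))\<^sup>2 \<le> opt_cost"
proof -
  \<comment> \<open>The coupling is a graph over its second marginal, since \<open>TJ\<close> may be
    singular and maps the projection to \<open>N\<close>.\<close>
  let ?\<pi> = "distr (gaussian 0 SJ) borel (\<lambda>x. (TJ *v x, x))"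
  have "?\<pi> \<in> couplings (distr (gaussian 0 SJ) borel ((*v) TJ)) (distr (gaussian 0 SJ) borel (\<lambda>x. x))"
    by (rule transport_cost_distr) simp_all
  then have "?\<pi> \<in> couplings (gaussian 0 N) (gaussian 0 SJ)"
    unfolding distr_TJ by (simp add: distr_id2)
  then have "(W2 (gaussian 0 N) (gaussian 0 SJ))\<^sup>2 \<le> transport_cost ?\<pi>"
    by (rule W2_le_cost[OF gaussian_in_P2[OF N] gaussian_in_P2[OF psd_SJ]])
  also have "transport_cost ?\<pi> = opt_cost"
    by (simp add: transport_cost_distr(2) norm_minus_commute[of "TJ *v _"]
        gaussian_spec_cost[OF psd_SJ admissible_orthogonal[OF adm]] opt_cost_SJ)
  finally show ?thesis .
qed

lemma J2_minimizer: "gaussian 0 SJ \<in> J2_minimizers N M"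
  and J2_minimizer_cost: "\<eta> \<in> J2_minimizers N M \<Longrightarrow> \<eta> \<in> P2 \<and> gaussian 0 M \<le>\<^sub>c\<^sub>x \<eta> \<and> (W2 (gaussian 0 N) \<eta>)\<^sup>2 \<le> opt_cost"
proof -
  have lower: "opt_cost \<le> (W2 (gaussian 0 N) \<eta>)\<^sup>2" if \<eta>: "\<eta> \<in> P2" and cx: "gaussian 0 M \<le>\<^sub>c\<^sub>x \<eta>" for \<eta>
  proof (rule W2_ge[OF gaussian_in_P2[OF N] \<eta>])
    fix \<pi> assume "\<pi> \<in> couplings (gaussian 0 N) \<eta>"
    note b = J2_coupling_bound[OF \<eta> cx this]
    have "0 \<le> (\<Sum>i\<in>UNIV. (1 - efac Q M N i) * ((\<integral>x. (column i Q \<bullet> x)\<^sup>2 \<partial>\<eta>) - conj_by Q M $ i $ i))"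
      using convex_order_second_moment[OF cx \<eta>, of "column _ Q"]
      by (intro sum_nonneg mult_nonneg_nonneg)
         (simp_all add: efac_bounds[OF M N] gaussian_second_moment[OF M] conj_by_nth)
    moreover have "0 \<le> (\<integral>w. (norm (fst w - TJ *v snd w))\<^sup>2 \<partial>\<pi>)" by simp
    ultimately show "opt_cost \<le> transport_cost \<pi>" using b by linarith
  qed
  have feas: "gaussian 0 SJ \<in> P2" "gaussian 0 M \<le>\<^sub>c\<^sub>x gaussian 0 SJ"
    using gaussian_in_P2[OF psd_SJ] gaussian_convex_order[OF M psd_SJ le_J[OF M N adm refl]] by blast+
  show "gaussian 0 SJ \<in> J2_minimizers N M"
    unfolding J2_minimizers_def mem_Collect_eq is_arg_min_def
  proof (intro conjI feas notI)
    assume "\<exists>\<eta>. (\<eta> \<in> P2 \<and> gaussian 0 M \<le>\<^sub>c\<^sub>x \<eta>) \<and> W2 (gaussian 0 N) \<eta> < W2 (gaussian 0 N) (gaussian 0 SJ)"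
    then obtain \<eta> where \<eta>: "\<eta> \<in> P2" "gaussian 0 M \<le>\<^sub>c\<^sub>x \<eta>"
      "W2 (gaussian 0 N) \<eta> < W2 (gaussian 0 N) (gaussian 0 SJ)" by blast
    have "(W2 (gaussian 0 N) \<eta>)\<^sup>2 < (W2 (gaussian 0 N) (gaussian 0 SJ))\<^sup>2"
      using \<eta>(3) by (intro power_strict_mono) (simp_all add: W2_nonneg)
    then show False using W2_SJ lower[OF \<eta>(1,2)] by linarith
  qed
  assume "\<eta> \<in> J2_minimizers N M"
  then have \<eta>: "\<eta> \<in> P2" "gaussian 0 M \<le>\<^sub>c\<^sub>x \<eta>" "W2 (gaussian 0 N) \<eta> \<le> W2 (gaussian 0 N) (gaussian 0 SJ)"
    using feas unfolding J2_minimizers_def is_arg_min_def by (auto simp: not_less)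
  have "(W2 (gaussian 0 N) \<eta>)\<^sup>2 \<le> (W2 (gaussian 0 N) (gaussian 0 SJ))\<^sup>2"
    using \<eta>(3) by (intro power_mono) (simp_all add: W2_nonneg)
  then show "\<eta> \<in> P2 \<and> gaussian 0 M \<le>\<^sub>c\<^sub>x \<eta> \<and> (W2 (gaussian 0 N) \<eta>)\<^sup>2 \<le> opt_cost"
    using W2_SJ \<eta> by linarith
qed

text \<open>Closeness only fixes the law of the image under \<open>TJ\<close>, which need not
  determine the minimizer itself. For a Gaussian one the vanishing variance excess supplies what is
  missing, and \<open>J_unique\<close> applies.\<close>

lemma J2_gaussian_minimizer_unique:
  assumes min: "gaussian m S \<in> J2_minimizers N M" and S: "psd S"
  shows "m = 0" "S = SJ"
proof -
  define \<eta> where "\<eta> = gaussian m S"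
  have \<eta>: "\<eta> \<in> P2" "gaussian 0 M \<le>\<^sub>c\<^sub>x \<eta>" "(W2 (gaussian 0 N) \<eta>)\<^sup>2 \<le> opt_cost"
    using J2_minimizer_cost[OF min] by (simp_all add: \<eta>_def)
  \<comment> \<open>Linear functionals are convex; testing with \<open>- m\<close> against a centred
    Gaussian makes the mean vanish.\<close>
  have "0 \<le> - m \<bullet> m"
    using convex_order_mean_le[OF \<eta>(2,1), of "- m"]
    by (simp only: \<eta>_def gaussian_dot(2)[OF M] gaussian_dot(2)[OF S] inner_zero_right)
  then have "m \<bullet> m = 0" using inner_ge_zero[of m] by simp
  then show m: "m = 0" by simp
  have mom: "(\<integral>x. (u \<bullet> x)\<^sup>2 \<partial>\<eta>) = u \<bullet> (S *v u)" for u
    by (simp add: \<eta>_def m gaussian_second_moment[OF S])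
  have le: "M \<le>\<^sub>L S"
    using convex_order_second_moment[OF \<eta>(2,1)] loewner_le_dot[OF M S]
    by (simp add: mom gaussian_second_moment[OF M])
  define g where "g i = (1 - efac Q M N i) * (conj_by Q S $ i $ i - conj_by Q M $ i $ i)" for i
  have g0: "0 \<le> g i" for i
    using le loewner_le_dot[OF M S] by (simp add: g_def efac_bounds[OF M N] conj_by_nth)
  have close: "\<exists>\<pi>\<in>couplings (gaussian 0 N) \<eta>. (\<integral>w. (norm (fst w - TJ *v snd w))\<^sup>2 \<partial>\<pi>) + sum g UNIV \<le> \<epsilon>"
    if eps: "0 < \<epsilon>" for \<epsilon>
  proof -
    obtain \<pi> where \<pi>: "\<pi> \<in> couplings (gaussian 0 N) \<eta>" and cost: "transport_cost \<pi> < opt_cost + \<epsilon>"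
      using W2_approx_coupling[OF gaussian_in_P2[OF N] \<eta>(1) order_le_less_trans[OF \<eta>(3)]] eps
      by (metis less_add_same_cancel1)
    have "opt_cost + (\<integral>w. (norm (fst w - TJ *v snd w))\<^sup>2 \<partial>\<pi>) + sum g UNIV \<le> transport_cost \<pi>"
      using J2_coupling_bound[OF \<eta>(1,2) \<pi>] by (simp add: mom g_def conj_by_nth)
    then show ?thesis using \<pi> cost by (intro bexI[of _ \<pi>]) simp_all
  qed
  \<comment> \<open>The excess does not depend on the coupling, yet is at most every positive
    \<open>\<epsilon>\<close>; each of its nonnegative terms is therefore 0.\<close>
  have "sum g UNIV \<le> 0"
  proof (rule field_le_epsilon)
    fix \<epsilon> :: real assume "0 < \<epsilon>"
    then obtain \<pi> where "(\<integral>w. (norm (fst w - TJ *v snd w))\<^sup>2 \<partial>\<pi>) + sum g UNIV \<le> \<epsilon>"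
      using close by blast
    moreover have "0 \<le> (\<integral>w. (norm (fst w - TJ *v snd w))\<^sup>2 \<partial>\<pi>)" by simp
    ultimately show "sum g UNIV \<le> 0 + \<epsilon>" by linarith
  qed
  then have "g i = 0" for i
    using g0 sum_nonneg_eq_0_iff[of UNIV g] sum_nonneg[of UNIV g] by simp
  then have diag: "conj_by Q S $ i $ i = conj_by Q M $ i $ i" if "efac Q M N i < 1" for i
    using that unfolding g_def by (metis diff_gt_0_iff_gt eq_iff_diff_eq_0 less_irrefl mult_eq_0_iff)
  have "gaussian 0 N = gaussian 0 (TJ ** S ** TJ)"
  proof (rule law_eq_of_close)
    fix \<epsilon> :: real assume "0 < \<epsilon>"
    then obtain \<pi> where \<pi>: "\<pi> \<in> couplings (gaussian 0 N) \<eta>"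
      and cost: "(\<integral>w. (norm (fst w - TJ *v snd w))\<^sup>2 \<partial>\<pi>) + sum g UNIV \<le> \<epsilon>"
      using close by blast
    note c = couplings_P2[OF \<pi> gaussian_in_P2[OF N] \<eta>(1)]
    note [measurable] = coupling_measurable[OF c(1)]
    have "distr \<pi> borel (\<lambda>w. TJ *v snd w) = gaussian 0 (TJ ** S ** TJ)"
      using distr_distr[of "(*v) TJ" borel borel snd \<pi>] distr_gaussian_linear[OF S, of TJ]
      by (simp add: c(4) comp_def \<eta>_def m)
    moreover have "distr \<pi> borel fst = gaussian 0 N" by (rule c(3))
    moreover have "(\<integral>w. (norm (fst w - TJ *v snd w))\<^sup>2 \<partial>\<pi>) \<le> \<epsilon>"
      using cost sum_nonneg[of UNIV g] g0 by simp
    moreover have "integrable \<pi> (\<lambda>w. (norm (fst w - TJ *v snd w))\<^sup>2)"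
      by (rule coupling_norm_sq(4)[OF \<pi> gaussian_in_P2[OF N] \<eta>(1) admissible_orthogonal[OF adm]])
    moreover have "fst \<in> borel_measurable \<pi>" "(\<lambda>w. TJ *v snd w) \<in> borel_measurable \<pi>" by measurable
    ultimately show "\<exists>(\<pi> :: ((real^'n) \<times> (real^'n)) measure) X Y. prob_space \<pi> \<and>
        X \<in> borel_measurable \<pi> \<and> Y \<in> borel_measurable \<pi> \<and> distr \<pi> borel X = gaussian 0 N \<and>
        distr \<pi> borel Y = gaussian 0 (TJ ** S ** TJ) \<and> integrable \<pi> (\<lambda>w. (norm (X w - Y w))\<^sup>2) \<and>
        (\<integral>w. (norm (X w - Y w))\<^sup>2 \<partial>\<pi>) \<le> \<epsilon>"
      using c(2) by blast
  qed
  then have "TJ ** S ** TJ = N"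
    using gaussian_inj[OF N psd_spec_sandwich[OF S]] by metis
  then show "S = SJ"
    using J_unique[OF M N adm refl S le _ diag] by blast
qed

lemma J2_eq: "J2 N M = SJ"
  unfolding J2_def
proof (rule the_equality)
  have *: "J2_minimizers N M \<inter> {gaussian m S' |m S'. psd S'} = {gaussian 0 SJ}"
    using J2_minimizer J2_gaussian_minimizer_unique psd_SJ by blast
  show "psd SJ \<and> J2_minimizers N M \<inter> {gaussian m S' |m S'. psd S'} = {gaussian 0 SJ}"
    using psd_SJ * by blast
  show "S = SJ" if "psd S \<and> J2_minimizers N M \<inter> {gaussian m S' |m S'. psd S'} = {gaussian 0 S}" for S
    using that gaussian_inj[OF psd_SJ, of S] unfolding * by simp
qed

text \<open>\<open>N\<close> is the sandwich of \<open>SJ\<close> by \<open>TJ\<close>, so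
  \<open>bw_spec\<close> evaluates the distance from \<open>SJ\<close> to \<open>N\<close>; symmetry
  reverses it.\<close>

lemma bw_J2: "(bw N SJ)\<^sup>2 = opt_cost"
  using bw_spec[OF psd_SJ admissible_orthogonal[OF adm], of "efac Q M N"] efac_bounds(1)[OF M N, of Q] bw_commute[OF N psd_SJ]
    spec_sandwich_J[OF M N adm refl] by (simp add: opt_cost_SJ)

end

theorem theorem4p1:
  fixes \<Sigma>\<mu> \<Sigma>\<nu> :: "real^'n^'n"
  assumes "psd \<Sigma>\<mu>" and "psd \<Sigma>\<nu>"
  shows "(\<exists>Q. admissible Q \<Sigma>\<mu> \<Sigma>\<nu>) \<and>
    (\<forall>Q. admissible Q \<Sigma>\<mu> \<Sigma>\<nu> \<longrightarrow>
       I2 \<Sigma>\<mu> \<Sigma>\<nu> =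
         Q ** Dmat Q \<Sigma>\<mu> \<Sigma>\<nu> ** transpose Q ** \<Sigma>\<mu> ** Q ** Dmat Q \<Sigma>\<mu> \<Sigma>\<nu> ** transpose Q \<and>
       (bw \<Sigma>\<mu> (I2 \<Sigma>\<mu> \<Sigma>\<nu>))\<^sup>2 =
         (\<Sum>i\<in>UNIV. (max (sqrt (conj_by Q \<Sigma>\<mu> $ i $ i) - sqrt (conj_by Q \<Sigma>\<nu> $ i $ i)) 0)\<^sup>2) \<and>
       (bw \<Sigma>\<nu> (J2 \<Sigma>\<nu> \<Sigma>\<mu>))\<^sup>2 =
         (\<Sum>i\<in>UNIV. (max (sqrt (conj_by Q \<Sigma>\<mu> $ i $ i) - sqrt (conj_by Q \<Sigma>\<nu> $ i $ i)) 0)\<^sup>2) \<and>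
       J2 \<Sigma>\<nu> \<Sigma>\<mu> = Q ** SigmaJ Q \<Sigma>\<mu> \<Sigma>\<nu> ** transpose Q)"
proof (intro conjI allI impI)
  show "\<exists>Q. admissible Q \<Sigma>\<mu> \<Sigma>\<nu>" using assms by (rule admissible_exists)
next
  fix Q assume adm: "admissible Q \<Sigma>\<mu> \<Sigma>\<nu>"
  note ctx = assms adm
  show "I2 \<Sigma>\<mu> \<Sigma>\<nu> = Q ** Dmat Q \<Sigma>\<mu> \<Sigma>\<nu> ** transpose Q ** \<Sigma>\<mu> ** Q ** Dmat Q \<Sigma>\<mu> \<Sigma>\<nu> ** transpose Q"
    unfolding I2_eq[OF ctx] by (simp add: spec_def Dmat_eq matrix_mul_assoc)
  show "(bw \<Sigma>\<mu> (I2 \<Sigma>\<mu> \<Sigma>\<nu>))\<^sup>2 =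
      (\<Sum>i\<in>UNIV. (max (sqrt (conj_by Q \<Sigma>\<mu> $ i $ i) - sqrt (conj_by Q \<Sigma>\<nu> $ i $ i)) 0)\<^sup>2)"
    unfolding I2_eq[OF ctx] bw_I2[OF ctx] opt_cost_def[OF ctx] ..
  show "J2 \<Sigma>\<nu> \<Sigma>\<mu> = Q ** SigmaJ Q \<Sigma>\<mu> \<Sigma>\<nu> ** transpose Q" by (rule J2_eq[OF ctx])
  show "(bw \<Sigma>\<nu> (J2 \<Sigma>\<nu> \<Sigma>\<mu>))\<^sup>2 =
      (\<Sum>i\<in>UNIV. (max (sqrt (conj_by Q \<Sigma>\<mu> $ i $ i) - sqrt (conj_by Q \<Sigma>\<nu> $ i $ i)) 0)\<^sup>2)"
    unfolding J2_eq[OF ctx] bw_J2[OF ctx] opt_cost_def[OF ctx] ..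
qed

end
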